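(* Let $w\in C^{1/2}(B_1)$ be $1/2$-Hölder continuous on $B_1\subset\mathbb R^{n+1}$, $w\ge0$, with $w$ harmonic in $B_1^+(w)$. (i) If $0\in F(w)$ and $\mathcal B_{1/2}(\tfrac12e_n)\subset B_1^+(w)$, then $$w(X)=\alpha U(X)+o(|X|^{1/2})\quad\text{as }X\to0,\quad\text{for some }\alpha>0.$$ (ii) If $0\in F(w)$ and $\mathcal B_{1/2}(-\tfrac12e_n)\subset\{w=0\}$, then the same expansion holds for some $\alpha\ge0$.
   Context: Points of $\mathbb R^{n+1}$ are written $X=(x,s)\in\mathbb R^n\times\mathbb R$, $x=(x',x_n)$; $e_n$ is the unit vector in the $x_n$-direction. $B_r=B_r(0)$ is a ball in $\mathbb R^{n+1}$, and $\mathcal B_r(x_0)$ is the ball in $\mathbb R^n$ (identified with $\{s=0\}$) of radius $r$ centered at $x_0$; $\mathcal B_r=\mathcal B_r(0)$. For a continuous $w\ge0$ on $B_1$: $B_1^+(w)=B_1\setminus\{(x,0):w(x,0)=0\}$ and $F(w)=\partial_{\mathbb R^n}\{x\in\mathcal B_1:w(x,0)>0\}\cap\mathcal B_1$. $U(t,s)=\rho^{1/2}\cos(\beta/2)$ where $t=\rho\cos\beta$, $s=\rho\sin\beta$, $\rho\ge0$, $-\pi\le\beta\le\pi$ (the real part of $\sqrt{t+is}$), and $U(X):=U(x_n,s)$. *)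

theory Defs
  imports "HOL-Analysis.Analysis" "HOL-Library.Landau_Symbols"
begin

definition holder_on :: "real \<Rightarrow> 'a::metric_space set \<Rightarrow> ('a \<Rightarrow> 'b::metric_space) \<Rightarrow> bool" where
  "holder_on a S f \<longleftrightarrow> (\<exists>C. \<forall>x\<in>S. \<forall>y\<in>S. dist (f x) (f y) \<le> C * dist x y powr a)"

text \<open>Derivatives are taken in the full space, so the next two notions are meant for open \<open>S\<close>;
  \<open>f'\<close> and \<open>f''\<close> are the first and second Frechet derivatives.\<close>

definition C2_on :: "'a::euclidean_space set \<Rightarrow> ('a \<Rightarrow> real) \<Rightarrow> bool" where
  "C2_on S f \<longleftrightarrow>
     (\<exists>(f' :: 'a \<Rightarrow> 'a \<Rightarrow>\<^sub>L real) (f'' :: 'a \<Rightarrow> 'a \<Rightarrow>\<^sub>L 'a \<Rightarrow>\<^sub>L real).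
        (\<forall>x\<in>S. (f has_derivative blinfun_apply (f' x)) (at x)) \<and>
        (\<forall>x\<in>S. (f' has_derivative blinfun_apply (f'' x)) (at x)) \<and>
        continuous_on S f'')"

definition laplacian :: "('a::euclidean_space \<Rightarrow> real) \<Rightarrow> 'a \<Rightarrow> real" where
  "laplacian f x = (\<Sum>b\<in>Basis. (deriv ^^ 2) (\<lambda>t. f (x + t *\<^sub>R b)) 0)"

definition harmonic_on :: "'a::euclidean_space set \<Rightarrow> ('a \<Rightarrow> real) \<Rightarrow> bool" where
  "harmonic_on S f \<longleftrightarrow> C2_on S f \<and> (\<forall>x\<in>S. laplacian f x = 0)"

text \<open>\<open>B\<^sub>1\<^sup>+(w)\<close>, \<open>{w = 0}\<close> and \<open>F(w)\<close>. Points \<open>X = (x, s)\<close> are pairs, with the Euclidean norm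
  on the product; \<open>x\<close> is identified with \<open>(x, 0)\<close>.\<close>

definition Bplus :: "('a::euclidean_space \<times> real \<Rightarrow> real) \<Rightarrow> ('a \<times> real) set" where
  "Bplus w = ball 0 1 - {(x, 0) | x. w (x, 0) = 0}"

definition zero_set :: "('a::euclidean_space \<times> real \<Rightarrow> real) \<Rightarrow> ('a \<times> real) set" where
  "zero_set w = {X \<in> ball 0 1. w X = 0}"

definition free_bdry :: "('a::euclidean_space \<times> real \<Rightarrow> real) \<Rightarrow> 'a set" where
  "free_bdry w = frontier {x \<in> ball 0 1. w (x, 0) > 0} \<inter> ball 0 1"

text \<open>\<open>Arg\<close> takes values in \<open>{-pi<..pi}\<close>. On the negative real axis the angles \<open>pi\<close> and \<open>-pi\<close> give
  the same value, so this is the function determined by all polar angles in \<open>{-pi..pi}\<close>.\<close>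

definition U_half :: "real \<Rightarrow> real \<Rightarrow> real" where
  "U_half t s = sqrt (cmod (Complex t s)) * cos (Arg (Complex t s) / 2)"

lemma U_half_polar:
  assumes "\<rho> \<ge> 0" "- pi \<le> \<beta>" "\<beta> \<le> pi"
  shows "U_half (\<rho> * cos \<beta>) (\<rho> * sin \<beta>) = sqrt \<rho> * cos (\<beta> / 2)"
proof (cases "\<rho> = 0")
  case False
  with assms have pos: "\<rho> > 0" by simp
  have eq: "Complex (\<rho> * cos \<beta>) (\<rho> * sin \<beta>) = rcis \<rho> \<beta>"
    by (simp add: complex_eq_iff)
  show ?thesis
  proof (cases "\<beta> = - pi")
    case True
    have "rcis \<rho> \<beta> = - complex_of_real \<rho>"
      using True by (simp add: complex_eq_iff)
    moreover have "Arg (- complex_of_real \<rho>) = pi"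
      using pos by (metis Arg_of_real neg_less_0_iff_less of_real_minus)
    ultimately show ?thesis
      using True eq pos by (simp add: U_half_def)
  next
    case False
    have "Arg (rcis \<rho> \<beta>) = \<beta>"
      using False assms pos by (intro Arg_unique[of \<rho>]) (auto simp: rcis_def cis_conv_exp)
    then show ?thesis
      using eq pos by (simp add: U_half_def)
  qed
qed (simp add: U_half_def zero_complex.code [symmetric])

definition U :: "'n::finite \<Rightarrow> (real ^ 'n) \<times> real \<Rightarrow> real" where
  "U n X = U_half (fst X $ n) (snd X)"

text \<open>\<open>w(X) = a U(X) + o(|X|\<^sup>1\<^sup>/\<^sup>2)\<close> as \<open>X \<rightarrow> 0\<close>.\<close>

definition U_expansion :: "'n::finite \<Rightarrow> ((real ^ 'n) \<times> real \<Rightarrow> real) \<Rightarrow> real \<Rightarrow> bool" where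
  "U_expansion n w a \<longleftrightarrow> (\<lambda>X. w X - a * U n X) \<in> o[at 0](\<lambda>X. norm X powr (1/2))"

end

(* After an inversion (Kelvin transform) centred at the pole opposite to 0, the ball tangent at 0
   becomes a half space, so w becomes a function that off the slit {s = 0, t <= 0} is harmonic
   (case i), or vanishes on the slit and is subharmonic off it (case ii, where an explicit quadratic
   barrier then gives w <= M U near 0 and one passes to M U - w).
   In either case one is left with a 1/2-Hoelder v >= 0, v(0) = 0, that is superharmonic off the
   slit. Let alpha be the supremum of the m with v >= m U near 0. If v - alpha U were at least
   eps |X|^(1/2) at points X -> 0, then for m close to alpha the rescaled v - m U is at least eps
   at some point of the unit sphere, hence, by Hoelder continuity, on a ball of fixed size.
   Hopf-type barriers propagate this to v - m U >= c U near 0 with c independent of m and X,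
   and m + c > alpha is a contradiction. *)
theory Submission
  imports Defs
begin

text \<open>Uniformity shapes the proof. The step from m to m + c needs c fixed before m and the
  scale, so every positivity estimate binds its constants ahead of the function and the point, and
  explicit barriers stand in for compactness. Rescaling costs nothing because the Hoelder seminorm,
  \<open>root\<close> and the error to be excluded all have homogeneity 1/2. Every estimate is one
  comparison of a smooth strict subsolution with a supersolution, proved by the second derivative
  test, so a pointwise Laplacian along basis lines is enough. The obstacle is the edge of the slit:
  Hopf barriers on half balls give lower bounds that are linear there, whereas \<open>root\<close>
  is of order 1/2. The product barrier \<open>root * q\<close> on a thin cylinder about the edge
  closes this gap. The two cases differ in what the slit offers. In (i) w may be positive on it,
  which is harmless in a comparison from below with a function that vanishes there. In (ii) w may
  also vanish off the slit, so it is only subharmonic and must first be bounded above by a multiple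
  of U. A single point with w > 0 near 0 makes \<alpha> positive in (i).\<close>

section \<open>Gradient, Laplacian and comparison\<close>

text \<open>\<open>g\<close> and \<open>l\<close> are the gradient and the Laplacian of \<open>u\<close> at \<open>x\<close>. Only the second derivatives along
  the basis directions are required: this is all that the test at an interior minimum uses.\<close>

definition has_lap :: "('a::euclidean_space \<Rightarrow> real) \<Rightarrow> 'a \<Rightarrow> 'a \<Rightarrow> real \<Rightarrow> bool" where
  "has_lap u x g l \<longleftrightarrow> (\<exists>p q.
     (\<forall>b\<in>Basis. (\<forall>\<^sub>F \<tau> in nhds 0. ((\<lambda>\<tau>. u (x + \<tau> *\<^sub>R b)) has_real_derivative p b \<tau>) (at \<tau>)) \<and>
        (p b has_real_derivative q b) (at 0) \<and> p b 0 = g \<bullet> b) \<and>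
     l = (\<Sum>b\<in>Basis. q b))"

lemma has_lapI:
  assumes "\<And>b. b \<in> Basis \<Longrightarrow> \<forall>\<^sub>F \<tau> in nhds 0. ((\<lambda>\<tau>. u (x + \<tau> *\<^sub>R b)) has_real_derivative p b \<tau>) (at \<tau>)"
    and "\<And>b. b \<in> Basis \<Longrightarrow> (p b has_real_derivative q b) (at 0)"
    and "\<And>b. b \<in> Basis \<Longrightarrow> p b 0 = g \<bullet> b"
    and "l = (\<Sum>b\<in>Basis. q b)"
  shows "has_lap u x g l"
  using assms unfolding has_lap_def by blast

lemma has_lapE:
  assumes "has_lap u x g l"
  obtains p q where
    "\<And>b. b \<in> Basis \<Longrightarrow> \<forall>\<^sub>F \<tau> in nhds 0. ((\<lambda>\<tau>. u (x + \<tau> *\<^sub>R b)) has_real_derivative p b \<tau>) (at \<tau>)"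
    "\<And>b. b \<in> Basis \<Longrightarrow> (p b has_real_derivative q b) (at 0)"
    "\<And>b. b \<in> Basis \<Longrightarrow> p b 0 = g \<bullet> b"
    "l = (\<Sum>b\<in>Basis. q b)"
  using assms unfolding has_lap_def by blast

section \<open>Calculus of pointwise Laplacians\<close>

lemma has_lap_const [intro]: "has_lap (\<lambda>x. c) x 0 0"
  by (rule has_lapI[where p = "\<lambda>b \<tau>. 0" and q = "\<lambda>b. 0"]) auto

lemma has_lap_linear: "has_lap (\<lambda>x. x \<bullet> v) x v 0"
  by (rule has_lapI[where p = "\<lambda>b \<tau>. v \<bullet> b" and q = "\<lambda>b. 0"])
    (auto simp: inner_add_left inner_commute[of v] intro!: derivative_eq_intros always_eventually)

lemma has_lap_dist_sq:
  fixes x P :: "'a::euclidean_space"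
  shows "has_lap (\<lambda>x. (x - P) \<bullet> (x - P)) x (2 *\<^sub>R (x - P)) (2 * DIM('a))"
proof (rule has_lapI[where p = "\<lambda>b \<tau>. 2 * ((x - P) \<bullet> b) + 2 * \<tau>" and q = "\<lambda>b. 2"])
  fix b :: 'a assume b: "b \<in> Basis"
  have "(\<lambda>\<tau>. (x + \<tau> *\<^sub>R b - P) \<bullet> (x + \<tau> *\<^sub>R b - P)) =
    (\<lambda>\<tau>. (x - P) \<bullet> (x - P) + 2 * ((x - P) \<bullet> b) * \<tau> + \<tau> * \<tau>)"
    using b by (auto simp: algebra_simps inner_commute fun_eq_iff)
  then show "\<forall>\<^sub>F \<tau> in nhds 0. ((\<lambda>\<tau>. (x + \<tau> *\<^sub>R b - P) \<bullet> (x + \<tau> *\<^sub>R b - P)) has_real_derivative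
      2 * ((x - P) \<bullet> b) + 2 * \<tau>) (at \<tau>)"
    by (auto intro!: always_eventually derivative_eq_intros)
qed (auto intro!: derivative_eq_intros)

lemma has_lap_add:
  assumes "has_lap u x g l" "has_lap v x h m"
  shows "has_lap (\<lambda>x. u x + v x) x (g + h) (l + m)"
proof -
  from assms(1) obtain p q where 1:
    "\<And>b. b \<in> Basis \<Longrightarrow> \<forall>\<^sub>F \<tau> in nhds 0. ((\<lambda>\<tau>. u (x + \<tau> *\<^sub>R b)) has_real_derivative p b \<tau>) (at \<tau>)"
    "\<And>b. b \<in> Basis \<Longrightarrow> (p b has_real_derivative q b) (at 0)"
    "\<And>b. b \<in> Basis \<Longrightarrow> p b 0 = g \<bullet> b"
    "l = (\<Sum>b\<in>Basis. q b)" by (elim has_lapE) blast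
  from assms(2) obtain p' q' where 2:
    "\<And>b. b \<in> Basis \<Longrightarrow> \<forall>\<^sub>F \<tau> in nhds 0. ((\<lambda>\<tau>. v (x + \<tau> *\<^sub>R b)) has_real_derivative p' b \<tau>) (at \<tau>)"
    "\<And>b. b \<in> Basis \<Longrightarrow> (p' b has_real_derivative q' b) (at 0)"
    "\<And>b. b \<in> Basis \<Longrightarrow> p' b 0 = h \<bullet> b"
    "m = (\<Sum>b\<in>Basis. q' b)" by (elim has_lapE) blast
  show ?thesis
  proof (rule has_lapI[where p = "\<lambda>b \<tau>. p b \<tau> + p' b \<tau>" and q = "\<lambda>b. q b + q' b"])
    fix b :: 'a assume b: "b \<in> Basis"
    show "\<forall>\<^sub>F \<tau> in nhds 0. ((\<lambda>\<tau>. u (x + \<tau> *\<^sub>R b) + v (x + \<tau> *\<^sub>R b)) has_real_derivative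
        p b \<tau> + p' b \<tau>) (at \<tau>)"
      using 1(1)[OF b] 2(1)[OF b] by eventually_elim (rule DERIV_add)
  qed (use 1 2 in \<open>auto intro!: DERIV_add simp: inner_add_left sum.distrib\<close>)
qed

text \<open>The cross term is the reason for recording the gradient in \<open>has_lap\<close>: the
  barriers below are built from products and compositions, whose Laplacians involve
  \<open>g \<bullet> h\<close> and \<open>g \<bullet> g\<close>.\<close>

lemma has_lap_mult:
  assumes "has_lap u x g l" "has_lap v x h m"
  shows "has_lap (\<lambda>x. u x * v x) x (u x *\<^sub>R h + v x *\<^sub>R g) (u x * m + 2 * (g \<bullet> h) + v x * l)"
proof -
  from assms(1) obtain p q where 1:
    "\<And>b. b \<in> Basis \<Longrightarrow> \<forall>\<^sub>F \<tau> in nhds 0. ((\<lambda>\<tau>. u (x + \<tau> *\<^sub>R b)) has_real_derivative p b \<tau>) (at \<tau>)"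
    "\<And>b. b \<in> Basis \<Longrightarrow> (p b has_real_derivative q b) (at 0)"
    "\<And>b. b \<in> Basis \<Longrightarrow> p b 0 = g \<bullet> b"
    "l = (\<Sum>b\<in>Basis. q b)" by (elim has_lapE) blast
  from assms(2) obtain p' q' where 2:
    "\<And>b. b \<in> Basis \<Longrightarrow> \<forall>\<^sub>F \<tau> in nhds 0. ((\<lambda>\<tau>. v (x + \<tau> *\<^sub>R b)) has_real_derivative p' b \<tau>) (at \<tau>)"
    "\<And>b. b \<in> Basis \<Longrightarrow> (p' b has_real_derivative q' b) (at 0)"
    "\<And>b. b \<in> Basis \<Longrightarrow> p' b 0 = h \<bullet> b"
    "m = (\<Sum>b\<in>Basis. q' b)" by (elim has_lapE) blast
  show ?thesis
  proof (rule has_lapI[where p = "\<lambda>b \<tau>. p b \<tau> * v (x + \<tau> *\<^sub>R b) + p' b \<tau> * u (x + \<tau> *\<^sub>R b)"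
        and q = "\<lambda>b. (q b * v x + p' b 0 * p b 0) + (q' b * u x + p b 0 * p' b 0)"])
    fix b :: 'a assume b: "b \<in> Basis"
    show "\<forall>\<^sub>F \<tau> in nhds 0. ((\<lambda>\<tau>. u (x + \<tau> *\<^sub>R b) * v (x + \<tau> *\<^sub>R b)) has_real_derivative
        p b \<tau> * v (x + \<tau> *\<^sub>R b) + p' b \<tau> * u (x + \<tau> *\<^sub>R b)) (at \<tau>)"
      using 1(1)[OF b] 2(1)[OF b] by eventually_elim (rule DERIV_mult)
    have "((\<lambda>\<tau>. u (x + \<tau> *\<^sub>R b)) has_real_derivative p b 0) (at 0)"
      "((\<lambda>\<tau>. v (x + \<tau> *\<^sub>R b)) has_real_derivative p' b 0) (at 0)"
      using eventually_nhds_x_imp_x[OF 1(1)[OF b]] eventually_nhds_x_imp_x[OF 2(1)[OF b]] by auto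
    from DERIV_mult[OF 1(2)[OF b] this(2)] DERIV_mult[OF 2(2)[OF b] this(1)]
    show "((\<lambda>\<tau>. p b \<tau> * v (x + \<tau> *\<^sub>R b) + p' b \<tau> * u (x + \<tau> *\<^sub>R b)) has_real_derivative
        (q b * v x + p' b 0 * p b 0) + (q' b * u x + p b 0 * p' b 0)) (at 0)"
      by (intro DERIV_add) simp_all
  next
    have "(\<Sum>b\<in>Basis. p b 0 * p' b 0) = g \<bullet> h"
      using 1(3) 2(3) by (simp add: euclidean_inner[of g h])
    moreover have "(\<Sum>b\<in>Basis. q b * v x + p' b 0 * p b 0 + (q' b * u x + p b 0 * p' b 0)) =
        u x * m + 2 * (\<Sum>b\<in>Basis. p b 0 * p' b 0) + v x * l"
      by (simp add: sum.distrib 1(4) 2(4) sum_distrib_left algebra_simps)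
    ultimately show "u x * m + 2 * (g \<bullet> h) + v x * l =
      (\<Sum>b\<in>Basis. q b * v x + p' b 0 * p b 0 + (q' b * u x + p b 0 * p' b 0))"
      by simp
  qed (use 1(3) 2(3) in \<open>auto simp: inner_add_left\<close>)
qed

lemma has_lap_cmult:
  assumes "has_lap u x g l"
  shows "has_lap (\<lambda>x. c * u x) x (c *\<^sub>R g) (c * l)"
  using has_lap_mult[OF has_lap_const[of c x] assms] by simp

lemma has_lap_diff:
  assumes "has_lap u x g l" "has_lap v x h m"
  shows "has_lap (\<lambda>x. u x - v x) x (g - h) (l - m)"
  using has_lap_add[OF assms(1) has_lap_cmult[OF assms(2), of "-1"]] by simp

lemma has_lap_compose:
  assumes u: "has_lap u x g l"
    and F: "\<forall>\<^sub>F y in nhds (u x). (F has_real_derivative F' y) (at y)"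
    and F': "(F' has_real_derivative F'') (at (u x))"
  shows "has_lap (\<lambda>x. F (u x)) x (F' (u x) *\<^sub>R g) (F'' * (g \<bullet> g) + F' (u x) * l)"
proof -
  from u obtain p q where 1:
    "\<And>b. b \<in> Basis \<Longrightarrow> \<forall>\<^sub>F \<tau> in nhds 0. ((\<lambda>\<tau>. u (x + \<tau> *\<^sub>R b)) has_real_derivative p b \<tau>) (at \<tau>)"
    "\<And>b. b \<in> Basis \<Longrightarrow> (p b has_real_derivative q b) (at 0)"
    "\<And>b. b \<in> Basis \<Longrightarrow> p b 0 = g \<bullet> b"
    "l = (\<Sum>b\<in>Basis. q b)" by (elim has_lapE) blast
  have d0: "((\<lambda>\<tau>. u (x + \<tau> *\<^sub>R b)) has_real_derivative p b 0) (at 0)" if "b \<in> Basis" for b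
    using eventually_nhds_x_imp_x[OF 1(1)[OF that]] .
  show ?thesis
  proof (rule has_lapI[where p = "\<lambda>b \<tau>. F' (u (x + \<tau> *\<^sub>R b)) * p b \<tau>"
        and q = "\<lambda>b. (F'' * p b 0) * p b 0 + q b * F' (u x)"])
    fix b :: 'a assume b: "b \<in> Basis"
    have "isCont (\<lambda>\<tau>. u (x + \<tau> *\<^sub>R b)) 0"
      using d0[OF b] DERIV_isCont by blast
    then have "((\<lambda>\<tau>. u (x + \<tau> *\<^sub>R b)) \<longlongrightarrow> u x) (nhds 0)"
      using tendsto_at_iff_tendsto_nhds[of "\<lambda>\<tau>. u (x + \<tau> *\<^sub>R b)" 0] by (simp add: isCont_def)
    then have "\<forall>\<^sub>F \<tau> in nhds 0. (F has_real_derivative F' (u (x + \<tau> *\<^sub>R b))) (at (u (x + \<tau> *\<^sub>R b)))"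
      by (rule eventually_compose_filterlim[OF F])
    with 1(1)[OF b] show "\<forall>\<^sub>F \<tau> in nhds 0. ((\<lambda>\<tau>. F (u (x + \<tau> *\<^sub>R b))) has_real_derivative
        F' (u (x + \<tau> *\<^sub>R b)) * p b \<tau>) (at \<tau>)"
      by eventually_elim (rule DERIV_chain2)
    have "((\<lambda>\<tau>. F' (u (x + \<tau> *\<^sub>R b))) has_real_derivative F'' * p b 0) (at 0)"
      by (rule DERIV_chain2[where f = F']) (use F' d0[OF b] in auto)
    from DERIV_mult[OF this 1(2)[OF b]]
    show "((\<lambda>\<tau>. F' (u (x + \<tau> *\<^sub>R b)) * p b \<tau>) has_real_derivative
        (F'' * p b 0) * p b 0 + q b * F' (u x)) (at 0)"
      by simp
  next
    have "(\<Sum>b\<in>Basis. p b 0 * p b 0) = g \<bullet> g"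
      using 1(3) by (simp add: euclidean_inner[of g g])
    moreover have "(\<Sum>b\<in>Basis. (F'' * p b 0) * p b 0 + q b * F' (u x)) =
        F'' * (\<Sum>b\<in>Basis. p b 0 * p b 0) + F' (u x) * l"
      by (simp add: sum.distrib 1(4) sum_distrib_left algebra_simps)
    ultimately show "F'' * (g \<bullet> g) + F' (u x) * l = (\<Sum>b\<in>Basis. (F'' * p b 0) * p b 0 + q b * F' (u x))"
      by simp
  qed (use 1(3) in auto)
qed

lemma has_lap_scale:
  assumes "has_lap u (r *\<^sub>R x) g l"
  shows "has_lap (\<lambda>y. u (r *\<^sub>R y)) x (r *\<^sub>R g) (r\<^sup>2 * l)"
proof -
  from assms obtain p q where 1:
    "\<And>b. b \<in> Basis \<Longrightarrow> \<forall>\<^sub>F \<tau> in nhds 0. ((\<lambda>\<tau>. u (r *\<^sub>R x + \<tau> *\<^sub>R b)) has_real_derivative p b \<tau>) (at \<tau>)"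
    "\<And>b. b \<in> Basis \<Longrightarrow> (p b has_real_derivative q b) (at 0)"
    "\<And>b. b \<in> Basis \<Longrightarrow> p b 0 = g \<bullet> b"
    "l = (\<Sum>b\<in>Basis. q b)" by (elim has_lapE) blast
  show ?thesis
  proof (rule has_lapI[where p = "\<lambda>b \<tau>. p b (r * \<tau>) * r" and q = "\<lambda>b. q b * r * r"])
    fix b :: 'a assume b: "b \<in> Basis"
    have "((\<lambda>\<tau>. r * \<tau>) \<longlongrightarrow> r * 0) (nhds 0)"
      by (intro tendsto_intros filterlim_ident)
    then have "\<forall>\<^sub>F \<tau> in nhds 0. ((\<lambda>\<tau>. u (r *\<^sub>R x + \<tau> *\<^sub>R b)) has_real_derivative p b (r * \<tau>)) (at (r * \<tau>))"
      using eventually_compose_filterlim[where f = "\<lambda>\<tau>. r * \<tau>" and F = "nhds 0", OF 1(1)[OF b]] by simp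
    then show "\<forall>\<^sub>F \<tau> in nhds 0. ((\<lambda>\<tau>. u (r *\<^sub>R (x + \<tau> *\<^sub>R b))) has_real_derivative p b (r * \<tau>) * r) (at \<tau>)"
    proof eventually_elim
      case (elim \<tau>)
      from DERIV_chain2[OF elim DERIV_cmult_Id]
      show ?case by (simp add: algebra_simps)
    qed
    have "((\<lambda>\<tau>. p b (r * \<tau>)) has_real_derivative q b * r) (at 0)"
      by (rule DERIV_chain2[where f = "p b"]) (use 1(2)[OF b] in \<open>auto intro: DERIV_cmult_Id\<close>)
    then show "((\<lambda>\<tau>. p b (r * \<tau>) * r) has_real_derivative q b * r * r) (at 0)"
      by (rule DERIV_cmult_right)
  next
    show "r\<^sup>2 * l = (\<Sum>b\<in>Basis. q b * r * r)"
      by (simp add: 1(4) sum_distrib_left power2_eq_square algebra_simps)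
  qed (use 1(3) in \<open>auto simp: algebra_simps\<close>)
qed

section \<open>The second derivative test and viscosity supersolutions\<close>

lemma local_min_second_derivative_nonneg:
  fixes u p :: "real \<Rightarrow> real"
  assumes d: "\<forall>\<^sub>F \<tau> in nhds 0. (u has_real_derivative p \<tau>) (at \<tau>)"
    and q: "(p has_real_derivative q) (at 0)"
    and min: "\<forall>\<^sub>F \<tau> in nhds 0. u 0 \<le> u \<tau>"
  shows "q \<ge> 0"
proof (rule ccontr)
  assume "\<not> q \<ge> 0"
  then have "q < 0" by simp
  from d obtain d1 where d1: "d1 > 0" "\<And>\<tau>. \<bar>\<tau>\<bar> < d1 \<Longrightarrow> (u has_real_derivative p \<tau>) (at \<tau>)"
    by (auto simp: eventually_nhds_metric dist_real_def)
  from min obtain d2 where d2: "d2 > 0" "\<And>\<tau>. \<bar>\<tau>\<bar> < d2 \<Longrightarrow> u 0 \<le> u \<tau>"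
    by (auto simp: eventually_nhds_metric dist_real_def)
  have "p 0 = 0"
    using DERIV_local_min[OF d1(2)[of 0] d2(1)] d1(1) d2(2) by simp
  from DERIV_neg_dec_right[OF q \<open>q < 0\<close>] obtain d3 where
    d3: "d3 > 0" "\<And>h. 0 < h \<Longrightarrow> h < d3 \<Longrightarrow> p h < 0"
    using \<open>p 0 = 0\<close> by auto
  define m where "m = min d1 (min d2 d3) / 2"
  have m: "0 < m" "m < d1" "m < d2" "m < d3"
    using d1(1) d2(1) d3(1) by (auto simp: m_def)
  have "u m < u 0"
  proof (rule DERIV_neg_imp_decreasing_open[OF m(1)])
    show "\<exists>y. (u has_real_derivative y) (at x) \<and> y < 0" if "0 < x" "x < m" for x
      using d1(2)[of x] d3(2)[of x] that m by auto
    show "continuous_on {0..m} u"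
      by (rule DERIV_continuous_on[of _ _ p])
        (use d1(2) m in \<open>auto intro: has_field_derivative_at_within\<close>)
  qed
  with d2(2)[of m] m show False by simp
qed

lemma has_lap_local_min:
  assumes "has_lap u x g l" "\<forall>\<^sub>F y in nhds x. u x \<le> u y"
  shows "l \<ge> 0"
proof -
  from assms(1) obtain p q where 1:
    "\<And>b. b \<in> Basis \<Longrightarrow> \<forall>\<^sub>F \<tau> in nhds 0. ((\<lambda>\<tau>. u (x + \<tau> *\<^sub>R b)) has_real_derivative p b \<tau>) (at \<tau>)"
    "\<And>b. b \<in> Basis \<Longrightarrow> (p b has_real_derivative q b) (at 0)"
    "l = (\<Sum>b\<in>Basis. q b)" by (elim has_lapE) blast
  have "q b \<ge> 0" if b: "b \<in> Basis" for b
  proof (rule local_min_second_derivative_nonneg[OF 1(1)[OF b] 1(2)[OF b]])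
    have "((\<lambda>\<tau>. x + \<tau> *\<^sub>R b) \<longlongrightarrow> x + 0 *\<^sub>R b) (nhds 0)"
      by (intro tendsto_intros filterlim_ident)
    then show "\<forall>\<^sub>F \<tau> in nhds 0. u (x + 0 *\<^sub>R b) \<le> u (x + \<tau> *\<^sub>R b)"
      using eventually_compose_filterlim[where f = "\<lambda>\<tau>. x + \<tau> *\<^sub>R b" and F = "nhds x", OF assms(2)] by simp
  qed
  then show ?thesis by (simp add: 1(3) sum_nonneg)
qed

text \<open>Superharmonicity in the viscosity sense, with the touching function as witness. For \<open>h = - u\<close>
  with \<open>u \<ge> 0\<close> harmonic on \<open>{u > 0}\<close>, the witness is \<open>- u\<close> where \<open>u > 0\<close> and \<open>0\<close> where \<open>u = 0\<close>.\<close>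

definition supersol :: "('a::euclidean_space \<Rightarrow> real) \<Rightarrow> 'a \<Rightarrow> bool" where
  "supersol h x \<longleftrightarrow> (\<exists>g d l. (\<forall>\<^sub>F y in nhds x. h y \<le> g y) \<and> h x = g x \<and> has_lap g x d l \<and> l \<le> 0)"

lemma supersol_lap: "has_lap h x d l \<Longrightarrow> l \<le> 0 \<Longrightarrow> supersol h x"
  unfolding supersol_def by (intro exI[of _ h] exI[of _ d] exI[of _ l]) auto

text \<open>The shape \<open>k * h y + v y\<close> covers all operations performed later: division
  by a scaling factor, subtraction of \<open>m * root\<close>, and the passage from
  \<open>- u\<close> to \<open>M * root - u\<close>.\<close>

lemma supersol_add_harmonic:
  assumes "supersol h x" "has_lap v x d 0" "k \<ge> 0"
  shows "supersol (\<lambda>y. k * h y + v y) x"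
proof -
  from assms(1) obtain g d' l where g: "\<forall>\<^sub>F y in nhds x. h y \<le> g y" "h x = g x" "has_lap g x d' l" "l \<le> 0"
    unfolding supersol_def by blast
  show ?thesis
    unfolding supersol_def
  proof (intro exI conjI)
    show "\<forall>\<^sub>F y in nhds x. k * h y + v y \<le> k * g y + v y"
      using g(1) by eventually_elim (simp add: assms(3) mult_left_mono)
    show "has_lap (\<lambda>y. k * g y + v y) x (k *\<^sub>R d' + d) (k * l + 0)"
      by (intro has_lap_add has_lap_cmult g assms)
    show "k * l + 0 \<le> 0"
      using assms(3) g(4) by (simp add: mult_nonneg_nonpos)
  qed (simp add: g(2))
qed

lemma supersol_scale:
  assumes "supersol h (r *\<^sub>R x)"
  shows "supersol (\<lambda>y. h (r *\<^sub>R y)) x"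
proof -
  from assms obtain g d' l where g: "\<forall>\<^sub>F y in nhds (r *\<^sub>R x). h y \<le> g y" "h (r *\<^sub>R x) = g (r *\<^sub>R x)"
      "has_lap g (r *\<^sub>R x) d' l" "l \<le> 0"
    unfolding supersol_def by blast
  show ?thesis
    unfolding supersol_def
  proof (intro exI conjI)
    have "((\<lambda>y. r *\<^sub>R y) \<longlongrightarrow> r *\<^sub>R x) (nhds x)"
      by (intro tendsto_intros filterlim_ident)
    then show "\<forall>\<^sub>F y in nhds x. h (r *\<^sub>R y) \<le> g (r *\<^sub>R y)"
      by (rule eventually_compose_filterlim[OF g(1)])
    show "has_lap (\<lambda>y. g (r *\<^sub>R y)) x (r *\<^sub>R d') (r\<^sup>2 * l)"
      by (rule has_lap_scale) (fact g)
    show "r\<^sup>2 * l \<le> 0"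
      using g(4) by (simp add: mult_nonneg_nonpos)
  qed (simp add: g(2))
qed

text \<open>At a negative minimum of \<open>h - \<phi>\<close>, replacing \<open>h\<close> by its
  witness \<open>g\<close> keeps the local minimum, since \<open>g\<close> lies above
  \<open>h\<close> and meets it there; the second derivative test then contradicts
  \<open>l' \<le> 0 < l\<close>. Strictness of \<open>l > 0\<close> replaces the strong maximum
  principle, and the disjunction treats the boundary of \<open>K\<close> and interior sets with a
  known bound alike.\<close>

lemma comparison:
  assumes K: "compact K" and h: "continuous_on K h" and \<phi>: "continuous_on K \<phi>"
    and *: "\<And>x. x \<in> K \<Longrightarrow> \<phi> x \<le> h x \<or>
              x \<in> interior K \<and> supersol h x \<and> (\<exists>d l. has_lap \<phi> x d l \<and> l > 0)"
    and y: "y \<in> K"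
  shows "\<phi> y \<le> h y"
proof -
  have "K \<noteq> {}" using y by auto
  from continuous_attains_inf[OF K this continuous_on_diff[OF h \<phi>]]
  obtain x where x: "x \<in> K" "\<And>z. z \<in> K \<Longrightarrow> h x - \<phi> x \<le> h z - \<phi> z"
    by metis
  have "\<phi> x \<le> h x"
  proof (rule ccontr)
    assume "\<not> \<phi> x \<le> h x"
    with *[OF x(1)] obtain d l where int: "x \<in> interior K" and sup: "supersol h x"
      and l: "has_lap \<phi> x d l" "l > 0" by auto
    from sup obtain g d' l' where g: "\<forall>\<^sub>F y in nhds x. h y \<le> g y" "h x = g x" "has_lap g x d' l'" "l' \<le> 0"
      unfolding supersol_def by blast
    have "\<forall>\<^sub>F y in nhds x. y \<in> K"
      using int eventually_nhds[of "\<lambda>y. y \<in> K" x] open_interior[of K] interior_subset[of K] by blast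
    with g(1) have "\<forall>\<^sub>F y in nhds x. g x - \<phi> x \<le> g y - \<phi> y"
    proof eventually_elim
      case (elim y)
      with x(2)[of y] g(2) show ?case by simp
    qed
    from has_lap_local_min[OF has_lap_diff[OF g(3) l(1)] this] l(2) g(4) show False by simp
  qed
  with x(2)[OF y] show ?thesis by simp
qed

section \<open>The slit and the model solution\<close>

lemma bessel_two:
  fixes e f x :: "'a::euclidean_space"
  assumes "e \<bullet> e = 1" "f \<bullet> f = 1" "e \<bullet> f = 0"
  shows "(x \<bullet> e)\<^sup>2 + (x \<bullet> f)\<^sup>2 \<le> (norm x)\<^sup>2"
proof -
  have "0 \<le> (x - (x \<bullet> e) *\<^sub>R e - (x \<bullet> f) *\<^sub>R f) \<bullet> (x - (x \<bullet> e) *\<^sub>R e - (x \<bullet> f) *\<^sub>R f)"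
    by simp
  also have "\<dots> = x \<bullet> x - ((x \<bullet> e)\<^sup>2 + (x \<bullet> f)\<^sup>2)"
    using assms by (simp add: algebra_simps inner_commute power2_eq_square)
  finally show ?thesis by (simp add: power2_norm_eq_inner)
qed

locale orthonormal_pair =
  fixes e f :: "'a::euclidean_space"
  assumes ee: "e \<bullet> e = 1" and ff: "f \<bullet> f = 1" and ef: "e \<bullet> f = 0"
begin

lemma fe: "f \<bullet> e = 0"
  using ef by (simp add: inner_commute)

definition slit :: "'a set" where
  "slit = {x. x \<bullet> f = 0 \<and> x \<bullet> e \<le> 0}"

text \<open>The function \<open>U\<close> of the paper is \<open>root\<close> for \<open>e\<close>, \<open>f\<close> the \<open>x\<^sub>n\<close>- and the \<open>s\<close>-direction.\<close>

definition proj :: "'a \<Rightarrow> complex" where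
  "proj x = Complex (x \<bullet> e) (x \<bullet> f)"

definition root :: "'a \<Rightarrow> real" where
  "root x = Re (csqrt (proj x))"

lemma proj_add: "proj (x + y) = proj x + proj y"
  and proj_diff: "proj (x - y) = proj x - proj y"
  and proj_scale: "proj (r *\<^sub>R x) = of_real r * proj x"
  by (simp_all add: proj_def complex_eq_iff inner_add_left inner_diff_left)

lemma Re_proj [simp]: "Re (proj x) = x \<bullet> e" and Im_proj [simp]: "Im (proj x) = x \<bullet> f"
  by (simp_all add: proj_def)

lemma norm_proj_le: "norm (proj x) \<le> norm x"
  using bessel_two[OF ee ff ef, of x]
  by (simp add: cmod_power2 power2_le_imp_le)

lemma continuous_proj: "continuous_on A proj"
proof -
  have "proj = (\<lambda>x. of_real (x \<bullet> e) + \<i> * of_real (x \<bullet> f))"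
    by (auto simp: proj_def Complex_eq)
  then show ?thesis by (auto intro!: continuous_intros)
qed

lemma proj_slit: "proj x \<in> \<real>\<^sub>\<le>\<^sub>0 \<longleftrightarrow> x \<in> slit"
  by (auto simp: complex_nonpos_Reals_iff slit_def)

lemma root_eq: "root x = sqrt ((norm (proj x) + x \<bullet> e) / 2)"
  by (simp add: root_def)

lemma proj_e_bound: "\<bar>x \<bullet> e\<bar> \<le> norm (proj x)" "\<bar>x \<bullet> f\<bar> \<le> norm (proj x)"
  using abs_Re_le_cmod[of "proj x"] abs_Im_le_cmod[of "proj x"] by simp_all

lemma root_nonneg: "root x \<ge> 0"
  using proj_e_bound(1)[of x] by (simp add: root_eq)

lemma root_zero_iff: "root x = 0 \<longleftrightarrow> x \<in> slit"
proof -
  have "root x = 0 \<longleftrightarrow> norm (proj x) = - (x \<bullet> e)"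
    by (auto simp: root_eq)
  also have "\<dots> \<longleftrightarrow> x \<in> slit"
  proof
    assume *: "norm (proj x) = - (x \<bullet> e)"
    then have "(norm (proj x))\<^sup>2 = (x \<bullet> e)\<^sup>2" by simp
    then have "x \<bullet> f = 0" by (simp add: cmod_power2)
    with * show "x \<in> slit" using norm_ge_zero[of "proj x"] by (simp add: slit_def)
  next
    assume "x \<in> slit"
    then show "norm (proj x) = - (x \<bullet> e)"
      by (simp add: slit_def cmod_def)
  qed
  finally show ?thesis .
qed

lemma root_pos: "x \<notin> slit \<Longrightarrow> root x > 0"
  using root_nonneg[of x] root_zero_iff[of x] by linarith

lemma root_le_sqrt: "root x \<le> sqrt (norm (proj x))"
  using proj_e_bound(1)[of x] by (simp add: root_eq)

lemma root_le: "root x \<le> sqrt (norm x)"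
  using root_le_sqrt[of x] norm_proj_le[of x] by (meson order_trans real_sqrt_le_iff)

lemma root_scale: "r \<ge> 0 \<Longrightarrow> root (r *\<^sub>R x) = sqrt r * root x"
  by (simp add: root_eq proj_scale norm_mult real_sqrt_mult [symmetric] algebra_simps add_divide_distrib)

lemma root_e: "root e = 1"
  by (simp add: root_eq proj_def ee ef cmod_def)

text \<open>\<open>root\<close> is the square root of the 1-Lipschitz function
  \<open>(norm (proj x) + x \<bullet> e) / 2\<close>. The constant 1 matters: subtracting
  \<open>m * root\<close> with \<open>m \<ge> 0\<close> raises a Hoelder constant by at most
  \<open>m\<close>.\<close>

lemma root_holder: "\<bar>root x - root y\<bar> \<le> sqrt (norm (x - y))"
proof -
  have sq: "\<bar>sqrt a - sqrt b\<bar> \<le> sqrt \<bar>a - b\<bar>" if "a \<ge> 0" "b \<ge> 0" for a b :: real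
  proof -
    have *: "sqrt a \<le> sqrt b + sqrt \<bar>a - b\<bar>" if "a \<ge> 0" "b \<ge> 0" for a b :: real
    proof -
      have "sqrt a \<le> sqrt (b + \<bar>a - b\<bar>)" by simp
      also have "\<dots> \<le> sqrt b + sqrt \<bar>a - b\<bar>" using that by (intro sqrt_add_le_add_sqrt) auto
      finally show ?thesis .
    qed
    from *[OF that] *[OF that(2,1)] show ?thesis by (simp add: abs_le_iff abs_minus_commute)
  qed
  have "\<bar>norm (proj x) - norm (proj y)\<bar> \<le> norm (x - y)"
    using norm_triangle_ineq3[of "proj x" "proj y"] norm_proj_le[of "x - y"] by (simp add: proj_diff)
  moreover have "\<bar>x \<bullet> e - y \<bullet> e\<bar> \<le> norm (x - y)"
    using proj_e_bound(1)[of "x - y"] norm_proj_le[of "x - y"] by (simp add: inner_diff_left)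
  ultimately have "\<bar>(norm (proj x) + x \<bullet> e) / 2 - (norm (proj y) + y \<bullet> e) / 2\<bar> \<le> norm (x - y)"
    by (auto simp: abs_le_iff field_simps)
  moreover have "\<bar>root x - root y\<bar> \<le> sqrt \<bar>(norm (proj x) + x \<bullet> e) / 2 - (norm (proj y) + y \<bullet> e) / 2\<bar>"
    unfolding root_eq using proj_e_bound(1)[of x] proj_e_bound(1)[of y] by (intro sq) auto
  ultimately show ?thesis by (meson order_trans real_sqrt_le_iff)
qed

lemma continuous_root: "continuous_on A root"
  unfolding root_eq by (intro continuous_intros continuous_proj ballI) simp

lemma closed_slit: "closed slit"
  unfolding slit_def by (intro closed_Collect_conj closed_Collect_eq closed_Collect_le continuous_intros)

text \<open>\<open>root\<close> is the real part of a holomorphic function of \<open>proj x\<close>.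
  The two inner products are Euler's identity for degree 1/2, in the whole space and in the plane of
  \<open>e\<close> and \<open>f\<close>; they agree because \<open>root\<close> depends on the
  planar part of \<open>x\<close> only. They evaluate the gradient term of the product barrier in
  \<open>gain\<close>.\<close>

lemma root_harmonic:
  assumes "x \<notin> slit"
  obtains g where "has_lap root x g 0" "g \<bullet> x = root x / 2"
    "g \<bullet> ((x \<bullet> e) *\<^sub>R e + (x \<bullet> f) *\<^sub>R f) = root x / 2"
proof -
  \<comment> \<open>\<open>d\<close> is the derivative of \<open>csqrt\<close> at
    \<open>proj x\<close>, so the derivative of \<open>root\<close> along \<open>b\<close> is
    \<open>Re (proj b * d)\<close>. Differentiating \<open>inverse (2 * csqrt z)\<close> once more
    gives \<open>- 2 * d ^ 3\<close>.\<close>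
  define d where "d = inverse (2 * csqrt (proj x))"
  define g where "g = Re d *\<^sub>R e - Im d *\<^sub>R f"
  have nz: "proj x \<noteq> 0" "csqrt (proj x) \<noteq> 0"
    using assms proj_slit[of x] by auto
  have "d * proj x = csqrt (proj x) / 2"
    using nz power2_csqrt[of "proj x"] by (simp add: d_def power2_eq_square field_simps)
  then have "Re (d * proj x) = Re (csqrt (proj x) / 2)"
    by (simp only:)
  then have dz: "Re (d * proj x) = root x / 2"
    by (simp only: root_def Re_divide_numeral)
  have gb: "g \<bullet> b = Re (proj b * d)" for b
    by (simp add: g_def inner_commute[of _ b] inner_diff_right mult.commute)
  have lap: "has_lap root x g 0"
  proof (rule has_lapI[where p = "\<lambda>b \<tau>. Re (proj b * inverse (2 * csqrt (proj (x + \<tau> *\<^sub>R b))))"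
        and q = "\<lambda>b. Re ((proj b)\<^sup>2 * (- 2 * d ^ 3))"])
    fix b :: 'a
    have lin: "((\<lambda>\<tau>. proj (x + \<tau> *\<^sub>R b)) has_vector_derivative proj b) (at \<tau>)" for \<tau>
      unfolding proj_add proj_scale
      by (auto intro!: derivative_eq_intros simp: scaleR_conv_of_real[symmetric])
    have "((\<lambda>\<tau>. x + \<tau> *\<^sub>R b) \<longlongrightarrow> x + 0 *\<^sub>R b) (nhds 0)"
      by (intro tendsto_intros filterlim_ident)
    moreover have "\<forall>\<^sub>F y in nhds (x + 0 *\<^sub>R b). y \<notin> slit"
      using eventually_nhds_in_open[of "- slit" x] assms closed_slit by (auto simp: open_Compl)
    ultimately have "\<forall>\<^sub>F \<tau> in nhds 0. x + \<tau> *\<^sub>R b \<notin> slit"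
      by (rule eventually_compose_filterlim[rotated])
    then show "\<forall>\<^sub>F \<tau> in nhds 0. ((\<lambda>\<tau>. root (x + \<tau> *\<^sub>R b)) has_real_derivative
        Re (proj b * inverse (2 * csqrt (proj (x + \<tau> *\<^sub>R b))))) (at \<tau>)"
    proof eventually_elim
      case (elim \<tau>)
      then have "proj (x + \<tau> *\<^sub>R b) \<notin> \<real>\<^sub>\<le>\<^sub>0"
        by (simp add: proj_slit)
      from has_field_derivative_Re[OF field_vector_diff_chain_at[OF lin has_field_derivative_csqrt[OF this]]]
      show ?case by (simp add: root_def o_def del: csqrt.simps)
    qed
    have nr: "proj x \<notin> \<real>\<^sub>\<le>\<^sub>0"
      using assms by (simp add: proj_slit)
    have "((\<lambda>z. inverse (2 * csqrt z)) has_field_derivative - 2 * d ^ 3) (at (proj x))"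
      using nz nr by (auto intro!: derivative_eq_intros has_field_derivative_csqrt
          simp: d_def power3_eq_cube field_simps simp del: csqrt.simps)
    then have "((\<lambda>z. inverse (2 * csqrt z)) has_field_derivative - 2 * d ^ 3) (at (proj (x + 0 *\<^sub>R b)))"
      by simp
    from field_vector_diff_chain_at[OF lin this]
    have "((\<lambda>\<tau>. inverse (2 * csqrt (proj (x + \<tau> *\<^sub>R b)))) has_vector_derivative proj b * (- 2 * d ^ 3)) (at 0)"
      by (simp add: o_def del: csqrt.simps)
    from has_field_derivative_Re[OF has_vector_derivative_mult_right[OF this, of "proj b"]]
    show "((\<lambda>\<tau>. Re (proj b * inverse (2 * csqrt (proj (x + \<tau> *\<^sub>R b))))) has_real_derivative
        Re ((proj b)\<^sup>2 * (- 2 * d ^ 3))) (at 0)"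
      by (simp add: power2_eq_square mult.assoc del: csqrt.simps)
  next
    show "Re (proj b * inverse (2 * csqrt (proj (x + 0 *\<^sub>R b)))) = g \<bullet> b" for b
      by (simp add: gb d_def del: csqrt.simps)
  next
    \<comment> \<open>Since \<open>proj b\<close> pairs \<open>b\<close> with the complex vector e +
      i f, the sum is its bilinear square, e.e - f.f + 2i e.f, which is 0 by orthonormality.\<close>
    have "(\<Sum>b\<in>Basis. (proj b)\<^sup>2) = 0"
    proof (rule complex_eqI)
      have "(\<Sum>b\<in>Basis. (b \<bullet> e) * (b \<bullet> e)) = 1" "(\<Sum>b\<in>Basis. (b \<bullet> f) * (b \<bullet> f)) = 1"
        "(\<Sum>b\<in>Basis. (b \<bullet> e) * (b \<bullet> f)) = 0"
        using euclidean_inner[of e e] euclidean_inner[of f f] euclidean_inner[of e f] ee ff ef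
        by (simp_all add: inner_commute)
      then show "Re (\<Sum>b\<in>Basis. (proj b)\<^sup>2) = Re 0" "Im (\<Sum>b\<in>Basis. (proj b)\<^sup>2) = Im 0"
        by (simp_all add: power2_eq_square sum_subtractf sum_distrib_left[symmetric])
    qed
    then have "Re ((\<Sum>b\<in>Basis. (proj b)\<^sup>2) * (- 2 * d ^ 3)) = 0" by simp
    then show "0 = (\<Sum>b\<in>Basis. Re ((proj b)\<^sup>2 * (- 2 * d ^ 3)))"
      by (simp only: sum_distrib_right Re_sum)
  qed
  have "g \<bullet> x = root x / 2"
    using dz by (simp add: gb mult.commute)
  moreover have "g \<bullet> ((x \<bullet> e) *\<^sub>R e + (x \<bullet> f) *\<^sub>R f) = root x / 2"
    using dz ee ff ef fe by (simp add: g_def algebra_simps)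
  ultimately show ?thesis using lap that by blast
qed

end

section \<open>Quantitative positivity\<close>

text \<open>\<open>c\<close> is bound before \<open>P\<close>, \<open>h\<close> and
  \<open>x\<close>, so it serves every function and every admissible centre. The centre may lie on
  the flat face, in which case only half of the ball of radius \<open>\<kappa>\<close> carries the
  bound \<open>m\<close>.\<close>

lemma hopf_half_ball:
  fixes v :: "'a::euclidean_space"
  assumes "v \<bullet> v = 1" "0 < \<kappa>" "0 < m" "\<rho> < R" "0 < \<rho>"
  obtains c where "c > 0"
    "\<And>P h x. 0 \<le> P \<bullet> v \<Longrightarrow> P \<bullet> v \<le> R \<Longrightarrow> continuous_on {x \<in> cball P R. 0 \<le> x \<bullet> v} h \<Longrightarrow>
      (\<And>x. x \<in> cball P R \<Longrightarrow> 0 \<le> x \<bullet> v \<Longrightarrow> 0 \<le> h x) \<Longrightarrow>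
      (\<And>x. x \<in> ball P R \<Longrightarrow> 0 < x \<bullet> v \<Longrightarrow> supersol h x) \<Longrightarrow>
      (\<And>x. x \<in> cball P \<kappa> \<Longrightarrow> 0 \<le> x \<bullet> v \<Longrightarrow> m \<le> h x) \<Longrightarrow>
      x \<in> cball P \<rho> \<Longrightarrow> 0 \<le> x \<bullet> v \<Longrightarrow> c * (x \<bullet> v) \<le> h x"
proof -
  define a where "a = (DIM('a) + 2) / \<kappa>\<^sup>2"
  \<comment> \<open>On the half ball \<open>x \<bullet> v \<le> 2 * R\<close> and
    \<open>G P x \<le> 1\<close>, so this factor keeps the barrier below \<open>m\<close> where
    \<open>h \<ge> m\<close> is known.\<close>
  define \<epsilon> where "\<epsilon> = m / (2 * R + 1)"
  define G where "G P x = exp (- a * ((x - P) \<bullet> (x - P))) - exp (- a * R\<^sup>2)" for P x :: 'a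
  define c where "c = \<epsilon> * (exp (- a * \<rho>\<^sup>2) - exp (- a * R\<^sup>2))"
  have a: "a > 0" using assms by (simp add: a_def)
  have R: "R > 0" using assms by simp
  have \<epsilon>: "\<epsilon> > 0" using assms by (simp add: \<epsilon>_def)
  have "c > 0"
    using \<epsilon> a assms by (simp add: c_def power_strict_mono)
  moreover have "c * (x \<bullet> v) \<le> h x"
    if P: "0 \<le> P \<bullet> v" "P \<bullet> v \<le> R" and h: "continuous_on {x \<in> cball P R. 0 \<le> x \<bullet> v} h"
      and h0: "\<And>x. x \<in> cball P R \<Longrightarrow> 0 \<le> x \<bullet> v \<Longrightarrow> 0 \<le> h x"
      and sup: "\<And>x. x \<in> ball P R \<Longrightarrow> 0 < x \<bullet> v \<Longrightarrow> supersol h x"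
      and hm: "\<And>x. x \<in> cball P \<kappa> \<Longrightarrow> 0 \<le> x \<bullet> v \<Longrightarrow> m \<le> h x"
      and x: "x \<in> cball P \<rho>" "0 \<le> x \<bullet> v" for P h x
  proof -
    define K where "K = {x \<in> cball P R. 0 \<le> x \<bullet> v}"
    \<comment> \<open>Hopf's barrier times the linear function \<open>x \<bullet> v\<close>, so that it also vanishes on the flat part of
      the boundary; it is a subsolution for \<open>\<bar>x - P\<bar> \<ge> \<kappa>\<close> since \<open>a * \<kappa>\<^sup>2 = DIM('a) + 2\<close>.\<close>
    define \<phi> where "\<phi> x = \<epsilon> * ((x \<bullet> v) * G P x)" for x
    have xP: "(x - P) \<bullet> (x - P) = (dist P x)\<^sup>2" for x
      by (simp add: dist_norm norm_minus_commute power2_norm_eq_inner[symmetric])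
    have "\<phi> x \<le> h x"
    proof (rule comparison[where K = K])
      have "K = cball P R \<inter> {x. 0 \<le> x \<bullet> v}" by (auto simp: K_def)
      moreover have "closed {x. 0 \<le> x \<bullet> v}"
        by (intro closed_Collect_le continuous_intros)
      ultimately show "compact K" by (simp add: compact_Int_closed)
      show "continuous_on K h" using h by (simp add: K_def)
      show "continuous_on K \<phi>" unfolding \<phi>_def G_def by (intro continuous_intros)
      show "x \<in> K" using x assms by (auto simp: K_def)
      fix y assume y: "y \<in> K"
      then have yK: "dist P y \<le> R" "0 \<le> y \<bullet> v" by (auto simp: K_def)
      have G: "0 \<le> G P y" "G P y \<le> 1"
      proof -
        show "0 \<le> G P y" using yK a R by (simp add: G_def xP power_mono)
        have "exp (- a * (dist P y)\<^sup>2) \<le> 1" using a by simp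
        then show "G P y \<le> 1" using exp_ge_zero[of "- a * R\<^sup>2"] unfolding G_def xP by linarith
      qed
      consider "y \<bullet> v = 0" | "dist P y = R" | "dist P y \<le> \<kappa>" | "0 < y \<bullet> v" "dist P y < R" "\<kappa> < dist P y"
        using yK by linarith
      then show "\<phi> y \<le> h y \<or> y \<in> interior K \<and> supersol h y \<and> (\<exists>d l. has_lap \<phi> y d l \<and> l > 0)"
      proof cases
        case 1
        with h0[of y] yK show ?thesis by (simp add: \<phi>_def)
      next
        case 2
        then have "\<phi> y = 0" by (simp add: \<phi>_def G_def xP)
        with h0[of y] yK show ?thesis by simp
      next
        case 3
        have "norm v = 1" using assms(1) by (simp add: norm_eq_1)
        then have "y \<bullet> v - P \<bullet> v \<le> R"
          using Cauchy_Schwarz_ineq2[of "y - P" v] yK by (simp add: inner_diff_left dist_norm norm_minus_commute)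
        then have yv: "y \<bullet> v \<le> 2 * R" using P by simp
        have "(y \<bullet> v) * G P y \<le> 2 * R * 1"
          using yv G yK R by (intro mult_mono) auto
        then have "\<phi> y \<le> \<epsilon> * (2 * R + 1)"
          unfolding \<phi>_def using \<epsilon> by (intro mult_left_mono) auto
        also have "\<dots> = m" using R by (simp add: \<epsilon>_def)
        also have "\<dots> \<le> h y" using 3 yK by (intro hm) auto
        finally show ?thesis ..
      next
        case 4
        have "y \<in> interior K"
        proof (rule interiorI[of "ball P R \<inter> {x. 0 < x \<bullet> v}"])
          show "open (ball P R \<inter> {x. 0 < x \<bullet> v})"
            by (intro open_Int open_ball open_Collect_less continuous_intros)
        qed (use 4 in \<open>auto simp: K_def\<close>)
        moreover have "supersol h y" using 4 by (intro sup) auto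
        moreover have "\<exists>d l. has_lap \<phi> y d l \<and> l > 0"
        proof -
          let ?D = "(y - P) \<bullet> (y - P)"
          let ?E = "exp (- a * ?D)"
          have "has_lap (\<lambda>x. exp (- a * ((x - P) \<bullet> (x - P)))) y ((- a * ?E) *\<^sub>R (2 *\<^sub>R (y - P)))
              ((a\<^sup>2 * ?E) * ((2 *\<^sub>R (y - P)) \<bullet> (2 *\<^sub>R (y - P))) + (- a * ?E) * (2 * DIM('a)))"
            by (rule has_lap_compose[where F = "\<lambda>t. exp (- a * t)" and F' = "\<lambda>t. - a * exp (- a * t)", OF has_lap_dist_sq])
              (auto intro!: derivative_eq_intros always_eventually simp: power2_eq_square)
          from has_lap_cmult[OF has_lap_mult[OF has_lap_linear[of v] has_lap_diff[OF this has_lap_const[of "exp (- a * R\<^sup>2)"]]], of \<epsilon>]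
          obtain d l where d: "has_lap \<phi> y d l" and "l = \<epsilon> * ((y \<bullet> v) * ((a\<^sup>2 * ?E) * ((2 *\<^sub>R (y - P)) \<bullet> (2 *\<^sub>R (y - P))) +
              (- a * ?E) * (2 * DIM('a)) - 0) + 2 * (v \<bullet> ((- a * ?E) *\<^sub>R (2 *\<^sub>R (y - P)) - 0)) +
              (?E - exp (- a * R\<^sup>2)) * 0)"
            unfolding \<phi>_def G_def by blast
          then have l: "l = \<epsilon> * ((y \<bullet> v) * ((a\<^sup>2 * ?E) * (4 * ?D) - 2 * a * ?E * DIM('a)) +
              2 * (v \<bullet> ((- a * ?E) *\<^sub>R (2 *\<^sub>R (y - P)))))"
            by (simp only: inner_scaleR_left inner_scaleR_right) simp
          have "2 * (v \<bullet> ((- a * ?E) *\<^sub>R (2 *\<^sub>R (y - P)))) = - 4 * a * ?E * (y \<bullet> v - P \<bullet> v)"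
            by (simp add: inner_diff_right inner_commute algebra_simps)
          \<comment> \<open>The position of the centre enters here: the part of the gradient term
            containing \<open>P \<bullet> v\<close> is nonnegative, and the part containing
            \<open>y \<bullet> v\<close> is absorbed by
            \<open>a * ?D \<ge> DIM('a) + 2\<close>.\<close>
          then have eq: "(y \<bullet> v) * ((a\<^sup>2 * ?E) * (4 * ?D) - 2 * a * ?E * DIM('a)) +
              2 * (v \<bullet> ((- a * ?E) *\<^sub>R (2 *\<^sub>R (y - P)))) =
              ?E * a * ((y \<bullet> v) * (4 * (a * ?D) - 2 * DIM('a) - 4) + 4 * (P \<bullet> v))"
            by (simp only:) (simp add: algebra_simps power2_eq_square)
          have "a * \<kappa>\<^sup>2 \<le> a * ?D"
            using a 4 assms unfolding xP by (intro mult_left_mono power_mono) auto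
          then have "a * ?D \<ge> DIM('a) + 2" using assms by (simp add: a_def)
          then have "0 < (y \<bullet> v) * (4 * (a * ?D) - 2 * DIM('a) - 4)"
            using 4 by (intro mult_pos_pos) auto
          then have "0 < (y \<bullet> v) * (4 * (a * ?D) - 2 * DIM('a) - 4) + 4 * (P \<bullet> v)"
            using P by simp
          then show ?thesis
            using d \<epsilon> a unfolding l eq by (intro exI conjI) (assumption, simp)
        qed
        ultimately show ?thesis by blast
      qed
    qed
    moreover have "c * (x \<bullet> v) \<le> \<phi> x"
    proof -
      have "(dist P x)\<^sup>2 \<le> \<rho>\<^sup>2" using x by (intro power_mono) auto
      then have "exp (- a * \<rho>\<^sup>2) - exp (- a * R\<^sup>2) \<le> G P x"
        using a by (simp add: G_def xP)
      then show ?thesis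
        unfolding \<phi>_def c_def mult.assoc mult.commute[of "x \<bullet> v"] using \<epsilon> x(2)
        by (intro mult_left_mono mult_right_mono) auto
    qed
    ultimately show ?thesis by simp
  qed
  ultimately show ?thesis using that by blast
qed

context orthonormal_pair
begin

text \<open>The open half space of each of the three directions misses the slit. The radii fit
  together: \<open>5/4 + 5/2 < 4\<close> keeps the outer ball in the domain, and
  \<open>1 + 5/4 = 9/4\<close> lets the inner ball cover the unit ball, so one application reaches
  the whole half of the unit ball.\<close>

lemma hopf_unit:
  assumes v: "v \<in> {e, f, - f}" and "0 < \<kappa>" "0 < m"
  obtains c where "c > 0"
    "\<And>P h x. 0 \<le> P \<bullet> v \<Longrightarrow> norm P \<le> 5/4 \<Longrightarrow> continuous_on (ball 0 4) h \<Longrightarrow>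
      (\<And>x. x \<in> ball 0 4 \<Longrightarrow> 0 \<le> h x) \<Longrightarrow> (\<And>x. x \<in> ball 0 4 - slit \<Longrightarrow> supersol h x) \<Longrightarrow>
      (\<And>x. x \<in> cball P \<kappa> \<Longrightarrow> 0 \<le> x \<bullet> v \<Longrightarrow> m \<le> h x) \<Longrightarrow>
      norm x \<le> 1 \<Longrightarrow> 0 \<le> x \<bullet> v \<Longrightarrow> c * (x \<bullet> v) \<le> h x"
proof -
  have vv: "v \<bullet> v = 1" using v ee ff by auto
  then have nv: "norm v = 1" by (simp add: norm_eq_1)
  have r: "(9/4::real) < 5/2" "(0::real) < 9/4" by simp_all
  show ?thesis
  proof (rule hopf_half_ball[OF vv assms(2,3) r])
    fix c :: real assume c: "c > 0"
      "\<And>P h x. 0 \<le> P \<bullet> v \<Longrightarrow> P \<bullet> v \<le> 5/2 \<Longrightarrow> continuous_on {x \<in> cball P (5/2). 0 \<le> x \<bullet> v} h \<Longrightarrow>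
        (\<And>x. x \<in> cball P (5/2) \<Longrightarrow> 0 \<le> x \<bullet> v \<Longrightarrow> 0 \<le> h x) \<Longrightarrow>
        (\<And>x. x \<in> ball P (5/2) \<Longrightarrow> 0 < x \<bullet> v \<Longrightarrow> supersol h x) \<Longrightarrow>
        (\<And>x. x \<in> cball P \<kappa> \<Longrightarrow> 0 \<le> x \<bullet> v \<Longrightarrow> m \<le> h x) \<Longrightarrow>
        x \<in> cball P (9/4) \<Longrightarrow> 0 \<le> x \<bullet> v \<Longrightarrow> c * (x \<bullet> v) \<le> h x"
    show ?thesis
    proof (rule that[OF c(1)])
      fix P h x
      assume P: "0 \<le> P \<bullet> v" "norm P \<le> 5/4" and h: "continuous_on (ball 0 4) h"
        and h0: "\<And>x. x \<in> ball 0 4 \<Longrightarrow> 0 \<le> h x" and sup: "\<And>x. x \<in> ball 0 4 - slit \<Longrightarrow> supersol h x"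
        and hm: "\<And>x. x \<in> cball P \<kappa> \<Longrightarrow> 0 \<le> x \<bullet> v \<Longrightarrow> m \<le> h x"
        and x: "norm x \<le> 1" "0 \<le> x \<bullet> v"
      have sub: "cball P (5/2) \<subseteq> ball 0 4"
      proof
        fix y assume "y \<in> cball P (5/2)"
        then show "y \<in> ball 0 4"
          using norm_triangle_sub[of y P] P by (simp add: dist_norm norm_minus_commute)
      qed
      show "c * (x \<bullet> v) \<le> h x"
      proof (rule c(2)[of P h x])
        show "P \<bullet> v \<le> 5/2"
          using Cauchy_Schwarz_ineq2[of P v] nv P by simp
        show "continuous_on {x \<in> cball P (5/2). 0 \<le> x \<bullet> v} h"
          by (rule continuous_on_subset[OF h]) (use sub in auto)
        show "0 \<le> h y" if "y \<in> cball P (5/2)" for y using that sub h0 by blast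
        show "supersol h y" if "y \<in> ball P (5/2)" "0 < y \<bullet> v" for y
        proof (rule sup)
          have "y \<in> cball P (5/2)" using that(1) by auto
          then show "y \<in> ball 0 4 - slit"
            using sub v that(2) by (auto simp: slit_def)
        qed
        show "x \<in> cball P (9/4)"
          using norm_triangle_ineq4[of P x] P x by (simp add: dist_norm)
      qed (use P hm x in auto)
    qed
  qed
qed

text \<open>The chain of half balls goes from the side of the slit that contains \<open>Y\<close> to \<open>{x. x \<bullet> e > 0}\<close>, which
  the slit does not meet, and from there to the other side.\<close>

lemma gain_signed:
  assumes "\<delta> > 0" "C \<ge> 0" and \<sigma>: "\<sigma> \<in> {1, -1}"
  obtains c where "c > 0"
    "\<And>h Y x. continuous_on (ball 0 4) h \<Longrightarrow>
      (\<And>x. x \<in> ball 0 4 \<Longrightarrow> 0 \<le> h x) \<Longrightarrow> (\<And>x. x \<in> ball 0 4 - slit \<Longrightarrow> supersol h x) \<Longrightarrow>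
      (\<And>x y. x \<in> ball 0 4 \<Longrightarrow> y \<in> ball 0 4 \<Longrightarrow> \<bar>h x - h y\<bar> \<le> C * sqrt (norm (x - y))) \<Longrightarrow>
      norm Y = 1 \<Longrightarrow> \<delta> \<le> h Y \<Longrightarrow> 0 \<le> \<sigma> * (Y \<bullet> f) \<Longrightarrow> norm x \<le> 1 \<Longrightarrow>
      c * \<bar>x \<bullet> f\<bar> \<le> h x \<and> c * (x \<bullet> e) \<le> h x"
proof -
  \<comment> \<open>On the ball of this radius about \<open>Y\<close> the Hoelder bound costs at
    most \<open>\<delta> / 2\<close>; the summand 2 in the denominator covers
    \<open>C = 0\<close>.\<close>
  define \<kappa> where "\<kappa> = min (1/4) ((\<delta> / (2 * C + 2))\<^sup>2)"
  have "\<delta> / (2 * C + 2) > 0" using assms by simp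
  then have \<kappa>: "\<kappa> > 0" "\<kappa> \<le> 1/4" "sqrt \<kappa> \<le> \<delta> / (2 * C + 2)"
    by (auto simp: \<kappa>_def intro!: real_le_lsqrt)
  have "C * sqrt \<kappa> \<le> C * (\<delta> / (2 * C + 2))"
    using \<kappa> assms by (intro mult_left_mono)
  also have "\<dots> \<le> \<delta> / 2" using assms by (simp add: field_simps)
  finally have C\<kappa>: "C * sqrt \<kappa> \<le> \<delta> / 2" .
  have v: "\<sigma> *\<^sub>R f \<in> {e, f, - f}" "- \<sigma> *\<^sub>R f \<in> {e, f, - f}" "e \<in> {e, f, - f}"
    using \<sigma> by auto
  obtain c1 where c1: "c1 > 0" 
    "\<And>P h x. 0 \<le> P \<bullet> (\<sigma> *\<^sub>R f) \<Longrightarrow> norm P \<le> 5/4 \<Longrightarrow> continuous_on (ball 0 4) h \<Longrightarrow>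
      (\<And>x. x \<in> ball 0 4 \<Longrightarrow> 0 \<le> h x) \<Longrightarrow> (\<And>x. x \<in> ball 0 4 - slit \<Longrightarrow> supersol h x) \<Longrightarrow>
      (\<And>x. x \<in> cball P \<kappa> \<Longrightarrow> 0 \<le> x \<bullet> (\<sigma> *\<^sub>R f) \<Longrightarrow> \<delta> / 2 \<le> h x) \<Longrightarrow>
      norm x \<le> 1 \<Longrightarrow> 0 \<le> x \<bullet> (\<sigma> *\<^sub>R f) \<Longrightarrow> c1 * (x \<bullet> (\<sigma> *\<^sub>R f)) \<le> h x"
    using hopf_unit[OF v(1) \<kappa>(1), of "\<delta> / 2"] assms(1) by (metis half_gt_zero)
  have "c1 / 4 > 0" using c1(1) by simp
  obtain c2 where c2: "c2 > 0" 
    "\<And>P h x. 0 \<le> P \<bullet> e \<Longrightarrow> norm P \<le> 5/4 \<Longrightarrow> continuous_on (ball 0 4) h \<Longrightarrow>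
      (\<And>x. x \<in> ball 0 4 \<Longrightarrow> 0 \<le> h x) \<Longrightarrow> (\<And>x. x \<in> ball 0 4 - slit \<Longrightarrow> supersol h x) \<Longrightarrow>
      (\<And>x. x \<in> cball P (1/4) \<Longrightarrow> 0 \<le> x \<bullet> e \<Longrightarrow> c1 / 4 \<le> h x) \<Longrightarrow>
      norm x \<le> 1 \<Longrightarrow> 0 \<le> x \<bullet> e \<Longrightarrow> c2 * (x \<bullet> e) \<le> h x"
    using hopf_unit[OF v(3) _ \<open>c1 / 4 > 0\<close>, of "1/4"] by (metis zero_less_divide_1_iff zero_less_numeral)
  have "c2 / 4 > 0" using c2(1) by simp
  obtain c3 where c3: "c3 > 0" 
    "\<And>P h x. 0 \<le> P \<bullet> (- \<sigma> *\<^sub>R f) \<Longrightarrow> norm P \<le> 5/4 \<Longrightarrow> continuous_on (ball 0 4) h \<Longrightarrow>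
      (\<And>x. x \<in> ball 0 4 \<Longrightarrow> 0 \<le> h x) \<Longrightarrow> (\<And>x. x \<in> ball 0 4 - slit \<Longrightarrow> supersol h x) \<Longrightarrow>
      (\<And>x. x \<in> cball P (1/4) \<Longrightarrow> 0 \<le> x \<bullet> (- \<sigma> *\<^sub>R f) \<Longrightarrow> c2 / 4 \<le> h x) \<Longrightarrow>
      norm x \<le> 1 \<Longrightarrow> 0 \<le> x \<bullet> (- \<sigma> *\<^sub>R f) \<Longrightarrow> c3 * (x \<bullet> (- \<sigma> *\<^sub>R f)) \<le> h x"
    using hopf_unit[OF v(2) _ \<open>c2 / 4 > 0\<close>, of "1/4"] by (metis zero_less_divide_1_iff zero_less_numeral)
  define c where "c = min c1 (min c2 c3)"
  show ?thesis
  proof (rule that[of c])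
    show "c > 0" using c1(1) c2(1) c3(1) by (simp add: c_def)
    fix h and Y x :: 'a
    assume h: "continuous_on (ball 0 4) h" "\<And>x. x \<in> ball 0 4 \<Longrightarrow> 0 \<le> h x"
        "\<And>x. x \<in> ball 0 4 - slit \<Longrightarrow> supersol h x"
      and holder: "\<And>x y. x \<in> ball 0 4 \<Longrightarrow> y \<in> ball 0 4 \<Longrightarrow> \<bar>h x - h y\<bar> \<le> C * sqrt (norm (x - y))"
      and Y: "norm Y = 1" "\<delta> \<le> h Y" "0 \<le> \<sigma> * (Y \<bullet> f)" and x: "norm x \<le> 1"
    have h1: "c1 * (x \<bullet> (\<sigma> *\<^sub>R f)) \<le> h x" if x: "norm x \<le> 1" "0 \<le> x \<bullet> (\<sigma> *\<^sub>R f)" for x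
    proof (rule c1(2)[of Y h x, OF _ _ h])
      fix y assume y: "y \<in> cball Y \<kappa>"
      have "norm y \<le> 5/4"
        using y norm_triangle_sub[of y Y] Y(1) \<kappa>(2) by (simp add: dist_norm norm_minus_commute)
      then have "\<bar>h Y - h y\<bar> \<le> C * sqrt (norm (Y - y))" using Y(1) by (intro holder) auto
      also have "\<dots> \<le> C * sqrt \<kappa>"
        using y assms by (intro mult_left_mono) (auto simp: dist_norm)
      finally show "\<delta> / 2 \<le> h y" using C\<kappa> Y(2) by linarith
    qed (use Y x in auto)
    \<comment> \<open>\<open>Q s\<close> has distance 1/2 from both hyperplanes
      \<open>x \<bullet> e = 0\<close> and \<open>x \<bullet> f = 0\<close>. Its ball of radius 1/4
      therefore lies in the unit ball and stays 1/4 away from both, and a linear bound with factor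
      \<open>c1\<close> or \<open>c2\<close> in one half ball becomes the constant bound
      \<open>c1 / 4\<close> or \<open>c2 / 4\<close> that starts the next one.\<close>
    define Q where "Q s = (1/2) *\<^sub>R e + (s / 2) *\<^sub>R f" for s :: real
    have Qe: "Q s \<bullet> e = 1/2" and Qf: "Q s \<bullet> f = s / 2" for s
      by (simp_all add: Q_def inner_add_left ee ff ef fe)
    have nQ: "norm (Q s) \<le> 3/4" if "s \<in> {1, -1}" for s
    proof -
      have "(norm (Q s))\<^sup>2 = 1/2"
        using that by (auto simp: power2_norm_eq_inner Q_def inner_add_left inner_add_right ee ff ef fe)
      then have "(norm (Q s))\<^sup>2 \<le> (3/4)\<^sup>2" by (simp add: power2_eq_square)
      then show ?thesis by (rule power2_le_imp_le) simp
    qed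
    have ball: "norm y \<le> 1" "\<bar>y \<bullet> e - 1/2\<bar> \<le> 1/4" "\<bar>y \<bullet> f - s/2\<bar> \<le> 1/4"
      if "y \<in> cball (Q s) (1/4)" "s \<in> {1, -1}" for y s
    proof -
      have d: "norm (y - Q s) \<le> 1/4" using that by (simp add: dist_norm norm_minus_commute)
      then show "norm y \<le> 1" using norm_triangle_sub[of y "Q s"] nQ[OF that(2)] by simp
      show "\<bar>y \<bullet> e - 1/2\<bar> \<le> 1/4" "\<bar>y \<bullet> f - s/2\<bar> \<le> 1/4"
        using d norm_proj_le[of "y - Q s"] proj_e_bound[of "y - Q s"] by (simp_all add: inner_diff_left Qe Qf)
    qed
    have h2: "c2 * (x \<bullet> e) \<le> h x" if x: "norm x \<le> 1" "0 \<le> x \<bullet> e" for x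
    proof (rule c2(2)[of "Q \<sigma>" h x, OF _ _ h])
      fix y assume "y \<in> cball (Q \<sigma>) (1/4)"
      note y = ball[OF this \<sigma>]
      have y4: "y \<bullet> (\<sigma> *\<^sub>R f) \<ge> 1/4" using y(3) \<sigma> by (auto simp: abs_if split: if_splits)
      then have "c1 * (1/4) \<le> c1 * (y \<bullet> (\<sigma> *\<^sub>R f))" using c1(1) by (intro mult_left_mono) auto
      also have "\<dots> \<le> h y" using y(1) y4 by (intro h1) auto
      finally show "c1 / 4 \<le> h y" by simp
    next
      show "0 \<le> Q \<sigma> \<bullet> e" unfolding Qe by simp
    qed (use x nQ[OF \<sigma>] in auto)
    have \<sigma>': "- \<sigma> \<in> {1, -1}" using \<sigma> by auto
    have h3: "c3 * (x \<bullet> (- \<sigma> *\<^sub>R f)) \<le> h x" if x: "norm x \<le> 1" "0 \<le> x \<bullet> (- \<sigma> *\<^sub>R f)" for x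
    proof (rule c3(2)[of "Q (- \<sigma>)" h x, OF _ _ h])
      fix y assume "y \<in> cball (Q (- \<sigma>)) (1/4)"
      note y = ball[OF this \<sigma>']
      have y4: "y \<bullet> e \<ge> 1/4" using y(2) by (auto simp: abs_if split: if_splits)
      then have "c2 * (1/4) \<le> c2 * (y \<bullet> e)" using c2(1) by (intro mult_left_mono) auto
      also have "\<dots> \<le> h y" using y(1) y4 by (intro h2) auto
      finally show "c2 / 4 \<le> h y" by simp
    next
      show "0 \<le> Q (- \<sigma>) \<bullet> (- \<sigma> *\<^sub>R f)" using \<sigma> by (auto simp: Qf)
    qed (use x nQ[OF \<sigma>'] in auto)
    have h0: "0 \<le> h x" using h(2)[of x] x by simp
    show "c * \<bar>x \<bullet> f\<bar> \<le> h x \<and> c * (x \<bullet> e) \<le> h x"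
    proof
      show "c * \<bar>x \<bullet> f\<bar> \<le> h x"
      proof (cases "0 \<le> x \<bullet> (\<sigma> *\<^sub>R f)")
        case True
        then have "\<bar>x \<bullet> f\<bar> = x \<bullet> (\<sigma> *\<^sub>R f)" using \<sigma> by auto
        then have "c * \<bar>x \<bullet> f\<bar> \<le> c1 * (x \<bullet> (\<sigma> *\<^sub>R f))"
          using True by (simp add: c_def mult_right_mono del: inner_scaleR_right)
        with h1[OF x True] show ?thesis by simp
      next
        case False
        then have *: "0 \<le> x \<bullet> (- \<sigma> *\<^sub>R f)" by simp
        then have "\<bar>x \<bullet> f\<bar> = x \<bullet> (- \<sigma> *\<^sub>R f)" using \<sigma> by auto
        then have "c * \<bar>x \<bullet> f\<bar> \<le> c3 * (x \<bullet> (- \<sigma> *\<^sub>R f))"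
          using mult_right_mono[OF _ *, of c c3] unfolding c_def by simp
        with h3[OF x *] show ?thesis by simp
      qed
      show "c * (x \<bullet> e) \<le> h x"
      proof (cases "0 \<le> x \<bullet> e")
        case True
        then have "c * (x \<bullet> e) \<le> c2 * (x \<bullet> e)" by (simp add: c_def mult_right_mono)
        with h2[OF x True] show ?thesis by simp
      next
        case False
        then have "c * (x \<bullet> e) \<le> 0" using \<open>c > 0\<close> by (simp add: mult_nonneg_nonpos)
        with h0 show ?thesis by simp
      qed
    qed
  qed
qed

text \<open>Where \<open>x \<bullet> e < 0\<close>, enlarging one factor
  \<open>norm (proj x)\<close> to \<open>norm (proj x) - x \<bullet> e\<close> produces a difference
  of squares, namely the square of \<open>x \<bullet> f\<close>. So at a fixed distance from the
  edge, \<open>root\<close> is controlled by the linear quantities that \<open>gain_signed\<close>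
  bounds.\<close>

lemma sqrt_root_le: "sqrt (norm (proj x)) * root x \<le> \<bar>x \<bullet> f\<bar> + max (x \<bullet> e) 0"
proof (cases "x \<bullet> e \<ge> 0")
  case True
  have "sqrt (norm (proj x)) * root x \<le> sqrt (norm (proj x)) * sqrt (norm (proj x))"
    by (intro mult_left_mono root_le_sqrt) simp
  also have "\<dots> \<le> \<bar>x \<bullet> f\<bar> + \<bar>x \<bullet> e\<bar>"
    using cmod_le[of "proj x"] by simp
  finally show ?thesis using True by simp
next
  case False
  let ?r = "norm (proj x)"
  have r2: "?r\<^sup>2 = (x \<bullet> e)\<^sup>2 + (x \<bullet> f)\<^sup>2" by (simp add: cmod_power2)
  have "(?r + x \<bullet> e) * ?r \<le> (?r + x \<bullet> e) * (?r - x \<bullet> e)"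
    using False proj_e_bound(1)[of x] by (intro mult_left_mono) auto
  also have "\<dots> = (x \<bullet> f)\<^sup>2" using r2 by (simp add: algebra_simps power2_eq_square)
  finally have "?r * ((?r + x \<bullet> e) / 2) \<le> (x \<bullet> f)\<^sup>2 / 2"
    by (simp add: mult.commute)
  also have "\<dots> \<le> (x \<bullet> f)\<^sup>2" by simp
  finally have "?r * ((?r + x \<bullet> e) / 2) \<le> (x \<bullet> f)\<^sup>2" .
  then have "sqrt (?r * ((?r + x \<bullet> e) / 2)) \<le> \<bar>x \<bullet> f\<bar>"
    using real_sqrt_le_mono[of "?r * ((?r + x \<bullet> e) / 2)" "(x \<bullet> f)\<^sup>2"] by simp
  then show ?thesis by (simp add: root_eq real_sqrt_mult[symmetric])
qed

text \<open>The linear bounds of \<open>gain_signed\<close> degenerate at the edge faster than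
  \<open>root\<close>. They are used only on the surface of a cylinder about the edge and are
  carried inwards by a barrier that behaves like \<open>root\<close> itself.\<close>

lemma gain:
  assumes "\<delta> > 0" "C \<ge> 0"
  obtains c r where "c > 0" "r > 0"
    "\<And>h Y x. continuous_on (ball 0 4) h \<Longrightarrow>
      (\<And>x. x \<in> ball 0 4 \<Longrightarrow> 0 \<le> h x) \<Longrightarrow> (\<And>x. x \<in> ball 0 4 - slit \<Longrightarrow> supersol h x) \<Longrightarrow>
      (\<And>x y. x \<in> ball 0 4 \<Longrightarrow> y \<in> ball 0 4 \<Longrightarrow> \<bar>h x - h y\<bar> \<le> C * sqrt (norm (x - y))) \<Longrightarrow>
      norm Y = 1 \<Longrightarrow> \<delta> \<le> h Y \<Longrightarrow> norm x \<le> r \<Longrightarrow> c * root x \<le> h x"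
proof -
  have one: "(1::real) \<in> {1, -1}" "(-1::real) \<in> {1, -1}" by simp_all
  obtain a1 where a1: "a1 > 0"
    "\<And>h Y x. continuous_on (ball 0 4) h \<Longrightarrow>
      (\<And>x. x \<in> ball 0 4 \<Longrightarrow> 0 \<le> h x) \<Longrightarrow> (\<And>x. x \<in> ball 0 4 - slit \<Longrightarrow> supersol h x) \<Longrightarrow>
      (\<And>x y. x \<in> ball 0 4 \<Longrightarrow> y \<in> ball 0 4 \<Longrightarrow> \<bar>h x - h y\<bar> \<le> C * sqrt (norm (x - y))) \<Longrightarrow>
      norm Y = 1 \<Longrightarrow> \<delta> \<le> h Y \<Longrightarrow> 0 \<le> 1 * (Y \<bullet> f) \<Longrightarrow> norm x \<le> 1 \<Longrightarrow>
      a1 * \<bar>x \<bullet> f\<bar> \<le> h x \<and> a1 * (x \<bullet> e) \<le> h x"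
    using gain_signed[OF assms one(1)] by metis
  obtain a2 where a2: "a2 > 0"
    "\<And>h Y x. continuous_on (ball 0 4) h \<Longrightarrow>
      (\<And>x. x \<in> ball 0 4 \<Longrightarrow> 0 \<le> h x) \<Longrightarrow> (\<And>x. x \<in> ball 0 4 - slit \<Longrightarrow> supersol h x) \<Longrightarrow>
      (\<And>x y. x \<in> ball 0 4 \<Longrightarrow> y \<in> ball 0 4 \<Longrightarrow> \<bar>h x - h y\<bar> \<le> C * sqrt (norm (x - y))) \<Longrightarrow>
      norm Y = 1 \<Longrightarrow> \<delta> \<le> h Y \<Longrightarrow> 0 \<le> -1 * (Y \<bullet> f) \<Longrightarrow> norm x \<le> 1 \<Longrightarrow>
      a2 * \<bar>x \<bullet> f\<bar> \<le> h x \<and> a2 * (x \<bullet> e) \<le> h x"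
    using gain_signed[OF assms one(2)] by metis
  define a where "a = min a1 a2"
  have a: "a > 0" using a1(1) a2(1) by (simp add: a_def)
  define N where "N = real DIM('a)"
  have N: "N \<ge> 1" using DIM_positive[where 'a = 'a] by (simp add: N_def)
  define \<eta> where "\<eta> = 1 / (2 * sqrt N)"
  have \<eta>: "\<eta> > 0" "4 * N * \<eta>\<^sup>2 = 1"
    using N by (auto simp: \<eta>_def power_divide power_mult_distrib)
  \<comment> \<open>Where \<open>norm (proj y) = \<eta>\<close> and \<open>q y \<le> 2\<close>, this
    makes the barrier at most \<open>a / 2 * (sqrt \<eta> * root y)\<close>, which
    \<open>sqrt_root_le\<close> and the linear bounds place below \<open>h\<close>.\<close>
  define \<epsilon> where "\<epsilon> = a * sqrt \<eta> / 4"
  have \<epsilon>: "\<epsilon> > 0" using a \<eta> by (simp add: \<epsilon>_def)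
  \<comment> \<open>The planar term lifts the Laplacian of \<open>q\<close> from
    \<open>- 8 * N\<close> to \<open>8 * N\<close>. By the choice of \<open>\<eta>\<close> it is at
    most 1 on the cylinder, so \<open>q\<close> is negative on the unit sphere there, while
    \<open>q \<ge> 1/2\<close> for \<open>norm x \<le> 1/4\<close>. The form \<open>x - 0\<close>
    matches \<open>has_lap_dist_sq\<close>.\<close>
  define q where "q x = 1 - 4 * ((x - 0) \<bullet> (x - 0)) + 4 * N * ((x \<bullet> e) * (x \<bullet> e) + (x \<bullet> f) * (x \<bullet> f))" for x
  have q_eq: "q x = 1 - 4 * (norm x)\<^sup>2 + 4 * N * (norm (proj x))\<^sup>2" for x
    by (simp add: q_def cmod_power2 dot_square_norm) (simp add: power2_eq_square)
  show ?thesis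
  proof (rule that[of "\<epsilon> / 2" "min (1/4) \<eta>"])
    show "\<epsilon> / 2 > 0" "min (1/4) \<eta> > 0" using \<epsilon> \<eta> by auto
    fix h Y and x :: 'a
    assume h: "continuous_on (ball 0 4) h" "\<And>x. x \<in> ball 0 4 \<Longrightarrow> 0 \<le> h x"
        "\<And>x. x \<in> ball 0 4 - slit \<Longrightarrow> supersol h x"
      "\<And>x y. x \<in> ball 0 4 \<Longrightarrow> y \<in> ball 0 4 \<Longrightarrow> \<bar>h x - h y\<bar> \<le> C * sqrt (norm (x - y))"
      and Y: "norm Y = 1" "\<delta> \<le> h Y" and x: "norm x \<le> min (1/4) \<eta>"
    have lower: "a * (\<bar>y \<bullet> f\<bar> + max (y \<bullet> e) 0) \<le> 2 * h y" if y: "norm y \<le> 1" for y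
    proof -
      have hy: "0 \<le> h y" using h(2)[of y] y by simp
      have 1: "a1 * \<bar>y \<bullet> f\<bar> \<le> h y \<and> a1 * (y \<bullet> e) \<le> h y \<or> a2 * \<bar>y \<bullet> f\<bar> \<le> h y \<and> a2 * (y \<bullet> e) \<le> h y"
      proof (cases "0 \<le> Y \<bullet> f")
        case True
        then show ?thesis using a1(2)[OF h Y _ y] by auto
      next
        case False
        then show ?thesis using a2(2)[OF h Y _ y] by auto
      qed
      have mono: "a * t \<le> b * t" if "t \<ge> 0" "b \<ge> a" for b t using that by (simp add: mult_right_mono)
      have f: "a * \<bar>y \<bullet> f\<bar> \<le> h y"
        using 1 mono[of "\<bar>y \<bullet> f\<bar>" a1] mono[of "\<bar>y \<bullet> f\<bar>" a2] by (auto simp: a_def)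
      have "a * max (y \<bullet> e) 0 \<le> h y"
      proof (cases "y \<bullet> e \<ge> 0")
        case True
        then show ?thesis using 1 mono[of "y \<bullet> e" a1] mono[of "y \<bullet> e" a2] by (auto simp: a_def)
      qed (use hy in auto)
      with f show ?thesis by (simp add: distrib_left)
    qed
    define K where "K = cball 0 1 \<inter> {x. norm (proj x) \<le> \<eta>}"
    \<comment> \<open>\<open>root\<close> is homogeneous of degree 1/2, so its gradient has the inner product \<open>(8 * N - 8) * root / 2\<close>
      with that of \<open>q\<close>, and \<open>root * q\<close> is a strict subsolution off the slit. On the lateral boundary
      \<open>norm (proj x) = \<eta>\<close> the linear lower bounds for \<open>h\<close> dominate \<open>root\<close>.\<close>
    define \<phi> where "\<phi> x = \<epsilon> * (root x * q x)" for x
    have "\<phi> x \<le> h x"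
    proof (rule comparison[where K = K])
      show "compact K"
        unfolding K_def by (intro compact_Int_closed compact_cball closed_Collect_le continuous_intros
            continuous_proj)
      show "continuous_on K h" by (rule continuous_on_subset[OF h(1)]) (auto simp: K_def)
      show "continuous_on K \<phi>"
        unfolding \<phi>_def q_def by (intro continuous_intros continuous_root)
      show "x \<in> K" using x norm_proj_le[of x] by (simp add: K_def)
      fix y assume "y \<in> K"
      then have y: "norm y \<le> 1" "norm (proj y) \<le> \<eta>" by (auto simp: K_def)
      have "4 * N * (norm (proj y))\<^sup>2 \<le> 4 * N * \<eta>\<^sup>2"
        using y(2) N by (intro mult_left_mono power_mono) auto
      then have q: "q y \<le> 2 - 4 * (norm y)\<^sup>2" unfolding q_eq \<eta>(2) by simp
      have hy: "0 \<le> h y" using h(2)[of y] y by simp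
      consider "y \<in> slit" | "norm y = 1" | "norm (proj y) = \<eta>"
        | "norm y < 1" "norm (proj y) < \<eta>" "y \<notin> slit"
        using y by linarith
      then show "\<phi> y \<le> h y \<or> y \<in> interior K \<and> supersol h y \<and> (\<exists>d l. has_lap \<phi> y d l \<and> l > 0)"
      proof cases
        case 1
        then have "\<phi> y = 0" by (simp add: \<phi>_def root_zero_iff)
        with hy show ?thesis by simp
      next
        case 2
        then have "\<phi> y \<le> 0"
          using q \<epsilon> root_nonneg[of y] unfolding \<phi>_def by (intro mult_nonneg_nonpos) auto
        with hy show ?thesis by simp
      next
        case 3
        have "\<phi> y \<le> \<epsilon> * (root y * 2)"
          unfolding \<phi>_def using \<epsilon> root_nonneg[of y] q
          by (intro mult_left_mono) (auto intro: order_trans)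
        also have "\<dots> = a / 2 * (sqrt (norm (proj y)) * root y)" by (simp add: \<epsilon>_def 3)
        also have "\<dots> \<le> a / 2 * (\<bar>y \<bullet> f\<bar> + max (y \<bullet> e) 0)"
          using a by (intro mult_left_mono sqrt_root_le) auto
        also have "\<dots> \<le> h y" using lower[OF y(1)] by simp
        finally show ?thesis ..
      next
        case 4
        have "y \<in> interior K"
        proof (rule interiorI[of "ball 0 1 \<inter> {x. norm (proj x) < \<eta>}"])
          show "open (ball 0 1 \<inter> {x. norm (proj x) < \<eta>})"
            by (intro open_Int open_ball open_Collect_less continuous_intros continuous_proj)
        qed (use 4 in \<open>auto simp: K_def\<close>)
        moreover have "supersol h y" using 4 by (intro h(3)) auto
        moreover have "\<exists>d l. has_lap \<phi> y d l \<and> l > 0"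
        proof -
          from root_harmonic[OF 4(3)] obtain g where g: "has_lap root y g 0" "g \<bullet> y = root y / 2"
            "g \<bullet> ((y \<bullet> e) *\<^sub>R e + (y \<bullet> f) *\<^sub>R f) = root y / 2" by blast
          let ?p = "(y \<bullet> e) *\<^sub>R e + (y \<bullet> f) *\<^sub>R f"
          have qlap: "has_lap q y (- 8 *\<^sub>R y + (8 * N) *\<^sub>R ?p) (8 * N)"
          proof -
            have "has_lap q y (0 - 4 *\<^sub>R (2 *\<^sub>R (y - 0)) + (4 * N) *\<^sub>R
                (((y \<bullet> e) *\<^sub>R e + (y \<bullet> e) *\<^sub>R e) + ((y \<bullet> f) *\<^sub>R f + (y \<bullet> f) *\<^sub>R f)))
              (0 - 4 * real (2 * DIM('a)) + (4 * N) * (((y \<bullet> e) * 0 + 2 * (e \<bullet> e) + (y \<bullet> e) * 0) +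
                ((y \<bullet> f) * 0 + 2 * (f \<bullet> f) + (y \<bullet> f) * 0)))"
              unfolding q_def
              by (intro has_lap_add has_lap_diff has_lap_cmult has_lap_mult has_lap_const has_lap_linear has_lap_dist_sq)
            moreover have "0 - 4 *\<^sub>R (2 *\<^sub>R (y - 0)) + (4 * N) *\<^sub>R
                (((y \<bullet> e) *\<^sub>R e + (y \<bullet> e) *\<^sub>R e) + ((y \<bullet> f) *\<^sub>R f + (y \<bullet> f) *\<^sub>R f)) = - 8 *\<^sub>R y + (8 * N) *\<^sub>R ?p"
              by (simp add: algebra_simps flip: scaleR_add_left)
            ultimately show ?thesis by (simp add: ee ff N_def)
          qed
          have "has_lap \<phi> y (\<epsilon> *\<^sub>R (root y *\<^sub>R (- 8 *\<^sub>R y + (8 * N) *\<^sub>R ?p) + q y *\<^sub>R g))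
              (\<epsilon> * (root y * (8 * N) + 2 * (g \<bullet> (- 8 *\<^sub>R y + (8 * N) *\<^sub>R ?p)) + q y * 0))"
            unfolding \<phi>_def by (intro has_lap_cmult has_lap_mult g(1) qlap)
          moreover have "g \<bullet> (- 8 *\<^sub>R y + (8 * N) *\<^sub>R ?p) = - 8 * (root y / 2) + 8 * N * (root y / 2)"
            unfolding inner_add_right[of g "- 8 *\<^sub>R y"] inner_scaleR_right g(2,3) ..
          moreover have "0 < \<epsilon> * (root y * (8 * N) + 2 * (- 8 * (root y / 2) + 8 * N * (root y / 2)) + q y * 0)"
          proof -
            have "0 < root y * (16 * N - 8)" using root_pos[OF 4(3)] N by (intro mult_pos_pos) auto
            then show ?thesis using \<epsilon> by (intro mult_pos_pos) (auto simp: algebra_simps)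
          qed
          ultimately show ?thesis by metis
        qed
        ultimately show ?thesis by blast
      qed
    qed
    moreover have "\<epsilon> / 2 * root x \<le> \<phi> x"
    proof -
      have "(norm x)\<^sup>2 \<le> (1/4)\<^sup>2" using x by (intro power_mono) auto
      moreover have "0 \<le> 4 * N * (norm (proj x))\<^sup>2" using N by simp
      ultimately have "q x \<ge> 1/2" unfolding q_eq power2_eq_square[of "1/4"] by linarith
      then have "\<epsilon> * (root x * (1/2)) \<le> \<phi> x"
        unfolding \<phi>_def using \<epsilon> root_nonneg[of x] by (intro mult_left_mono) auto
      then show ?thesis by simp
    qed
    ultimately show "\<epsilon> / 2 * root x \<le> h x" by simp
  qed
qed

end

section \<open>Expansion for a flat slit\<close>

lemma continuous_on_sqrt_holder:
  fixes h :: "'a::real_normed_vector \<Rightarrow> real"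
  assumes "\<And>x y. x \<in> S \<Longrightarrow> y \<in> S \<Longrightarrow> \<bar>h x - h y\<bar> \<le> C * sqrt (norm (x - y))"
  shows "continuous_on S h"
  unfolding continuous_on_def
proof
  fix x assume x: "x \<in> S"
  have "((\<lambda>y. C * sqrt (norm (y - x))) \<longlongrightarrow> C * sqrt (norm (x - x))) (at x within S)"
    by (intro tendsto_intros)
  then have lim: "((\<lambda>y. C * sqrt (norm (y - x))) \<longlongrightarrow> 0) (at x within S)" by simp
  have "\<forall>\<^sub>F y in at x within S. norm (h y - h x) \<le> C * sqrt (norm (y - x))"
    using assms x by (auto simp: eventually_at_filter)
  from Lim_null_comparison[OF this lim] show "(h \<longlongrightarrow> h x) (at x within S)"
    by (simp add: LIM_zero_iff)
qed

context orthonormal_pair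
begin

text \<open>With \<rho> the norm of \<open>X\<close>, the function
  \<open>h (\<rho> *\<^sub>R y) / sqrt \<rho>\<close> has the same Hoelder constant as
  \<open>h\<close>, the slit is a cone, and \<open>root\<close> is invariant under the same
  rescaling. Hence \<open>c\<close> and \<open>r\<close> do not depend on \<open>X\<close>. The
  factor 4 is the radius of the domain in \<open>gain\<close>.\<close>

lemma gain_at_scale:
  assumes "\<delta> > 0" "C \<ge> 0"
  obtains c r where "c > 0" "r > 0"
    "\<And>h R X x. (\<And>x. x \<in> ball 0 R \<Longrightarrow> 0 \<le> h x) \<Longrightarrow> (\<And>x. x \<in> ball 0 R - slit \<Longrightarrow> supersol h x) \<Longrightarrow>
      (\<And>x y. x \<in> ball 0 R \<Longrightarrow> y \<in> ball 0 R \<Longrightarrow> \<bar>h x - h y\<bar> \<le> C * sqrt (norm (x - y))) \<Longrightarrow>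
      X \<noteq> 0 \<Longrightarrow> 4 * norm X \<le> R \<Longrightarrow> \<delta> * sqrt (norm X) \<le> h X \<Longrightarrow> norm x \<le> r * norm X \<Longrightarrow>
      c * root x \<le> h x"
proof (rule gain[OF assms])
  fix c r :: real
  assume cr: "c > 0" "r > 0"
    and gain: "\<And>h Y x. continuous_on (ball 0 4) h \<Longrightarrow>
      (\<And>x. x \<in> ball 0 4 \<Longrightarrow> 0 \<le> h x) \<Longrightarrow> (\<And>x. x \<in> ball 0 4 - slit \<Longrightarrow> supersol h x) \<Longrightarrow>
      (\<And>x y. x \<in> ball 0 4 \<Longrightarrow> y \<in> ball 0 4 \<Longrightarrow> \<bar>h x - h y\<bar> \<le> C * sqrt (norm (x - y))) \<Longrightarrow>
      norm Y = 1 \<Longrightarrow> \<delta> \<le> h Y \<Longrightarrow> norm x \<le> r \<Longrightarrow> c * root x \<le> h x"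
  show ?thesis
  proof (rule that[OF cr])
    fix h :: "'a \<Rightarrow> real" and R :: real and X x :: 'a
    assume h0: "\<And>x. x \<in> ball 0 R \<Longrightarrow> 0 \<le> h x" and sup: "\<And>x. x \<in> ball 0 R - slit \<Longrightarrow> supersol h x"
      and holder: "\<And>x y. x \<in> ball 0 R \<Longrightarrow> y \<in> ball 0 R \<Longrightarrow> \<bar>h x - h y\<bar> \<le> C * sqrt (norm (x - y))"
      and X: "X \<noteq> 0" "4 * norm X \<le> R" "\<delta> * sqrt (norm X) \<le> h X" and x: "norm x \<le> r * norm X"
    define \<rho> where "\<rho> = norm X"
    have \<rho>: "\<rho> > 0" "sqrt \<rho> > 0" using X by (simp_all add: \<rho>_def)
    \<comment> \<open>The summand 0 gives \<open>k\<close> the shape of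
      \<open>supersol_add_harmonic\<close>.\<close>
    define k where "k y = (1 / sqrt \<rho>) * h (\<rho> *\<^sub>R y) + 0" for y
    have inR: "\<rho> *\<^sub>R y \<in> ball 0 R" if "y \<in> ball 0 4" for y :: 'a
    proof -
      have "\<rho> * norm y < \<rho> * 4" using that \<rho> by (intro mult_strict_left_mono) auto
      then have "\<rho> * norm y < R" using X(2) unfolding \<rho>_def by linarith
      then show ?thesis using \<rho> by simp
    qed
    have hk: "\<bar>k y - k z\<bar> \<le> C * sqrt (norm (y - z))" if "y \<in> ball 0 4" "z \<in> ball 0 4" for y z
    proof -
      have "k y - k z = (h (\<rho> *\<^sub>R y) - h (\<rho> *\<^sub>R z)) / sqrt \<rho>"
        by (simp add: k_def diff_divide_distrib)
      then have "\<bar>k y - k z\<bar> = \<bar>h (\<rho> *\<^sub>R y) - h (\<rho> *\<^sub>R z)\<bar> / sqrt \<rho>"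
        using \<rho> by simp
      also have "\<dots> \<le> (C * sqrt (norm (\<rho> *\<^sub>R y - \<rho> *\<^sub>R z))) / sqrt \<rho>"
        using \<rho> that inR by (intro divide_right_mono holder) auto
      also have "norm (\<rho> *\<^sub>R y - \<rho> *\<^sub>R z) = \<rho> * norm (y - z)"
        using \<rho> by (simp flip: scaleR_diff_right)
      finally show ?thesis using \<rho> by (simp add: real_sqrt_mult)
    qed
    have "c * root ((1 / \<rho>) *\<^sub>R x) \<le> k ((1 / \<rho>) *\<^sub>R x)"
    proof (rule gain[of k "(1 / \<rho>) *\<^sub>R X"])
      show "continuous_on (ball 0 4) k" by (rule continuous_on_sqrt_holder[OF hk])
      show "0 \<le> k y" if "y \<in> ball 0 4" for y
        using h0[OF inR[OF that]] \<rho> by (simp add: k_def)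
      show "supersol k y" if "y \<in> ball 0 4 - slit" for y
        unfolding k_def
      proof (rule supersol_add_harmonic[OF supersol_scale[OF sup] has_lap_const])
        show "\<rho> *\<^sub>R y \<in> ball 0 R - slit"
          using that inR[of y] \<rho> by (auto simp: slit_def mult_le_0_iff)
      qed (use \<rho> in simp)
      show "norm ((1 / \<rho>) *\<^sub>R X) = 1" using \<rho> by (simp add: \<rho>_def)
      show "\<delta> \<le> k ((1 / \<rho>) *\<^sub>R X)"
        using X(3) \<rho> by (simp add: k_def \<rho>_def[symmetric] field_simps)
      show "norm ((1 / \<rho>) *\<^sub>R x) \<le> r"
        using x \<rho> by (simp add: \<rho>_def[symmetric] field_simps)
    qed (fact hk)
    moreover have "root x = sqrt \<rho> * root ((1 / \<rho>) *\<^sub>R x)"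
      using root_scale[of \<rho> "(1 / \<rho>) *\<^sub>R x"] \<rho> by simp
    ultimately have "c * root x \<le> sqrt \<rho> * k ((1 / \<rho>) *\<^sub>R x)"
      using \<rho> by (simp add: mult.left_commute)
    also have "\<dots> = h x" using \<rho> by (simp add: k_def)
    finally show "c * root x \<le> h x" .
  qed
qed

text \<open>\<open>v\<close> may be positive on the slit, since it is only compared from below with
  multiples of \<open>root\<close>. The lower half of the expansion follows from elements of
  \<open>A\<close> near \<alpha>; only the upper half needs \<open>gain_at_scale\<close>.\<close>

lemma expansion_supersol:
  fixes v :: "'a \<Rightarrow> real"
  assumes R: "R > 0" and C: "C \<ge> 0" and v0: "v 0 = 0" and nonneg: "\<And>x. x \<in> ball 0 R \<Longrightarrow> 0 \<le> v x"
    and sup: "\<And>x. x \<in> ball 0 R - slit \<Longrightarrow> supersol v x"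
    and holder: "\<And>x y. x \<in> ball 0 R \<Longrightarrow> y \<in> ball 0 R \<Longrightarrow> \<bar>v x - v y\<bar> \<le> C * sqrt (norm (x - y))"
  obtains \<alpha> where "\<alpha> \<ge> 0" "\<And>x. 4 * norm x \<le> R \<Longrightarrow> v x > 0 \<Longrightarrow> \<alpha> > 0"
    "\<And>\<epsilon>. \<epsilon> > 0 \<Longrightarrow> \<exists>r>0. \<forall>x. norm x < r \<longrightarrow> \<bar>v x - \<alpha> * root x\<bar> \<le> \<epsilon> * sqrt (norm x)"
proof -
  define A where "A = {m. \<exists>r>0. \<forall>x. norm x < r \<longrightarrow> m * root x \<le> v x}"
  define \<alpha> where "\<alpha> = Sup A"
  have A0: "0 \<in> A" using R nonneg by (auto simp: A_def)
  \<comment> \<open>Tested along \<open>t *\<^sub>R e\<close>, where \<open>root\<close> equals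
    \<open>sqrt t\<close> and the Hoelder bound at 0 gives
    \<open>v \<le> C * sqrt t\<close>.\<close>
  have ub: "m \<le> C" if "m \<in> A" for m
  proof -
    from that obtain r where r: "r > 0" "\<And>x. norm x < r \<Longrightarrow> m * root x \<le> v x" by (auto simp: A_def)
    define t where "t = min r R / 2"
    have t: "t > 0" "t < r" "t < R" using r(1) R by (auto simp: t_def)
    have ne: "norm e = 1" using ee by (simp add: norm_eq_1)
    have "m * sqrt t = m * root (t *\<^sub>R e)" using t root_scale[of t e] by (simp add: root_e)
    also have "\<dots> \<le> v (t *\<^sub>R e)" using t ne by (intro r(2)) simp
    also have "\<dots> \<le> C * sqrt t" using holder[of "t *\<^sub>R e" 0] t ne R v0 by simp
    finally show "m \<le> C" using t by simp
  qed
  then have bdd: "bdd_above A" by (auto simp: bdd_above_def)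
  have le_\<alpha>: "m \<le> \<alpha>" if "m \<in> A" for m unfolding \<alpha>_def by (rule cSup_upper[OF that bdd])
  \<comment> \<open>A nonnegative \<open>m\<close> exists because \<open>0 \<in> A\<close>. Together
    with \<open>m \<le> \<alpha>\<close> it bounds the Hoelder constant of \<open>m * root\<close>
    by \<alpha>.\<close>
  have approx: "\<exists>m\<in>A. 0 \<le> m \<and> \<alpha> - d < m" if "d > 0" for d
  proof -
    have "\<alpha> - d < Sup A" using that by (simp add: \<alpha>_def)
    then obtain m where m: "m \<in> A" "\<alpha> - d < m" using less_cSup_iff[OF _ bdd] A0 by blast
    show ?thesis
    proof (cases "0 \<le> m")
      case False
      with m A0 show ?thesis by (intro bexI[of _ 0]) auto
    qed (use m in blast)
  qed
  have \<alpha>0: "\<alpha> \<ge> 0" using le_\<alpha>[OF A0] .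
  show ?thesis
  proof (rule that[OF \<alpha>0])
    fix X assume X: "4 * norm X \<le> R" "v X > 0"
    then have "X \<noteq> 0" using v0 by auto
    define \<delta> where "\<delta> = v X / sqrt (norm X)"
    have "\<delta> > 0" using X \<open>X \<noteq> 0\<close> by (simp add: \<delta>_def)
    \<comment> \<open>One application to \<open>v\<close> itself, at the single point
      \<open>X\<close>, puts a positive number into \<open>A\<close>.\<close>
    from this C show "\<alpha> > 0"
    proof (rule gain_at_scale)
      fix c r :: real
      assume cr: "c > 0" "r > 0" and
        gain: "\<And>h R X x. (\<And>x. x \<in> ball 0 R \<Longrightarrow> 0 \<le> h x) \<Longrightarrow> (\<And>x. x \<in> ball 0 R - slit \<Longrightarrow> supersol h x) \<Longrightarrow>
          (\<And>x y. x \<in> ball 0 R \<Longrightarrow> y \<in> ball 0 R \<Longrightarrow> \<bar>h x - h y\<bar> \<le> C * sqrt (norm (x - y))) \<Longrightarrow>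
          X \<noteq> 0 \<Longrightarrow> 4 * norm X \<le> R \<Longrightarrow> \<delta> * sqrt (norm X) \<le> h X \<Longrightarrow> norm x \<le> r * norm X \<Longrightarrow>
          c * root x \<le> h x"
      have "c * root x \<le> v x" if "norm x < r * norm X" for x
        by (rule gain[of R v X, OF nonneg sup holder \<open>X \<noteq> 0\<close> X(1)])
          (use that \<open>X \<noteq> 0\<close> in \<open>auto simp: \<delta>_def\<close>)
      then have "c \<in> A" using cr \<open>X \<noteq> 0\<close> by (auto simp: A_def intro!: exI[of _ "r * norm X"])
      with le_\<alpha>[of c] cr show ?thesis by simp
    qed
  next
    fix \<epsilon> :: real assume \<epsilon>: "\<epsilon> > 0"
    \<comment> \<open>\<open>C + \<alpha>\<close> is a Hoelder constant of
      \<open>v - m * root\<close> for all \<open>m\<close> between 0 and \<alpha> at once, so it can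
      be fixed before \<open>m\<close>.\<close>
    have "C + \<alpha> \<ge> 0" using C \<alpha>0 by simp
    with \<epsilon> show "\<exists>r>0. \<forall>x. norm x < r \<longrightarrow> \<bar>v x - \<alpha> * root x\<bar> \<le> \<epsilon> * sqrt (norm x)"
    proof (rule gain_at_scale)
      fix c r0 :: real
      assume cr: "c > 0" "r0 > 0" and
        gain: "\<And>h R X x. (\<And>x. x \<in> ball 0 R \<Longrightarrow> 0 \<le> h x) \<Longrightarrow> (\<And>x. x \<in> ball 0 R - slit \<Longrightarrow> supersol h x) \<Longrightarrow>
          (\<And>x y. x \<in> ball 0 R \<Longrightarrow> y \<in> ball 0 R \<Longrightarrow> \<bar>h x - h y\<bar> \<le> (C + \<alpha>) * sqrt (norm (x - y))) \<Longrightarrow>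
          X \<noteq> 0 \<Longrightarrow> 4 * norm X \<le> R \<Longrightarrow> \<epsilon> * sqrt (norm X) \<le> h X \<Longrightarrow> norm x \<le> r0 * norm X \<Longrightarrow>
          c * root x \<le> h x"
      from approx[OF cr(1)] obtain m where m: "m \<in> A" "0 \<le> m" "\<alpha> - c < m" by blast
      from m(1) obtain r1 where r1: "r1 > 0" "\<And>x. norm x < r1 \<Longrightarrow> m * root x \<le> v x" by (auto simp: A_def)
      from approx[OF \<epsilon>] obtain m' where m': "m' \<in> A" "\<alpha> - \<epsilon> < m'" by blast
      from m'(1) obtain r2 where r2: "r2 > 0" "\<And>x. norm x < r2 \<Longrightarrow> m' * root x \<le> v x" by (auto simp: A_def)
      define R' where "R' = min r1 R"
      have R': "R' > 0" "R' \<le> r1" "R' \<le> R" using r1(1) R by (auto simp: R'_def)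
      have "\<bar>v X - \<alpha> * root X\<bar> \<le> \<epsilon> * sqrt (norm X)" if X: "norm X < min (R' / 4) r2" for X
      proof (cases "X = 0")
        case True
        then show ?thesis using v0 root_le[of 0] root_nonneg[of 0] by simp
      next
        case False
        have "(\<alpha> - m') * root X \<le> \<epsilon> * root X"
          using m'(2) root_nonneg[of X] by (intro mult_right_mono) auto
        also have "\<dots> \<le> \<epsilon> * sqrt (norm X)"
          using \<epsilon> root_le[of X] by (intro mult_left_mono) auto
        finally have lower: "- (\<epsilon> * sqrt (norm X)) \<le> v X - \<alpha> * root X"
          using r2(2)[of X] X by (simp add: algebra_simps)
        have upper: "v X - \<alpha> * root X \<le> \<epsilon> * sqrt (norm X)"
        proof (rule ccontr)
          assume "\<not> ?thesis"
          then have big: "\<epsilon> * sqrt (norm X) \<le> v X - \<alpha> * root X" by simp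
          define h where "h x = 1 * v x + (- m) * root x" for x
          have h_eq: "h x = v x - m * root x" for x by (simp add: h_def)
          have "c * root x \<le> h x" if x: "norm x \<le> r0 * norm X" for x
          proof (rule gain[of R' h X x])
            show "0 \<le> h x" if "x \<in> ball 0 R'" for x
              using r1(2)[of x] that R' by (simp add: h_eq)
            show "supersol h x" if "x \<in> ball 0 R' - slit" for x
            proof -
              have "x \<notin> slit" using that by simp
              from root_harmonic[OF this] obtain g where "has_lap root x g 0" by blast
              from has_lap_cmult[OF this, of "- m"]
              have lap: "has_lap (\<lambda>x. (- m) * root x) x ((- m) *\<^sub>R g) 0" by simp
              show ?thesis
                unfolding h_def
                by (rule supersol_add_harmonic[OF sup lap]) (use that R' in auto)
            qed
            show "\<bar>h x - h y\<bar> \<le> (C + \<alpha>) * sqrt (norm (x - y))"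
              if "x \<in> ball 0 R'" "y \<in> ball 0 R'" for x y
            proof -
              have "\<bar>m * root x - m * root y\<bar> = m * \<bar>root x - root y\<bar>"
                using m(2) by (simp flip: right_diff_distrib add: abs_mult)
              also have "\<dots> \<le> \<alpha> * sqrt (norm (x - y))"
                using m(2) le_\<alpha>[OF m(1)] \<alpha>0 by (intro mult_mono root_holder) auto
              finally have "\<bar>m * root x - m * root y\<bar> \<le> \<alpha> * sqrt (norm (x - y))" .
              moreover have "\<bar>v x - v y\<bar> \<le> C * sqrt (norm (x - y))"
                using that R' by (intro holder) auto
              ultimately show ?thesis
                by (simp add: h_eq distrib_right abs_le_iff)
            qed
            have "m * root X \<le> \<alpha> * root X"
              using le_\<alpha>[OF m(1)] root_nonneg[of X] by (rule mult_right_mono)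
            with big show "\<epsilon> * sqrt (norm X) \<le> h X" by (simp add: h_eq)
          qed (use False X x in auto)
          then have "(m + c) * root x \<le> v x" if "norm x < r0 * norm X" for x
            using less_imp_le[OF that] by (fastforce simp: h_eq distrib_right)
          then have "m + c \<in> A"
            using cr False by (auto simp: A_def intro!: exI[of _ "r0 * norm X"])
          with le_\<alpha>[of "m + c"] m(3) show False by simp
        qed
        from lower upper show ?thesis by (simp add: abs_le_iff)
      qed
      then show ?thesis using R' r2(1) by (intro exI[of _ "min (R' / 4) r2"]) auto
    qed
  qed
qed

text \<open>Near a point of the slit at distance \<open>l\<close> from its edge, \<open>u \<le> C * sqrt l\<close> improves to
  \<open>u \<le> const * \<bar>x \<bullet> f\<bar> / sqrt l\<close> by the quadratic barrier \<open>\<psi>\<close>, which matches the size of \<open>root\<close> there.\<close>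

lemma vanishing_le_root:
  fixes u :: "'a \<Rightarrow> real"
  assumes C: "C > 0" and zero: "\<And>x. x \<in> ball 0 R \<inter> slit \<Longrightarrow> u x = 0"
    and sup: "\<And>x. x \<in> ball 0 R - slit \<Longrightarrow> supersol (\<lambda>x. - u x) x"
    and holder: "\<And>x y. x \<in> ball 0 R \<Longrightarrow> y \<in> ball 0 R \<Longrightarrow> \<bar>u x - u y\<bar> \<le> C * sqrt (norm (x - y))"
    and x: "4 * norm x < R"
  shows "u x \<le> 3 * C * (DIM('a) + 1) * root x"
proof -
  define N where "N = real DIM('a)"
  have N: "N \<ge> 1" using DIM_positive[where 'a = 'a] by (simp add: N_def)
  define t s \<rho> where "t = x \<bullet> e" and "s = x \<bullet> f" and "\<rho> = norm (proj x)"
  have nx: "norm x \<ge> 0" by simp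
  have \<rho>: "\<rho>\<^sup>2 = t\<^sup>2 + s\<^sup>2" "\<rho> \<le> norm x" "\<rho> \<ge> 0" "\<bar>t\<bar> \<le> \<rho>" "\<bar>s\<bar> \<le> \<rho>"
    using norm_proj_le[of x] proj_e_bound[of x] by (simp_all add: \<rho>_def t_def s_def cmod_power2)
  have root2: "(root x)\<^sup>2 = (\<rho> + t) / 2"
    using \<rho>(4) by (simp add: root_eq \<rho>_def t_def)
  \<comment> \<open>In the sector \<open>- \<bar>s\<bar> \<le> t\<close> the function
    \<open>root\<close> is comparable with \<open>sqrt \<rho>\<close>, and the Hoelder bound from
    the nearest edge point suffices. The barrier is needed only in the complementary sector around
    the slit.\<close>
  show ?thesis
  proof (cases "- \<bar>s\<bar> \<le> t")
    case True
    define X0 where "X0 = x - (t *\<^sub>R e + s *\<^sub>R f)"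
    have n: "norm (t *\<^sub>R e + s *\<^sub>R f) = \<rho>"
    proof -
      have "(norm (t *\<^sub>R e + s *\<^sub>R f))\<^sup>2 = \<rho>\<^sup>2"
        unfolding \<rho>(1) by (simp add: power2_norm_eq_inner inner_add_left inner_add_right ee ff ef fe)
          (simp add: power2_eq_square)
      then show ?thesis using \<rho>(3) by simp
    qed
    have "norm X0 \<le> norm x + \<rho>"
      unfolding X0_def n[symmetric] by (rule norm_triangle_ineq4)
    then have "norm X0 < R" using x \<rho>(2) nx by linarith
    then have X0: "X0 \<in> ball 0 R" by simp
    have xR: "x \<in> ball 0 R" using x nx unfolding mem_ball_0 by linarith
    have "X0 \<in> slit"
      by (simp add: slit_def X0_def t_def s_def inner_diff_left inner_add_left ee ff ef fe)
    then have "u X0 = 0" using X0 by (intro zero) auto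
    then have 1: "u x \<le> C * sqrt \<rho>"
      using holder[OF xR X0] \<open>u X0 = 0\<close> n by (simp add: X0_def add.commute)
    \<comment> \<open>For negative \<open>t\<close> in this sector, \<open>- t\<close> is at most
      \<open>\<rho> / sqrt 2\<close>, hence at most \<open>3/4 * \<rho>\<close>, so
      \<open>\<rho> + t \<ge> \<rho> / 4\<close>.\<close>
    have "\<rho> \<le> 8 * (root x)\<^sup>2"
    proof (cases "t \<ge> 0")
      case False
      with True have "t\<^sup>2 \<le> s\<^sup>2" by (intro abs_le_square_iff[THEN iffD1]) auto
      then have "2 * (- t)\<^sup>2 \<le> \<rho>\<^sup>2" using \<rho>(1) by simp
      then have "16 * t\<^sup>2 \<le> 9 * \<rho>\<^sup>2"
        using zero_le_power2[of t] unfolding power2_minus by linarith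
      then have "(- t)\<^sup>2 \<le> (3/4 * \<rho>)\<^sup>2"
        by (simp add: power_mult_distrib power_divide)
      then have "- t \<le> 3/4 * \<rho>" using \<rho>(3) by (intro power2_le_imp_le[of "- t" "3/4 * \<rho>"]) auto
      then show ?thesis unfolding root2 by simp
    qed (use \<rho>(3) root2 in simp)
    also have "\<dots> \<le> (3 * root x)\<^sup>2" by (simp add: power_mult_distrib)
    finally have "sqrt \<rho> \<le> 3 * root x" using root_nonneg[of x] by (intro real_le_lsqrt) auto
    then have "C * sqrt \<rho> \<le> C * (3 * root x)" using C by (intro mult_left_mono) auto
    also have "\<dots> = 3 * C * root x * 1" by simp
    also have "\<dots> \<le> 3 * C * root x * (N + 1)" using C root_nonneg[of x] N by (intro mult_left_mono) auto
    finally show ?thesis using 1 by (simp add: N_def algebra_simps)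
  next
    case False
    then have t: "t < 0" "\<bar>s\<bar> < - t" by auto
    show ?thesis
    proof (cases "s = 0")
      case True
      then have "x \<in> slit" using t by (simp add: slit_def s_def t_def)
      moreover have "norm x < R" using x nx by linarith
      ultimately have "u x = 0" by (intro zero) simp
      then show ?thesis using C root_nonneg[of x] by simp
    next
      case False
      define v where "v = sgn s *\<^sub>R f"
      \<comment> \<open>The distance of the foot point \<open>X0\<close> from the edge: the largest
        radius for which the flat face of the half ball about \<open>X0\<close> stays inside the
        slit.\<close>
      define l where "l = - t"
      have l: "l > 0" "\<bar>s\<bar> < l" "l \<le> norm x" using t \<rho> by (auto simp: l_def)
      have \<sigma>: "sgn s * sgn s = 1" using False by (simp add: sgn_mult_self_eq)
      have vv: "v \<bullet> v = 1" using \<sigma> by (simp add: v_def ff)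
      have nv: "norm v = 1" using vv by (simp add: norm_eq_1)
      define X0 where "X0 = x - s *\<^sub>R f"
      have X0e: "X0 \<bullet> e = t" and X0v: "X0 \<bullet> v = 0" and X0f: "X0 \<bullet> f = 0"
        by (simp_all add: X0_def v_def t_def s_def inner_diff_left fe ff)
      have nf: "norm f = 1" using ff by (simp add: norm_eq_1)
      have "norm X0 \<le> norm x + \<bar>s\<bar>"
        using norm_triangle_ineq4[of x "s *\<^sub>R f"] nf by (simp add: X0_def)
      then have nX0: "norm X0 \<le> 2 * norm x" using \<rho> by simp
      \<comment> \<open>The half ball reaches out to \<open>3 * norm x\<close>, because
        \<open>norm X0 \<le> 2 * norm x\<close> and \<open>l \<le> norm x\<close>.\<close>
      have sub: "y \<in> ball 0 R" if "dist X0 y \<le> l" for y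
      proof -
        have "norm y < R"
          using norm_triangle_sub[of y X0] that nX0 l x nx
          unfolding dist_norm norm_minus_commute[of X0] by linarith
        then show ?thesis by simp
      qed
      have "X0 \<in> slit" using t X0e X0f by (simp add: slit_def)
      then have uX0: "u X0 = 0" using sub[of X0] l by (intro zero) auto
      \<comment> \<open>Chosen so that \<open>A * l\<^sup>2 = C * sqrt l\<close>, the Hoelder bound
        for \<open>u\<close> on the sphere of radius \<open>l\<close> about the zero
        \<open>X0\<close>.\<close>
      define A where "A = C * sqrt l / l\<^sup>2"
      have A: "A > 0" using C l by (simp add: A_def)
      \<comment> \<open>The Laplacian is \<open>2 * N - 2 * (N + 1) = - 2\<close>. For
        \<open>0 \<le> y \<bullet> v \<le> l\<close> the last two terms together are nonnegative, so
        \<open>\<psi>\<close> dominates the squared distance from \<open>X0\<close>; at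
        \<open>x\<close> it is at most linear in \<open>\<bar>s\<bar>\<close>.\<close>
      define \<psi> where "\<psi> y = (y - X0) \<bullet> (y - X0) - (N + 1) * ((y \<bullet> v) * (y \<bullet> v)) + (N + 1) * l * (y \<bullet> v)" for y
      define \<phi> where "\<phi> y = - A * \<psi> y" for y
      define K where "K = cball X0 l \<inter> {y. 0 \<le> y \<bullet> v}"
      have "\<phi> x \<le> - u x"
      proof (rule comparison[where K = K])
        show "compact K"
          unfolding K_def by (intro compact_Int_closed compact_cball closed_Collect_le continuous_intros)
        show "continuous_on K (\<lambda>x. - u x)"
          by (rule continuous_on_minus, rule continuous_on_subset[OF continuous_on_sqrt_holder[of "ball 0 R" u C, OF holder]])
            (use sub in \<open>auto simp: K_def\<close>)
        show "continuous_on K \<phi>"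
          unfolding \<phi>_def \<psi>_def by (intro continuous_intros)
        have "x \<bullet> v = \<bar>s\<bar>" by (simp add: v_def s_def abs_sgn mult.commute)
        then show "x \<in> K" using l nf by (simp add: K_def dist_norm X0_def)
        fix y assume "y \<in> K"
        then have y: "dist X0 y \<le> l" "0 \<le> y \<bullet> v" by (auto simp: K_def)
        have d2: "(y - X0) \<bullet> (y - X0) = (dist X0 y)\<^sup>2"
          by (simp add: dist_norm norm_minus_commute dot_square_norm)
        have "\<bar>(y - X0) \<bullet> v\<bar> \<le> norm (y - X0) * norm v" by (rule Cauchy_Schwarz_ineq2)
        then have yv: "y \<bullet> v \<le> l"
          using y(1) nv X0v by (simp add: inner_diff_left dist_norm norm_minus_commute)
        have "0 \<le> (N + 1) * ((y \<bullet> v) * (l - y \<bullet> v))" using N y(2) yv by simp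
        then have \<psi>: "\<psi> y \<ge> (dist X0 y)\<^sup>2" unfolding \<psi>_def d2 by (simp add: algebra_simps)
        consider "y \<bullet> v = 0" | "dist X0 y = l" | "dist X0 y < l" "0 < y \<bullet> v" using y by linarith
        then show "\<phi> y \<le> - u y \<or> y \<in> interior K \<and> supersol (\<lambda>x. - u x) y \<and> (\<exists>d l. has_lap \<phi> y d l \<and> l > 0)"
        proof cases
          case 1
          then have "y \<bullet> f = 0" using False by (simp add: v_def sgn_0_0)
          moreover have "y \<bullet> e - t \<le> l"
            using proj_e_bound(1)[of "y - X0"] norm_proj_le[of "y - X0"] y(1)
            by (simp add: inner_diff_left X0e dist_norm norm_minus_commute)
          ultimately have "y \<in> slit" by (simp add: slit_def l_def)
          then have "u y = 0" using sub[OF y(1)] by (intro zero) auto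
          moreover have "\<phi> y \<le> 0" using \<psi> A order_trans[OF zero_le_power2 \<psi>] by (simp add: \<phi>_def)
          ultimately show ?thesis by simp
        next
          case 2
          have "u y \<le> C * sqrt l"
            using holder[OF sub[OF y(1)] sub[of X0]] l uX0 2 by (simp add: dist_norm norm_minus_commute)
          also have "\<dots> = A * l\<^sup>2" using l by (simp add: A_def)
          also have "\<dots> \<le> A * \<psi> y" using A \<psi> 2 by (intro mult_left_mono) auto
          finally show ?thesis by (simp add: \<phi>_def)
        next
          case 3
          have "y \<in> interior K"
          proof (rule interiorI[of "ball X0 l \<inter> {x. 0 < x \<bullet> v}"])
            show "open (ball X0 l \<inter> {x. 0 < x \<bullet> v})"
              by (intro open_Int open_ball open_Collect_less continuous_intros)
          qed (use 3 in \<open>auto simp: K_def\<close>)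
          moreover have "supersol (\<lambda>x. - u x) y"
            using sub[OF y(1)] 3 by (intro sup) (auto simp: slit_def v_def)
          moreover have "\<exists>d l. has_lap \<phi> y d l \<and> l > 0"
          proof -
            have "has_lap \<phi> y ((- A) *\<^sub>R (2 *\<^sub>R (y - X0) - (N + 1) *\<^sub>R ((y \<bullet> v) *\<^sub>R v + (y \<bullet> v) *\<^sub>R v) + ((N + 1) * l) *\<^sub>R v))
               (- A * (real (2 * DIM('a)) - (N + 1) * ((y \<bullet> v) * 0 + 2 * (v \<bullet> v) + (y \<bullet> v) * 0) + (N + 1) * l * 0))"
              unfolding \<phi>_def \<psi>_def
              by (intro has_lap_add has_lap_diff has_lap_cmult has_lap_mult has_lap_linear has_lap_dist_sq)
            moreover have "0 < - A * (real (2 * DIM('a)) - (N + 1) * ((y \<bullet> v) * 0 + 2 * (v \<bullet> v) + (y \<bullet> v) * 0) + (N + 1) * l * 0)"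
              using A by (simp add: vv N_def algebra_simps)
            ultimately show ?thesis by blast
          qed
          ultimately show ?thesis by blast
        qed
      qed
      then have "u x \<le> A * \<psi> x" by (simp add: \<phi>_def)
      also have "\<psi> x \<le> (N + 1) * l * \<bar>s\<bar>"
      proof -
        have "x \<bullet> v = \<bar>s\<bar>" by (simp add: v_def s_def abs_sgn mult.commute)
        moreover have "(x - X0) \<bullet> (x - X0) = s * s" by (simp add: X0_def ff)
        ultimately have "\<psi> x = (N + 1) * l * \<bar>s\<bar> - N * (s * s)"
          by (simp add: \<psi>_def algebra_simps)
        then show ?thesis using N by simp
      qed
      then have "A * \<psi> x \<le> A * ((N + 1) * l * \<bar>s\<bar>)" using A by simp
      also have "\<dots> = C * (N + 1) * (sqrt l * \<bar>s\<bar> / l)"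
        using l by (simp add: A_def power2_eq_square)
      \<comment> \<open>Here \<open>s\<^sup>2 = (\<rho> + t) * (\<rho> - t)\<close>, the first
        factor is twice the square of \<open>root x\<close>, and the second is at most
        \<open>3 * l\<close> because \<open>\<bar>s\<bar> < l\<close>.\<close>
      also have "sqrt l * \<bar>s\<bar> / l \<le> 3 * root x"
      proof -
        have "\<rho> \<le> \<bar>t\<bar> + \<bar>s\<bar>" using cmod_le[of "proj x"] by (simp add: \<rho>_def t_def s_def)
        then have "\<rho> - t \<le> 3 * l" using l t by (simp add: l_def)
        then have "(\<rho> + t) * (\<rho> - t) \<le> (\<rho> + t) * (3 * l)" using \<rho>(4) by (intro mult_left_mono) auto
        moreover have "(\<rho> + t) * (\<rho> - t) = s\<^sup>2" using \<rho>(1) by (simp add: algebra_simps power2_eq_square)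
        ultimately have "s\<^sup>2 \<le> 6 * l * (root x)\<^sup>2" unfolding root2 by (simp add: algebra_simps)
        also have "\<dots> \<le> 9 * l * (root x)\<^sup>2" using l by (intro mult_right_mono) auto
        also have "\<dots> = (3 * (sqrt l * root x))\<^sup>2" using l by (simp add: power_mult_distrib)
        finally have "\<bar>s\<bar>\<^sup>2 \<le> (3 * (sqrt l * root x))\<^sup>2" by simp
        then have "\<bar>s\<bar> \<le> 3 * (sqrt l * root x)"
          by (rule power2_le_imp_le) (use l root_nonneg[of x] in simp)
        then have "sqrt l * \<bar>s\<bar> \<le> sqrt l * (3 * (sqrt l * root x))" using l by (intro mult_left_mono) auto
        also have "\<dots> = 3 * root x * l" using l by simp
        finally show ?thesis using l by (simp add: pos_divide_le_eq)
      qed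
      then have "C * (N + 1) * (sqrt l * \<bar>s\<bar> / l) \<le> C * (N + 1) * (3 * root x)"
        using C N by (intro mult_left_mono) auto
      finally show ?thesis using A by (simp add: N_def algebra_simps)
    qed
  qed
qed

lemma expansion_vanishing:
  fixes u :: "'a \<Rightarrow> real"
  assumes R: "R > 0" and C: "C > 0" and nonneg: "\<And>x. x \<in> ball 0 R \<Longrightarrow> 0 \<le> u x"
    and zero: "\<And>x. x \<in> ball 0 R \<inter> slit \<Longrightarrow> u x = 0"
    and sup: "\<And>x. x \<in> ball 0 R - slit \<Longrightarrow> supersol (\<lambda>x. - u x) x"
    and holder: "\<And>x y. x \<in> ball 0 R \<Longrightarrow> y \<in> ball 0 R \<Longrightarrow> \<bar>u x - u y\<bar> \<le> C * sqrt (norm (x - y))"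
  obtains \<alpha> where "\<alpha> \<ge> 0"
    "\<And>\<epsilon>. \<epsilon> > 0 \<Longrightarrow> \<exists>r>0. \<forall>x. norm x < r \<longrightarrow> \<bar>u x - \<alpha> * root x\<bar> \<le> \<epsilon> * sqrt (norm x)"
proof -
  define M where "M = 3 * C * (DIM('a) + 1)"
  have M: "M \<ge> 0" using C by (simp add: M_def)
  define v where "v x = 1 * (- u x) + M * root x" for x
  have v_eq: "v x = M * root x - u x" for x by (simp add: v_def)
  have "0 \<in> slit" by (simp add: slit_def)
  then have v0: "v 0 = 0" using zero[of 0] R root_zero_iff[of 0] by (simp add: v_eq)
  have R4: "R / 4 > 0" and MC: "M + C \<ge> 0" using R M C by auto
  have nonneg': "0 \<le> v x" if "x \<in> ball 0 (R / 4)" for x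
    using vanishing_le_root[of C R u x, OF C zero sup holder] that by (simp add: v_eq M_def)
  have sup': "supersol v x" if "x \<in> ball 0 (R / 4) - slit" for x
  proof -
    have "x \<notin> slit" using that by simp
    from root_harmonic[OF this] obtain g where "has_lap root x g 0" by blast
    from has_lap_cmult[OF this, of M] have lap: "has_lap (\<lambda>x. M * root x) x (M *\<^sub>R g) 0" by simp
    show ?thesis
      unfolding v_def by (rule supersol_add_harmonic[OF sup lap]) (use that R in auto)
  qed
  have holder': "\<bar>v x - v y\<bar> \<le> (M + C) * sqrt (norm (x - y))"
    if "x \<in> ball 0 (R / 4)" "y \<in> ball 0 (R / 4)" for x y
  proof -
    have "\<bar>M * root x - M * root y\<bar> = M * \<bar>root x - root y\<bar>"
      using M by (simp flip: right_diff_distrib add: abs_mult)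
    also have "\<dots> \<le> M * sqrt (norm (x - y))"
      using M by (intro mult_left_mono root_holder) auto
    finally have "\<bar>M * root x - M * root y\<bar> \<le> M * sqrt (norm (x - y))" .
    moreover have "\<bar>u x - u y\<bar> \<le> C * sqrt (norm (x - y))"
      using that R by (intro holder) auto
    ultimately show ?thesis by (simp add: v_eq distrib_right abs_le_iff)
  qed
  show ?thesis
  proof (rule expansion_supersol[OF R4 MC v0 nonneg' sup' holder'])
    fix \<beta> assume \<beta>: "\<And>\<epsilon>. \<epsilon> > 0 \<Longrightarrow> \<exists>r>0. \<forall>x. norm x < r \<longrightarrow> \<bar>v x - \<beta> * root x\<bar> \<le> \<epsilon> * sqrt (norm x)"
    have exp: "\<exists>r>0. \<forall>x. norm x < r \<longrightarrow> \<bar>u x - (M - \<beta>) * root x\<bar> \<le> \<epsilon> * sqrt (norm x)" if "\<epsilon> > 0" for \<epsilon>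
    proof -
      have "\<bar>u x - (M - \<beta>) * root x\<bar> = \<bar>v x - \<beta> * root x\<bar>" for x :: 'a
        by (simp add: v_eq algebra_simps abs_minus_commute)
      then show ?thesis using \<beta>[OF that] by simp
    qed
    \<comment> \<open>Along \<open>t *\<^sub>R e\<close>, where \<open>root\<close> equals
      \<open>sqrt t\<close>, a negative coefficient would force \<open>u\<close> below 0.\<close>
    have pos: "0 \<le> (M - \<beta>) + \<epsilon>" if "\<epsilon> > 0" for \<epsilon>
    proof -
      from exp[OF that] obtain r where r: "r > 0"
        "\<And>x. norm x < r \<Longrightarrow> \<bar>u x - (M - \<beta>) * root x\<bar> \<le> \<epsilon> * sqrt (norm x)" by blast
      define t where "t = min r R / 2"
      have t: "t > 0" "t < r" "t < R" using r(1) R by (auto simp: t_def)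
      have ne: "norm e = 1" using ee by (simp add: norm_eq_1)
      have "u (t *\<^sub>R e) - (M - \<beta>) * sqrt t \<le> \<epsilon> * sqrt t"
        using r(2)[of "t *\<^sub>R e"] t ne root_scale[of t e] root_e by (simp add: abs_le_iff)
      moreover have "0 \<le> u (t *\<^sub>R e)" using t ne by (intro nonneg) simp
      ultimately have "0 \<le> ((M - \<beta>) + \<epsilon>) * sqrt t" by (simp add: algebra_simps)
      then show ?thesis using t by (simp add: zero_le_mult_iff)
    qed
    have "0 \<le> M - \<beta>" by (rule field_le_epsilon) (rule pos)
    with exp show ?thesis using that by blast
  qed
qed

end

section \<open>Inversion and the Kelvin transform\<close>

definition inversion :: "'a::euclidean_space \<Rightarrow> 'a \<Rightarrow> 'a" where
  "inversion c y = c + (1 / ((y - c) \<bullet> (y - c))) *\<^sub>R (y - c)"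

text \<open>The base is a squared distance, so the weight is the distance from \<open>c\<close> to
  the power 2 - N with N the dimension, which is harmonic away from \<open>c\<close>.\<close>

definition kelvin :: "'a::euclidean_space \<Rightarrow> ('a \<Rightarrow> real) \<Rightarrow> 'a \<Rightarrow> real" where
  "kelvin c w y = ((y - c) \<bullet> (y - c)) powr ((2 - real DIM('a)) / 2) * w (inversion c y)"

text \<open>The derivative in direction \<open>b\<close>: the reflection of \<open>b\<close> in the
  hyperplane orthogonal to \<open>y - c\<close>, divided by the squared distance. In this form the
  conformality of the inversion is visible.\<close>

definition inversion_deriv :: "'a::euclidean_space \<Rightarrow> 'a \<Rightarrow> 'a \<Rightarrow> 'a" where
  "inversion_deriv c b y = (1 / ((y - c) \<bullet> (y - c))) *\<^sub>R b +
     (- 2 * ((y - c) \<bullet> b) / ((y - c) \<bullet> (y - c))\<^sup>2) *\<^sub>R (y - c)"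

text \<open>The second derivative along a unit vector \<open>b\<close>; a factor
  \<open>b \<bullet> b\<close> in the last term is already replaced by 1.\<close>

definition inversion_deriv2 :: "'a::euclidean_space \<Rightarrow> 'a \<Rightarrow> 'a \<Rightarrow> 'a" where
  "inversion_deriv2 c b y = (- 4 * ((y - c) \<bullet> b) / ((y - c) \<bullet> (y - c))\<^sup>2) *\<^sub>R b +
     (8 * ((y - c) \<bullet> b)\<^sup>2 / ((y - c) \<bullet> (y - c)) ^ 3 - 2 / ((y - c) \<bullet> (y - c))\<^sup>2) *\<^sub>R (y - c)"

section \<open>Derivatives of the inversion and harmonicity of the Kelvin transform\<close>

lemma has_real_derivative_dist_sq_line:
  "((\<lambda>\<tau>. (y + \<tau> *\<^sub>R b - c) \<bullet> (y + \<tau> *\<^sub>R b - c)) has_real_derivative 2 * ((y + \<tau> *\<^sub>R b - c) \<bullet> b)) (at \<tau>)"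
proof -
  have "(\<lambda>\<tau>. (y + \<tau> *\<^sub>R b - c) \<bullet> (y + \<tau> *\<^sub>R b - c)) =
    (\<lambda>\<tau>. (y - c) \<bullet> (y - c) + 2 * ((y - c) \<bullet> b) * \<tau> + (b \<bullet> b) * \<tau>\<^sup>2)"
    by (auto simp: algebra_simps inner_commute fun_eq_iff power2_eq_square)
  then show ?thesis
    by (auto intro!: derivative_eq_intros simp: algebra_simps)
qed

lemma has_real_derivative_inner_line:
  "((\<lambda>\<tau>. (y + \<tau> *\<^sub>R b - c) \<bullet> b) has_real_derivative b \<bullet> b) (at \<tau>)"
  by (auto simp: inner_add_left inner_diff_left intro!: derivative_eq_intros)

lemma has_vector_derivative_line:
  fixes y b c :: "'a::real_normed_vector"
  shows "((\<lambda>\<tau>. y + \<tau> *\<^sub>R b - c) has_vector_derivative b) (at \<tau>)"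
  by (auto intro!: derivative_eq_intros)

lemma inversion_line_derivative:
  assumes "y + \<tau> *\<^sub>R b \<noteq> c"
  shows "((\<lambda>\<tau>. inversion c (y + \<tau> *\<^sub>R b)) has_vector_derivative inversion_deriv c b (y + \<tau> *\<^sub>R b)) (at \<tau>)"
proof -
  have nz: "(y + \<tau> *\<^sub>R b - c) \<bullet> (y + \<tau> *\<^sub>R b - c) \<noteq> 0" using assms by simp
  have "((\<lambda>\<tau>. 1 / ((y + \<tau> *\<^sub>R b - c) \<bullet> (y + \<tau> *\<^sub>R b - c))) has_real_derivative
      - 2 * ((y + \<tau> *\<^sub>R b - c) \<bullet> b) / ((y + \<tau> *\<^sub>R b - c) \<bullet> (y + \<tau> *\<^sub>R b - c))\<^sup>2) (at \<tau>)"
    by (rule derivative_eq_intros has_real_derivative_dist_sq_line nz refl)+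
      (simp add: power2_eq_square)
  from has_vector_derivative_add[OF has_vector_derivative_const
      has_vector_derivative_scaleR[OF this has_vector_derivative_line], of c]
  show ?thesis by (simp add: inversion_def inversion_deriv_def)
qed

lemma inversion_deriv_line_derivative:
  assumes "y \<noteq> c" "b \<bullet> b = 1"
  shows "((\<lambda>\<tau>. inversion_deriv c b (y + \<tau> *\<^sub>R b)) has_vector_derivative inversion_deriv2 c b y) (at 0)"
proof -
  define D where "D = (y - c) \<bullet> (y - c)"
  define m where "m = (y - c) \<bullet> b"
  have D: "D \<noteq> 0" using assms by (simp add: D_def)
  have 1: "((\<lambda>\<tau>. (y + \<tau> *\<^sub>R b - c) \<bullet> (y + \<tau> *\<^sub>R b - c)) has_real_derivative 2 * m) (at 0)"
    using has_real_derivative_dist_sq_line[of y b c 0] by (simp add: m_def)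
  have 2: "((\<lambda>\<tau>. (y + \<tau> *\<^sub>R b - c) \<bullet> b) has_real_derivative 1) (at 0)"
    using has_real_derivative_inner_line[of y b c 0] assms by simp
  have nz: "(y + 0 *\<^sub>R b - c) \<bullet> (y + 0 *\<^sub>R b - c) \<noteq> 0" using assms by simp
  have "((\<lambda>\<tau>. 1 / ((y + \<tau> *\<^sub>R b - c) \<bullet> (y + \<tau> *\<^sub>R b - c))) has_real_derivative - 2 * m / D\<^sup>2) (at 0)"
    by (rule derivative_eq_intros 1 nz refl)+ (simp add: power2_eq_square D_def)
  from has_vector_derivative_scaleR[OF this has_vector_derivative_const[of b]]
  have A: "((\<lambda>\<tau>. (1 / ((y + \<tau> *\<^sub>R b - c) \<bullet> (y + \<tau> *\<^sub>R b - c))) *\<^sub>R b) has_vector_derivative (- 2 * m / D\<^sup>2) *\<^sub>R b) (at 0)"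
    by simp
  have "((\<lambda>\<tau>. - 2 * ((y + \<tau> *\<^sub>R b - c) \<bullet> b) / ((y + \<tau> *\<^sub>R b - c) \<bullet> (y + \<tau> *\<^sub>R b - c))\<^sup>2) has_real_derivative
      8 * m\<^sup>2 / D ^ 3 - 2 / D\<^sup>2) (at 0)"
    by (rule derivative_eq_intros 1 2 refl)+
      (use D in \<open>simp_all add: D_def[symmetric] m_def[symmetric] field_simps eval_nat_numeral\<close>)
  from has_vector_derivative_scaleR[OF this has_vector_derivative_line]
  have B: "((\<lambda>\<tau>. (- 2 * ((y + \<tau> *\<^sub>R b - c) \<bullet> b) / ((y + \<tau> *\<^sub>R b - c) \<bullet> (y + \<tau> *\<^sub>R b - c))\<^sup>2) *\<^sub>R (y + \<tau> *\<^sub>R b - c))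
      has_vector_derivative (- 2 * m / D\<^sup>2) *\<^sub>R b + (8 * m\<^sup>2 / D ^ 3 - 2 / D\<^sup>2) *\<^sub>R (y - c)) (at 0)"
    by (simp add: D_def m_def)
  have "(- 2 * m / D\<^sup>2) *\<^sub>R b + ((- 2 * m / D\<^sup>2) *\<^sub>R b + (8 * m\<^sup>2 / D ^ 3 - 2 / D\<^sup>2) *\<^sub>R (y - c)) =
    inversion_deriv2 c b y"
  proof -
    have "- 2 * m / D\<^sup>2 + - 2 * m / D\<^sup>2 = - 4 * m / D\<^sup>2" by simp
    then show ?thesis
      unfolding inversion_deriv2_def D_def[symmetric] m_def[symmetric]
      by (simp only: add.assoc[symmetric] scaleR_add_left[symmetric])
  qed
  with has_vector_derivative_add[OF A B] show ?thesis
    by (simp add: inversion_deriv_def)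
qed

text \<open>The inversion turns basis lines into curves with other velocities, so second derivatives
  of \<open>w\<close> along the basis are not enough. The Laplacian, defined by iterated
  \<open>deriv\<close>, is identified with the trace of the full second derivative.\<close>

lemma harmonic_second_derivatives:
  assumes S: "open S" and w: "harmonic_on S w"
  shows "\<exists>f' f''. \<forall>x\<in>S. (w has_derivative blinfun_apply (f' x)) (at x) \<and>
    (f' has_derivative blinfun_apply (f'' x)) (at x) \<and>
    (\<Sum>b\<in>Basis. blinfun_apply (blinfun_apply (f'' x) b) b) = 0"
proof -
  from w obtain f' f'' where f: "\<And>x. x \<in> S \<Longrightarrow> (w has_derivative blinfun_apply (f' x)) (at x)"
    "\<And>x. x \<in> S \<Longrightarrow> (f' has_derivative blinfun_apply (f'' x)) (at x)"
    unfolding harmonic_on_def C2_on_def by blast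
  have "(\<Sum>b\<in>Basis. blinfun_apply (blinfun_apply (f'' x) b) b) = 0" if x: "x \<in> S" for x
  proof -
    have "(deriv ^^ 2) (\<lambda>t. w (x + t *\<^sub>R b)) 0 = blinfun_apply (blinfun_apply (f'' x) b) b" for b
    proof -
      have line: "((\<lambda>\<tau>. x + \<tau> *\<^sub>R b) has_vector_derivative b) (at \<tau>)" for \<tau>
        by (auto intro!: derivative_eq_intros)
      have "((\<lambda>\<tau>. x + \<tau> *\<^sub>R b) \<longlongrightarrow> x + 0 *\<^sub>R b) (nhds 0)"
        by (intro tendsto_intros filterlim_ident)
      moreover have "\<forall>\<^sub>F y in nhds (x + 0 *\<^sub>R b). y \<in> S"
        using eventually_nhds_in_open[OF S x] by simp
      ultimately have "\<forall>\<^sub>F \<tau> in nhds 0. x + \<tau> *\<^sub>R b \<in> S"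
        by (rule eventually_compose_filterlim[rotated])
      then have "\<forall>\<^sub>F \<tau> in nhds 0. deriv (\<lambda>t. w (x + t *\<^sub>R b)) \<tau> = blinfun_apply (f' (x + \<tau> *\<^sub>R b)) b"
      proof eventually_elim
        case (elim \<tau>)
        from vector_derivative_diff_chain_within[OF line has_derivative_at_withinI[OF f(1)[OF elim]]]
        show ?case
          by (intro DERIV_imp_deriv) (simp add: o_def has_real_derivative_iff_has_vector_derivative)
      qed
      then have "deriv (deriv (\<lambda>t. w (x + t *\<^sub>R b))) 0 = deriv (\<lambda>\<tau>. blinfun_apply (f' (x + \<tau> *\<^sub>R b)) b) 0"
        by (intro deriv_cong_ev) simp_all
      also have "\<dots> = blinfun_apply (blinfun_apply (f'' x) b) b"
      proof (rule DERIV_imp_deriv)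
        have "(f' has_derivative blinfun_apply (f'' x)) (at (x + 0 *\<^sub>R b))" using f(2)[OF x] by simp
        from vector_derivative_diff_chain_within[OF line has_derivative_at_withinI[OF this]]
        have "((\<lambda>\<tau>. f' (x + \<tau> *\<^sub>R b)) has_vector_derivative blinfun_apply (f'' x) b) (at 0)"
          by (simp add: o_def)
        from bounded_bilinear.has_vector_derivative[OF bounded_bilinear_blinfun_apply this has_vector_derivative_const[of b]]
        show "((\<lambda>\<tau>. blinfun_apply (f' (x + \<tau> *\<^sub>R b)) b) has_real_derivative blinfun_apply (blinfun_apply (f'' x) b) b) (at 0)"
          by (simp add: has_real_derivative_iff_has_vector_derivative blinfun.zero_right)
      qed
      finally show ?thesis by (simp add: eval_nat_numeral)
    qed
    then have "(\<Sum>b\<in>Basis. blinfun_apply (blinfun_apply (f'' x) b) b) = laplacian w x"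
      unfolding laplacian_def by (intro sum.cong) simp_all
    then show ?thesis using w x by (simp add: harmonic_on_def)
  qed
  with f show ?thesis by blast
qed

lemma sum_Basis_blinfun:
  fixes T :: "'a::euclidean_space \<Rightarrow>\<^sub>L real"
  shows "(\<Sum>b\<in>Basis. (z \<bullet> b) * blinfun_apply T b) = blinfun_apply T z"
proof -
  have "blinfun_apply T z = blinfun_apply T (\<Sum>b\<in>Basis. (z \<bullet> b) *\<^sub>R b)"
    by (simp add: euclidean_representation)
  also have "\<dots> = (\<Sum>b\<in>Basis. (z \<bullet> b) * blinfun_apply T b)"
    by (simp add: blinfun.sum_right blinfun.scaleR_right)
  finally show ?thesis ..
qed

lemma sum_Basis_blinfun2:
  fixes T :: "'a::euclidean_space \<Rightarrow>\<^sub>L 'a \<Rightarrow>\<^sub>L real"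
  shows "(\<Sum>b\<in>Basis. (z \<bullet> b) * blinfun_apply (blinfun_apply T b) z) = blinfun_apply (blinfun_apply T z) z"
proof -
  have "blinfun_apply T z = blinfun_apply T (\<Sum>b\<in>Basis. (z \<bullet> b) *\<^sub>R b)"
    by (simp add: euclidean_representation)
  also have "\<dots> = (\<Sum>b\<in>Basis. (z \<bullet> b) *\<^sub>R blinfun_apply T b)"
    by (simp add: blinfun.sum_right blinfun.scaleR_right)
  finally show ?thesis by (simp add: blinfun.sum_left blinfun.scaleR_left)
qed

text \<open>The first derivative of the inversion is a reflection divided by \<open>D\<close>, so
  the second derivative of \<open>w\<close> enters only through its trace, which is 0. What is left
  is a first-order term from the second derivative of the inversion. The exponent \<open>p\<close>
  makes the weight harmonic and at the same time makes twice the product of the gradients cancel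
  that term.\<close>

lemma kelvin_harmonic:
  fixes w :: "'a::euclidean_space \<Rightarrow> real"
  assumes S: "open S" and w: "harmonic_on S w" and y: "y \<noteq> c" "inversion c y \<in> S"
  shows "\<exists>d. has_lap (kelvin c w) y d 0"
proof -
  from harmonic_second_derivatives[OF S w] obtain f' f'' where
    *: "\<forall>x\<in>S. (w has_derivative blinfun_apply (f' x)) (at x) \<and>
    (f' has_derivative blinfun_apply (f'' x)) (at x) \<and>
    (\<Sum>b\<in>Basis. blinfun_apply (blinfun_apply (f'' x) b) b) = 0" by blast
  have f: "(w has_derivative blinfun_apply (f' x)) (at x)"
    "(f' has_derivative blinfun_apply (f'' x)) (at x)"
    "(\<Sum>b\<in>Basis. blinfun_apply (blinfun_apply (f'' x) b) b) = 0" if "x \<in> S" for x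
    using * that by auto
  define z where "z = y - c"
  define D where "D = z \<bullet> z"
  define N where "N = real DIM('a)"
  have D: "D > 0" using y by (simp add: D_def z_def)
  let ?J = "inversion c"
  define F where "F = blinfun_apply (f' (?J y))"
  define B where "B u v = blinfun_apply (blinfun_apply (f'' (?J y)) u) v" for u v
  have J1: "inversion_deriv c b y = (1 / D) *\<^sub>R b + (- 2 * (z \<bullet> b) / D\<^sup>2) *\<^sub>R z" for b
    by (simp add: inversion_deriv_def z_def D_def)
  have J2: "inversion_deriv2 c b y = (- 4 * (z \<bullet> b) / D\<^sup>2) *\<^sub>R b + (8 * (z \<bullet> b)\<^sup>2 / D ^ 3 - 2 / D\<^sup>2) *\<^sub>R z" for b
    by (simp add: inversion_deriv2_def z_def D_def)
  have Flin: "F (u + v) = F u + F v" "F (r *\<^sub>R u) = r * F u" for u v r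
    by (simp_all add: F_def blinfun.add_right blinfun.scaleR_right)
  have sum_m2: "(\<Sum>b\<in>Basis. (z \<bullet> b)\<^sup>2) = D"
    unfolding D_def by (subst euclidean_inner[of z z]) (simp add: power2_eq_square)
  have sumF: "(\<Sum>b\<in>Basis. (z \<bullet> b) * F b) = F z"
    unfolding F_def by (rule sum_Basis_blinfun)
  define g where "g = (\<Sum>b\<in>Basis. F (inversion_deriv c b y) *\<^sub>R b)"
  define l where "l = (\<Sum>b\<in>Basis. B (inversion_deriv c b y) (inversion_deriv c b y) + F (inversion_deriv2 c b y))"
  have lap: "has_lap (\<lambda>y. w (?J y)) y g l"
  proof (rule has_lapI[where p = "\<lambda>b \<tau>. blinfun_apply (f' (?J (y + \<tau> *\<^sub>R b))) (inversion_deriv c b (y + \<tau> *\<^sub>R b))"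
        and q = "\<lambda>b. B (inversion_deriv c b y) (inversion_deriv c b y) + F (inversion_deriv2 c b y)"])
    fix b :: 'a assume b: "b \<in> Basis"
    have lim: "((\<lambda>\<tau>. y + \<tau> *\<^sub>R b) \<longlongrightarrow> y + 0 *\<^sub>R b) (nhds 0)"
      by (intro tendsto_intros filterlim_ident)
    have "\<forall>\<^sub>F x in nhds (y + 0 *\<^sub>R b). x \<noteq> c"
      using y(1) by (intro t1_space_nhds) simp
    from eventually_compose_filterlim[OF this lim] have ne: "\<forall>\<^sub>F \<tau> in nhds 0. y + \<tau> *\<^sub>R b \<noteq> c" .
    have "((\<lambda>\<tau>. ?J (y + \<tau> *\<^sub>R b)) has_vector_derivative inversion_deriv c b (y + 0 *\<^sub>R b)) (at 0)"
      using y(1) by (intro inversion_line_derivative) simp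
    then have "isCont (\<lambda>\<tau>. ?J (y + \<tau> *\<^sub>R b)) 0"
      by (rule has_vector_derivative_continuous)
    then have lim': "((\<lambda>\<tau>. ?J (y + \<tau> *\<^sub>R b)) \<longlongrightarrow> ?J y) (nhds 0)"
      using tendsto_at_iff_tendsto_nhds[of "\<lambda>\<tau>. ?J (y + \<tau> *\<^sub>R b)" 0] by (simp add: isCont_def)
    have inS: "\<forall>\<^sub>F \<tau> in nhds 0. ?J (y + \<tau> *\<^sub>R b) \<in> S"
      by (rule eventually_compose_filterlim[OF eventually_nhds_in_open[OF S y(2)] lim'])
    from ne inS show "\<forall>\<^sub>F \<tau> in nhds 0. ((\<lambda>\<tau>. w (?J (y + \<tau> *\<^sub>R b))) has_real_derivative
        blinfun_apply (f' (?J (y + \<tau> *\<^sub>R b))) (inversion_deriv c b (y + \<tau> *\<^sub>R b))) (at \<tau>)"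
    proof eventually_elim
      case (elim \<tau>)
      from vector_derivative_diff_chain_within[OF inversion_line_derivative[OF elim(1)]
          has_derivative_at_withinI[OF f(1)[OF elim(2)]]]
      show ?case by (simp add: o_def has_real_derivative_iff_has_vector_derivative)
    qed
    have d1: "((\<lambda>\<tau>. ?J (y + \<tau> *\<^sub>R b)) has_vector_derivative inversion_deriv c b y) (at 0)"
      using inversion_line_derivative[of y 0 b c] y(1) by simp
    have "(f' has_derivative blinfun_apply (f'' (?J y))) (at (?J (y + 0 *\<^sub>R b)))"
      using f(2)[OF y(2)] by simp
    from vector_derivative_diff_chain_within[OF d1 has_derivative_at_withinI[OF this]]
    have d2: "((\<lambda>\<tau>. f' (?J (y + \<tau> *\<^sub>R b))) has_vector_derivative
        blinfun_apply (f'' (?J y)) (inversion_deriv c b y)) (at 0)"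
      by (simp add: o_def)
    have d3: "((\<lambda>\<tau>. inversion_deriv c b (y + \<tau> *\<^sub>R b)) has_vector_derivative inversion_deriv2 c b y) (at 0)"
      using b y(1) by (intro inversion_deriv_line_derivative) auto
    from bounded_bilinear.has_vector_derivative[OF bounded_bilinear_blinfun_apply d2 d3]
    show "((\<lambda>\<tau>. blinfun_apply (f' (?J (y + \<tau> *\<^sub>R b))) (inversion_deriv c b (y + \<tau> *\<^sub>R b))) has_real_derivative
        B (inversion_deriv c b y) (inversion_deriv c b y) + F (inversion_deriv2 c b y)) (at 0)"
      by (simp add: has_real_derivative_iff_has_vector_derivative B_def F_def add.commute)
    show "blinfun_apply (f' (?J (y + 0 *\<^sub>R b))) (inversion_deriv c b (y + 0 *\<^sub>R b)) = g \<bullet> b"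
      using b by (simp add: g_def F_def)
  qed (simp add: l_def)
  have gz: "g \<bullet> z = - F z / D"
  proof -
    have "g \<bullet> z = (\<Sum>b\<in>Basis. F (inversion_deriv c b y) * (z \<bullet> b))"
      by (simp only: g_def inner_sum_left inner_scaleR_left inner_commute[of z])
    also have "\<dots> = (\<Sum>b\<in>Basis. (1 / D) * ((z \<bullet> b) * F b) + (- 2 * F z / D\<^sup>2) * (z \<bullet> b)\<^sup>2)"
      unfolding J1 Flin by (simp add: algebra_simps power2_eq_square)
    also have "\<dots> = (1 / D) * F z + (- 2 * F z / D\<^sup>2) * D"
      by (simp only: sum.distrib sum_distrib_left[symmetric] sumF sum_m2)
    also have "\<dots> = - F z / D" using D by (simp add: field_simps power2_eq_square)
    finally show ?thesis .
  qed
  have l_eq: "l = (4 - 2 * N) / D\<^sup>2 * F z"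
  proof -
    have "(\<Sum>b\<in>Basis. B (inversion_deriv c b y) (inversion_deriv c b y)) =
      (\<Sum>b\<in>Basis. (1 / D\<^sup>2) * B b b + (- 2 / D ^ 3) * ((z \<bullet> b) * B z b) +
        (- 2 / D ^ 3) * ((z \<bullet> b) * B b z) + (4 / D ^ 4 * B z z) * (z \<bullet> b)\<^sup>2)"
    proof (rule sum.cong[OF refl])
      fix b :: 'a
      have Blin: "B (u + v) u' = B u u' + B v u'" "B u (u' + v') = B u u' + B u v'"
        "B (r *\<^sub>R u) u' = r * B u u'" "B u (r *\<^sub>R u') = r * B u u'" for u v u' v' r
        by (simp_all add: B_def blinfun.add_right blinfun.scaleR_right blinfun.add_left blinfun.scaleR_left)
      define m where "m = z \<bullet> b"
      show "B (inversion_deriv c b y) (inversion_deriv c b y) =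
        (1 / D\<^sup>2) * B b b + (- 2 / D ^ 3) * ((z \<bullet> b) * B z b) +
        (- 2 / D ^ 3) * ((z \<bullet> b) * B b z) + (4 / D ^ 4 * B z z) * (z \<bullet> b)\<^sup>2"
        unfolding J1 Blin m_def[symmetric]
        using D by (simp add: field_simps eval_nat_numeral)
    qed
    also have "\<dots> = (1 / D\<^sup>2) * 0 + (- 2 / D ^ 3) * B z z + (- 2 / D ^ 3) * B z z + (4 / D ^ 4 * B z z) * D"
    proof -
      have "(\<Sum>b\<in>Basis. B b b) = 0" unfolding B_def by (rule f(3)[OF y(2)])
      moreover have "(\<Sum>b\<in>Basis. (z \<bullet> b) * B z b) = B z z" unfolding B_def by (rule sum_Basis_blinfun)
      moreover have "(\<Sum>b\<in>Basis. (z \<bullet> b) * B b z) = B z z" unfolding B_def by (rule sum_Basis_blinfun2)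
      ultimately show ?thesis
        by (simp only: sum.distrib sum_distrib_left[symmetric] sum_m2)
    qed
    also have "\<dots> = 0" using D by (simp add: field_simps eval_nat_numeral)
    finally have Bsum: "(\<Sum>b\<in>Basis. B (inversion_deriv c b y) (inversion_deriv c b y)) = 0" .
    have "(\<Sum>b\<in>Basis. F (inversion_deriv2 c b y)) =
      (\<Sum>b\<in>Basis. (- 4 / D\<^sup>2) * ((z \<bullet> b) * F b) + (8 / D ^ 3 * F z) * (z \<bullet> b)\<^sup>2 - 2 / D\<^sup>2 * F z)"
      unfolding J2 Flin by (intro sum.cong refl) (simp add: algebra_simps)
    also have "\<dots> = (- 4 / D\<^sup>2) * F z + (8 / D ^ 3 * F z) * D - N * (2 / D\<^sup>2 * F z)"
      by (simp only: sum.distrib sum_subtractf sum_distrib_left[symmetric] sumF sum_m2 sum_constant N_def) (simp only: mult_ac)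
    also have "\<dots> = (4 - 2 * N) / D\<^sup>2 * F z" using D by (simp add: field_simps eval_nat_numeral)
    finally show ?thesis using Bsum by (simp add: l_def sum.distrib)
  qed
  define p where "p = (2 - N) / 2"
  have "\<forall>\<^sub>F t in nhds D. t > 0" using D by (intro eventually_nhds_in_open[of "{0<..}", simplified]) auto
  then have "\<forall>\<^sub>F t in nhds D. ((\<lambda>t. t powr p) has_real_derivative p * t powr (p - 1)) (at t)"
    by eventually_elim (auto intro!: derivative_eq_intros)
  moreover have "((\<lambda>t. p * t powr (p - 1)) has_real_derivative p * ((p - 1) * D powr (p - 2))) (at D)"
    using D by (auto intro!: derivative_eq_intros simp: diff_diff_eq)
  ultimately have "has_lap (\<lambda>y. ((y - c) \<bullet> (y - c)) powr p) y
      ((p * D powr (p - 1)) *\<^sub>R (2 *\<^sub>R (y - c)))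
      ((p * ((p - 1) * D powr (p - 2))) * ((2 *\<^sub>R (y - c)) \<bullet> (2 *\<^sub>R (y - c))) + (p * D powr (p - 1)) * real (2 * DIM('a)))"
    unfolding D_def z_def by (rule has_lap_compose[OF has_lap_dist_sq])
  moreover have "(p * ((p - 1) * D powr (p - 2))) * ((2 *\<^sub>R (y - c)) \<bullet> (2 *\<^sub>R (y - c))) + (p * D powr (p - 1)) * real (2 * DIM('a)) = 0"
  proof -
    have e1: "D powr (p - 1) = D powr (p - 2) * D" using D powr_add[of D "p - 2" 1] by simp
    have e2: "(2 *\<^sub>R (y - c)) \<bullet> (2 *\<^sub>R (y - c)) = 4 * D" unfolding D_def z_def by simp
    have e3: "real (2 * DIM('a)) = 2 * N" by (simp add: N_def)
    have "(p * ((p - 1) * D powr (p - 2))) * (4 * D) + (p * (D powr (p - 2) * D)) * (2 * N)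
      = p * D powr (p - 2) * D * 2 * ((2 * p) - 2 + N)"
      by (simp add: algebra_simps)
    also have "2 * p - 2 + N = 0" by (simp add: p_def field_simps)
    finally show ?thesis unfolding e1 e2 e3 by simp
  qed
  ultimately have k: "has_lap (\<lambda>y. ((y - c) \<bullet> (y - c)) powr p) y ((p * D powr (p - 1)) *\<^sub>R (2 *\<^sub>R z)) 0"
    by (simp only: z_def)
  have "D powr p * l + 2 * (((p * D powr (p - 1)) *\<^sub>R (2 *\<^sub>R z)) \<bullet> g) + w (?J y) * 0 = 0"
  proof -
    have e1: "D powr (p - 1) = D powr (p - 2) * D" using D powr_add[of D "p - 2" 1] by simp
    have e2: "D powr p = D powr (p - 2) * D\<^sup>2" using D powr_add[of D "p - 2" 2] by simp
    have "D powr p * l + 2 * (((p * D powr (p - 1)) *\<^sub>R (2 *\<^sub>R z)) \<bullet> g) =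
      D powr (p - 2) * D\<^sup>2 * ((4 - 2 * N) / D\<^sup>2 * F z) + 4 * p * (D powr (p - 2) * D) * (- F z / D)"
      unfolding e1 e2 l_eq gz[symmetric] by (simp add: inner_commute)
    also have "\<dots> = D powr (p - 2) * F z * ((4 - 2 * N) - 4 * p)"
      using D by (simp add: field_simps)
    also have "\<dots> = 0" by (simp add: p_def field_simps)
    finally show ?thesis by simp
  qed
  with has_lap_mult[OF k lap]
  have "has_lap (\<lambda>y. ((y - c) \<bullet> (y - c)) powr p * w (?J y)) y
    (((y - c) \<bullet> (y - c)) powr p *\<^sub>R g + w (?J y) *\<^sub>R ((p * D powr (p - 1)) *\<^sub>R (2 *\<^sub>R z))) 0"
    unfolding D_def z_def by simp
  then show ?thesis unfolding kelvin_def[abs_def] p_def N_def by blast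
qed

section \<open>Metric properties of the inversion and Hoelder bounds\<close>

lemma powr_lipschitz:
  fixes a b p :: real
  assumes "0 < a"
  obtains L where "L \<ge> 0" "\<And>s t. s \<in> {a..b} \<Longrightarrow> t \<in> {a..b} \<Longrightarrow> \<bar>s powr p - t powr p\<bar> \<le> L * \<bar>s - t\<bar>"
proof -
  have "continuous_on {a..b} (\<lambda>t. p * t powr (p - 1))"
    using assms by (intro continuous_intros) auto
  then have "bounded ((\<lambda>t. p * t powr (p - 1)) ` {a..b})"
    by (intro compact_imp_bounded compact_continuous_image) auto
  then obtain L where "\<forall>x\<in>(\<lambda>t. p * t powr (p - 1)) ` {a..b}. norm x \<le> L"
    unfolding bounded_iff by blast
  then have L: "norm (p * t powr (p - 1)) \<le> L" if "t \<in> {a..b}" for t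
    using that by blast
  show ?thesis
  proof (rule that[of "max L 0"])
    fix s t assume st: "s \<in> {a..b}" "t \<in> {a..b}"
    have "norm (s powr p - t powr p) \<le> max L 0 * norm (s - t)"
    proof (rule field_differentiable_bound[of "{a..b}" "\<lambda>t. t powr p" "\<lambda>t. p * t powr (p - 1)"])
      show "((\<lambda>t. t powr p) has_field_derivative p * z powr (p - 1)) (at z within {a..b})"
        if "z \<in> {a..b}" for z
        using that assms by (auto intro!: derivative_eq_intros)
      show "norm (p * z powr (p - 1)) \<le> max L 0" if "z \<in> {a..b}" for z
        using L[OF that] by simp
    qed (use st in auto)
    then show "\<bar>s powr p - t powr p\<bar> \<le> max L 0 * \<bar>s - t\<bar>" by simp
  qed simp
qed

lemma inversion_minus_center: "inversion c y - c = (1 / ((y - c) \<bullet> (y - c))) *\<^sub>R (y - c)"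
  by (simp add: inversion_def)

lemma dist_sq_inversion: "(inversion c y - c) \<bullet> (inversion c y - c) = 1 / ((y - c) \<bullet> (y - c))"
  by (simp add: inversion_minus_center)

lemma inversion_inversion:
  assumes "y \<noteq> c"
  shows "inversion c (inversion c y) = y"
proof -
  have "inversion c (inversion c y) = c + (1 / ((inversion c y - c) \<bullet> (inversion c y - c))) *\<^sub>R (inversion c y - c)"
    by (simp add: inversion_def[of c "inversion c y"])
  also have "\<dots> = y"
    unfolding dist_sq_inversion inversion_minus_center using assms by simp
  finally show ?thesis .
qed

lemma norm_inversion_diff:
  assumes "x \<noteq> c" "y \<noteq> c"
  shows "norm (inversion c x - inversion c y) = norm (x - y) / (norm (x - c) * norm (y - c))"
proof -
  define a b where "a = x - c" and "b = y - c"
  have nz: "a \<bullet> a \<noteq> 0" "b \<bullet> b \<noteq> 0" using assms by (simp_all add: a_def b_def)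
  have "(norm (inversion c x - inversion c y))\<^sup>2 = (norm ((1 / (a \<bullet> a)) *\<^sub>R a - (1 / (b \<bullet> b)) *\<^sub>R b))\<^sup>2"
    by (simp add: inversion_def a_def b_def)
  also have "\<dots> = (1 / (a \<bullet> a)) - 2 * (a \<bullet> b) / ((a \<bullet> a) * (b \<bullet> b)) + 1 / (b \<bullet> b)"
    unfolding power2_norm_eq_inner using nz by (simp add: inner_diff_left inner_diff_right inner_commute field_simps)
  also have "\<dots> = ((a - b) \<bullet> (a - b)) / ((a \<bullet> a) * (b \<bullet> b))"
    using nz by (simp add: inner_diff_left inner_diff_right inner_commute field_simps)
  also have "\<dots> = (norm (x - y) / (norm (x - c) * norm (y - c)))\<^sup>2"
    by (simp add: a_def b_def power_divide power_mult_distrib dot_square_norm)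
  finally show ?thesis by (simp add: power2_eq_iff_nonneg)
qed

context
  fixes c :: "'a::euclidean_space"
  assumes nc: "norm c = 1"
begin

lemma cc: "c \<bullet> c = 1"
  using nc by (simp add: norm_eq_1)

text \<open>A centre at distance 1 puts the origin on the sphere of inversion, so the boundary point
  stays fixed.\<close>

lemma inversion_0 [simp]: "inversion c 0 = 0"
  by (simp add: inversion_def cc)

lemma norm_center_bounds:
  assumes "norm y < 1/4"
  shows "3/4 \<le> norm (y - c)" "norm (y - c) \<le> 5/4" "y \<noteq> c"
  using norm_triangle_ineq4[of y c] norm_triangle_ineq3[of y c] assms nc by auto

lemma dist_sq_center_bounds:
  assumes "norm y < 1/4"
  shows "(y - c) \<bullet> (y - c) \<in> {9/16..25/16}"
proof -
  have "(3/4)\<^sup>2 \<le> (norm (y - c))\<^sup>2" "(norm (y - c))\<^sup>2 \<le> (5/4)\<^sup>2"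
    using norm_center_bounds[OF assms] by (intro power_mono; simp)+
  then show ?thesis by (simp add: dot_square_norm power2_eq_square)
qed

lemma norm_inversion_diff_le:
  assumes "norm x < 1/4" "norm y < 1/4"
  shows "norm (inversion c x - inversion c y) \<le> 16/9 * norm (x - y)"
proof -
  note x = norm_center_bounds[OF assms(1)] and y = norm_center_bounds[OF assms(2)]
  have "3/4 * (3/4) \<le> norm (x - c) * norm (y - c)" using x y by (intro mult_mono) auto
  then have "norm (x - y) / (norm (x - c) * norm (y - c)) \<le> norm (x - y) / (9/16)"
    by (intro divide_left_mono) auto
  then show ?thesis using norm_inversion_diff[OF x(3) y(3)] by simp
qed

lemma norm_inversion_le:
  assumes "norm y < 1/4"
  shows "norm (inversion c y) \<le> 4/3 * norm y"
proof -
  note y = norm_center_bounds[OF assms]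
  have "0 \<noteq> c" using nc by auto
  then have "norm (inversion c y) = norm y / norm (y - c)"
    using norm_inversion_diff[OF y(3), of 0] nc by simp
  also have "\<dots> \<le> norm y / (3/4)" using y by (intro divide_left_mono) auto
  finally show ?thesis by simp
qed

text \<open>The first inequality describes the open ball with diameter from 0 to \<open>c\<close>.
  Its sphere passes through the centre of inversion, so it becomes a hyperplane; the exact identity
  is that \<open>c \<bullet> inversion c y\<close> minus the squared norm of
  \<open>inversion c y\<close> equals \<open>- (c \<bullet> y) / D\<close>.\<close>

lemma inversion_ball_halfspace:
  assumes "y \<noteq> c"
  shows "inversion c y \<bullet> inversion c y < c \<bullet> inversion c y \<longleftrightarrow> c \<bullet> y < 0"
proof -
  define D where "D = (y - c) \<bullet> (y - c)"
  have D: "D > 0" using assms by (simp add: D_def)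
  have J: "inversion c y = c + (1 / D) *\<^sub>R (y - c)" by (simp add: inversion_def D_def)
  have "inversion c y \<bullet> inversion c y = 1 + 2 / D * (c \<bullet> (y - c)) + (1 / D)\<^sup>2 * D"
  proof -
    have "(u + r *\<^sub>R v) \<bullet> (u + r *\<^sub>R v) = u \<bullet> u + 2 * r * (u \<bullet> v) + r\<^sup>2 * (v \<bullet> v)" for u v :: 'a and r
      by (simp add: inner_add_left inner_add_right power2_eq_square inner_commute[of v u] algebra_simps)
    from this[of c "1 / D" "y - c"] show ?thesis unfolding J D_def[symmetric] by (simp add: cc)
  qed
  moreover have "c \<bullet> inversion c y = 1 + 1 / D * (c \<bullet> (y - c))"
    unfolding J by (simp add: inner_add_right cc)
  moreover have "c \<bullet> (y - c) = c \<bullet> y - 1" by (simp add: inner_diff_right cc)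
  ultimately have "c \<bullet> inversion c y - inversion c y \<bullet> inversion c y = - (c \<bullet> y) / D"
    using D by (simp add: field_simps power2_eq_square)
  then have "inversion c y \<bullet> inversion c y < c \<bullet> inversion c y \<longleftrightarrow> - (c \<bullet> y) / D > 0" by linarith
  then show ?thesis using D by (simp add: zero_less_divide_iff divide_less_0_iff)
qed

lemma kelvin_holder:
  fixes w :: "'a \<Rightarrow> real"
  assumes C: "C \<ge> 0" and w0: "w 0 = 0"
    and holder: "\<And>x y. x \<in> ball 0 1 \<Longrightarrow> y \<in> ball 0 1 \<Longrightarrow> \<bar>w x - w y\<bar> \<le> C * sqrt (norm (x - y))"
  obtains C' where "C' > 0"
    "\<And>x y. x \<in> ball 0 (1/4) \<Longrightarrow> y \<in> ball 0 (1/4) \<Longrightarrow> \<bar>kelvin c w x - kelvin c w y\<bar> \<le> C' * sqrt (norm (x - y))"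
proof -
  define p where "p = (2 - real DIM('a)) / 2"
  obtain L where L: "L \<ge> 0"
    "\<And>s t. s \<in> {9/16..25/16} \<Longrightarrow> t \<in> {9/16..25/16} \<Longrightarrow> \<bar>s powr p - t powr p\<bar> \<le> L * \<bar>s - t\<bar>"
    using powr_lipschitz[of "9/16" "25/16" p] by auto
  have k_le: "s powr p \<le> 1 + L" if "s \<in> {9/16..25/16}" for s
  proof -
    have "\<bar>s powr p - 1 powr p\<bar> \<le> L * \<bar>s - 1\<bar>" using that by (intro L(2)) auto
    also have "\<dots> \<le> L * 1" using L(1) that by (intro mult_left_mono) (auto simp: abs_le_iff)
    finally show ?thesis by simp
  qed
  \<comment> \<open>The product estimate: 4/3 is the square root of the Lipschitz constant 16/9 of
    the inversion, 5/2 bounds the sum of the two distances from \<open>c\<close>, and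
    \<open>w 0 = 0\<close> bounds the values of \<open>w\<close> by \<open>C\<close>. The summand 1
    makes \<open>C'\<close> positive even if \<open>C = 0\<close>.\<close>
  define C' where "C' = (1 + L) * (C * (4/3)) + L * (5/2) * C + 1"
  show ?thesis
  proof (rule that[of C'])
    show "C' > 0" using L(1) C by (simp add: C'_def add_nonneg_pos)
    fix x y :: 'a assume "x \<in> ball 0 (1/4)" "y \<in> ball 0 (1/4)"
    then have xy: "norm x < 1/4" "norm y < 1/4" by auto
    define Dx Dy where "Dx = (x - c) \<bullet> (x - c)" and "Dy = (y - c) \<bullet> (y - c)"
    have D: "Dx \<in> {9/16..25/16}" "Dy \<in> {9/16..25/16}"
      using dist_sq_center_bounds[OF xy(1)] dist_sq_center_bounds[OF xy(2)] by (auto simp: Dx_def Dy_def)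
    have in1: "inversion c z \<in> ball 0 1" if "norm z < 1/4" for z
      using norm_inversion_le[OF that] that by simp
    have "\<bar>w (inversion c x) - w (inversion c y)\<bar> \<le> C * sqrt (norm (inversion c x - inversion c y))"
      by (intro holder in1 xy)
    also have "\<dots> \<le> C * sqrt (16/9 * norm (x - y))"
      using C norm_inversion_diff_le[OF xy] by (intro mult_left_mono real_sqrt_le_mono) auto
    also have "\<dots> = C * (4/3) * sqrt (norm (x - y))"
      by (simp add: real_sqrt_mult real_sqrt_divide)
    finally have 1: "\<bar>w (inversion c x) - w (inversion c y)\<bar> \<le> C * (4/3) * sqrt (norm (x - y))" .
    have "\<bar>w (inversion c y) - w 0\<bar> \<le> C * sqrt (norm (inversion c y - 0))"
      by (intro holder in1 xy) simp
    also have "\<dots> \<le> C * 1"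
      using C in1[OF xy(2)] by (intro mult_left_mono) auto
    finally have 2: "\<bar>w (inversion c y)\<bar> \<le> C" using w0 by simp
    have n12: "norm (x - y) \<le> 1" using norm_triangle_ineq4[of x y] xy by simp
    have "Dx - Dy = (norm (x - c) - norm (y - c)) * (norm (x - c) + norm (y - c))"
      by (simp add: Dx_def Dy_def dot_square_norm power2_eq_square algebra_simps)
    then have "\<bar>Dx - Dy\<bar> = \<bar>norm (x - c) - norm (y - c)\<bar> * \<bar>norm (x - c) + norm (y - c)\<bar>"
      by (simp add: abs_mult)
    also have "\<dots> \<le> norm (x - y) * (5/2)"
      using norm_triangle_ineq3[of "x - c" "y - c"] norm_center_bounds[OF xy(1)] norm_center_bounds[OF xy(2)]
      by (intro mult_mono) auto
    also have "\<dots> \<le> sqrt (norm (x - y)) * (5/2)"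
    proof -
      have "norm (x - y) = sqrt (norm (x - y)) * sqrt (norm (x - y))" by simp
      also have "\<dots> \<le> sqrt (norm (x - y)) * 1" using n12 by (intro mult_left_mono) auto
      finally show ?thesis by simp
    qed
    finally have 3: "\<bar>Dx - Dy\<bar> \<le> sqrt (norm (x - y)) * (5/2)" .
    have "kelvin c w x - kelvin c w y =
      Dx powr p * (w (inversion c x) - w (inversion c y)) + (Dx powr p - Dy powr p) * w (inversion c y)"
      by (simp add: kelvin_def Dx_def Dy_def p_def algebra_simps)
    then have "\<bar>kelvin c w x - kelvin c w y\<bar> \<le>
      \<bar>Dx powr p * (w (inversion c x) - w (inversion c y))\<bar> + \<bar>(Dx powr p - Dy powr p) * w (inversion c y)\<bar>"
      by simp
    also have "\<bar>Dx powr p * (w (inversion c x) - w (inversion c y))\<bar> \<le> (1 + L) * (C * (4/3) * sqrt (norm (x - y)))"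
      unfolding abs_mult using k_le[OF D(1)] 1 L(1) by (intro mult_mono) auto
    also have "\<bar>(Dx powr p - Dy powr p) * w (inversion c y)\<bar> \<le> (L * (sqrt (norm (x - y)) * (5/2))) * C"
      unfolding abs_mult using order_trans[OF L(2)[OF D] mult_left_mono[OF 3 L(1)]] 2 L(1)
      by (intro mult_mono) auto
    also have "(1 + L) * (C * (4/3) * sqrt (norm (x - y))) + (L * (sqrt (norm (x - y)) * (5/2))) * C
       = (C' - 1) * sqrt (norm (x - y))"
      by (simp add: C'_def algebra_simps)
    also have "\<dots> \<le> C' * sqrt (norm (x - y))" by (intro mult_right_mono) auto
    finally show "\<bar>kelvin c w x - kelvin c w y\<bar> \<le> C' * sqrt (norm (x - y))" by simp
  qed
qed

end

section \<open>Transfer of expansions through the inversion\<close>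

context orthonormal_pair
begin

interpretation flip: orthonormal_pair "- e" f
  using ee ff ef by unfold_locales simp_all

lemma flip_slit: "y \<in> flip.slit \<longleftrightarrow> y \<bullet> f = 0 \<and> 0 \<le> y \<bullet> e"
  by (simp add: flip.slit_def)

text \<open>The inversion maps the tangent sphere to its tangent hyperplane at 0 and interchanges the two
  sides, so the model solution in the inverted picture opens towards \<open>- e\<close>.\<close>

lemma kelvin_expansion_transfer:
  fixes w :: "'a \<Rightarrow> real"
  assumes c: "c = \<sigma> *\<^sub>R e" "\<sigma> \<in> {1, -1}" and \<alpha>: "\<alpha> \<ge> 0"
    and exp: "\<And>\<epsilon>. \<epsilon> > 0 \<Longrightarrow> \<exists>r>0. \<forall>y. norm y < r \<longrightarrow> \<bar>kelvin c w y - \<alpha> * flip.root y\<bar> \<le> \<epsilon> * sqrt (norm y)"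
    and \<epsilon>: "\<epsilon> > 0"
  shows "\<exists>r>0. \<forall>x. norm x < r \<longrightarrow> \<bar>w x - \<alpha> * root x\<bar> \<le> \<epsilon> * sqrt (norm x)"
proof -
  have ne: "norm e = 1" using ee by (simp add: norm_eq_1)
  have nc: "norm c = 1" using c ne by auto
  have \<sigma>2: "\<sigma> * \<sigma> = 1" using c by auto
  define p where "p = (2 - real DIM('a)) / 2"
  obtain L where L: "L \<ge> 0"
    "\<And>s t. s \<in> {9/16..25/16} \<Longrightarrow> t \<in> {9/16..25/16} \<Longrightarrow> \<bar>s powr p - t powr p\<bar> \<le> L * \<bar>s - t\<bar>"
    using powr_lipschitz[of "9/16" "25/16" p] by auto
  \<comment> \<open>Collects the errors of size \<open>norm x\<close>:
    \<open>6 * \<alpha> * L\<close> from the weight, \<open>3 * \<alpha>\<close> from the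
    displacement of the argument of \<open>root\<close>, and 1 for positivity.\<close>
  define K where "K = 6 * \<alpha> * L + 3 * \<alpha> + 1"
  have K: "K > 0" using \<alpha> L(1) by (simp add: K_def add_nonneg_pos)
  \<comment> \<open>The weight is at most \<open>1 + L\<close> and
    \<open>sqrt (norm y) \<le> 2 * q\<close>, so the transformed remainder uses up
    \<open>\<epsilon> / 2\<close>.\<close>
  define \<epsilon>' where "\<epsilon>' = \<epsilon> / (4 * (1 + L))"
  have \<epsilon>': "\<epsilon>' > 0" using \<epsilon> L(1) by (simp add: \<epsilon>'_def)
  from exp[OF this] obtain r where r: "r > 0"
    "\<And>y. norm y < r \<Longrightarrow> \<bar>kelvin c w y - \<alpha> * flip.root y\<bar> \<le> \<epsilon>' * sqrt (norm y)" by blast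
  define r' where "r' = min (1/4) (min (r / 2) ((\<epsilon> / (2 * K))\<^sup>2))"
  have r': "r' > 0" using r(1) \<epsilon> K by (simp add: r'_def)
  have "\<bar>w x - \<alpha> * root x\<bar> \<le> \<epsilon> * sqrt (norm x)" if x: "norm x < r'" for x
  proof -
    have x4: "norm x < 1/4" and xr: "norm x < r / 2" and xK: "norm x < (\<epsilon> / (2 * K))\<^sup>2"
      using x by (simp_all add: r'_def)
    define q where "q = sqrt (norm x)"
    have q: "q \<ge> 0" "q * q = norm x" "q \<le> 1" using x4 by (auto simp: q_def)
    have qK: "q * K \<le> \<epsilon> / 2"
    proof -
      have "q \<le> \<epsilon> / (2 * K)" unfolding q_def using xK \<epsilon> K by (intro real_le_lsqrt) auto
      then show ?thesis using K by (simp add: field_simps)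
    qed
    have qq: "norm x \<le> q" using mult_left_mono[OF q(3,1)] q(2) by simp
    define D where "D = (x - c) \<bullet> (x - c)"
    have D: "D \<in> {9/16..25/16}" using dist_sq_center_bounds[OF nc x4] by (simp add: D_def)
    have xc: "x \<noteq> c" using norm_center_bounds[OF nc x4] by simp
    define y where "y = inversion c x"
    have ny: "norm y \<le> 4/3 * norm x" unfolding y_def by (rule norm_inversion_le[OF nc x4])
    have sy: "sqrt (norm y) \<le> 2 * q"
    proof -
      have "sqrt (norm y) \<le> sqrt (4 * norm x)" using ny norm_ge_zero[of x] by (intro real_sqrt_le_mono) linarith
      then show ?thesis by (simp add: real_sqrt_mult q_def)
    qed
    have jy: "inversion c y = x" unfolding y_def by (rule inversion_inversion[OF xc])
    have Dy: "(y - c) \<bullet> (y - c) = 1 / D" unfolding y_def dist_sq_inversion D_def ..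
    have "(1 / D) powr p * D powr p = 1"
      using D by (simp add: powr_mult[symmetric])
    moreover have "D powr p * kelvin c w y = ((1 / D) powr p * D powr p) * w x"
      unfolding kelvin_def Dy jy p_def[symmetric] by (simp only: mult_ac)
    ultimately have w: "w x = D powr p * kelvin c w y" by simp
    have D1: "D - 1 = (norm x)\<^sup>2 - 2 * \<sigma> * (x \<bullet> e)"
      using \<sigma>2 by (simp add: D_def c(1) inner_diff_left inner_diff_right inner_commute ee dot_square_norm[symmetric])
    have "\<bar>x \<bullet> e\<bar> \<le> norm x" using Cauchy_Schwarz_ineq2[of x e] ne by simp
    moreover have "(norm x)\<^sup>2 \<le> norm x"
      using x4 mult_left_mono[of "norm x" 1 "norm x"] by (simp add: power2_eq_square)
    moreover have "\<bar>2 * \<sigma> * (x \<bullet> e)\<bar> = 2 * \<bar>x \<bullet> e\<bar>" using c(2) by auto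
    moreover have "0 \<le> (norm x)\<^sup>2" by simp
    ultimately have D1': "\<bar>D - 1\<bar> \<le> 3 * norm x" unfolding D1 by linarith
    have kD: "\<bar>D powr p - 1\<bar> \<le> L * (3 * norm x)"
    proof -
      have "\<bar>D powr p - 1 powr p\<bar> \<le> L * \<bar>D - 1\<bar>" using D by (intro L(2)) auto
      also have "\<dots> \<le> L * (3 * norm x)" using D1' L(1) by (intro mult_left_mono)
      finally show ?thesis by simp
    qed
    have kD': "D powr p \<le> 1 + L"
    proof -
      have "L * (3 * norm x) \<le> L * 1" using x4 L(1) by (intro mult_left_mono) auto
      with kD show ?thesis by (simp add: abs_le_iff)
    qed
    \<comment> \<open>The derivative of the inversion at 0 is the reflection that flips
      \<open>e\<close>. Undoing it leaves a point within \<open>9 * (norm x)\<^sup>2\<close> of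
      \<open>x\<close>. Quadratic closeness is what counts: the Hoelder bound for
      \<open>root\<close> takes a square root, and the resulting \<open>3 * norm x\<close> is still
      negligible against \<open>sqrt (norm x)\<close>.\<close>
    define y' where "y' = y - (2 * (y \<bullet> e)) *\<^sub>R e"
    have root_y: "flip.root y = root y'"
    proof -
      have "y' \<bullet> e = - (y \<bullet> e)" "y' \<bullet> f = y \<bullet> f"
        by (simp_all add: y'_def inner_diff_left ee ef)
      then show ?thesis by (simp add: root_def flip.root_def proj_def flip.proj_def)
    qed
    have y'x: "y' - x = (1 / D) *\<^sub>R ((1 - D) *\<^sub>R x - (\<sigma> * (norm x)\<^sup>2) *\<^sub>R e)"
    proof -
      have D0: "D \<noteq> 0" using D by auto
      have y: "y = \<sigma> *\<^sub>R e + (1 / D) *\<^sub>R (x - \<sigma> *\<^sub>R e)"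
        by (simp add: y_def inversion_def D_def c(1))
      have ye: "y \<bullet> e = \<sigma> + (1 / D) * (x \<bullet> e - \<sigma>)"
        by (simp add: y inner_add_left inner_diff_left ee)
      have "y' - x = (1 / D - 1) *\<^sub>R x + (\<sigma> - (1 / D) * \<sigma> - 2 * (\<sigma> + (1 / D) * (x \<bullet> e - \<sigma>))) *\<^sub>R e"
      proof -
        have "\<sigma> *\<^sub>R e + (1 / D) *\<^sub>R (x - \<sigma> *\<^sub>R e) - k *\<^sub>R e - x =
            (1 / D - 1) *\<^sub>R x + (\<sigma> - (1 / D) * \<sigma> - k) *\<^sub>R e" for k
          by (simp add: algebra_simps)
        then show ?thesis unfolding y'_def ye unfolding y .
      qed
      also have "\<sigma> - (1 / D) * \<sigma> - 2 * (\<sigma> + (1 / D) * (x \<bullet> e - \<sigma>)) = - (1 / D) * (\<sigma> * (norm x)\<^sup>2)"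
      proof -
        have "\<sigma> * (D - 1) = \<sigma> * (norm x)\<^sup>2 - 2 * (\<sigma> * \<sigma>) * (x \<bullet> e)"
          unfolding D1 by (simp add: algebra_simps)
        then have n: "\<sigma> * (norm x)\<^sup>2 = \<sigma> * (D - 1) + 2 * (x \<bullet> e)" unfolding \<sigma>2 by simp
        show ?thesis unfolding n using D0 by (simp add: field_simps)
      qed
      also have "1 / D - 1 = (1 / D) * (1 - D)" using D0 by (simp add: field_simps)
      finally show ?thesis by (simp add: scaleR_diff_right)
    qed
    have "norm ((1 - D) *\<^sub>R x - (\<sigma> * (norm x)\<^sup>2) *\<^sub>R e) \<le> \<bar>1 - D\<bar> * norm x + (norm x)\<^sup>2"
      using norm_triangle_ineq4[of "(1 - D) *\<^sub>R x" "(\<sigma> * (norm x)\<^sup>2) *\<^sub>R e"] c(2) ne by auto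
    also have "\<dots> \<le> (3 * norm x) * norm x + (norm x)\<^sup>2"
      using D1' by (intro add_right_mono mult_right_mono) (auto simp: abs_minus_commute)
    finally have n1: "norm ((1 - D) *\<^sub>R x - (\<sigma> * (norm x)\<^sup>2) *\<^sub>R e) \<le> 4 * (norm x)\<^sup>2"
      by (simp add: power2_eq_square)
    have "norm (y' - x) \<le> (16/9) * (4 * (norm x)\<^sup>2)"
      unfolding y'x norm_scaleR using D n1 by (intro mult_mono) (auto simp: field_simps)
    also have "\<dots> \<le> 9 * (norm x)\<^sup>2" by simp
    also have "\<dots> = (3 * norm x)\<^sup>2" by (simp add: power_mult_distrib)
    finally have "sqrt (norm (y' - x)) \<le> 3 * norm x" by (intro real_le_lsqrt) auto
    then have rd: "\<bar>flip.root y - root x\<bar> \<le> 3 * norm x"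
      unfolding root_y using root_holder[of y' x] by simp
    have "norm y < r" using ny xr norm_ge_zero[of x] by linarith
    then have ky: "\<bar>kelvin c w y - \<alpha> * flip.root y\<bar> \<le> \<epsilon>' * (2 * q)"
      using r(2)[of y] sy mult_left_mono[OF sy, of \<epsilon>'] \<epsilon>' by linarith
    have "w x - \<alpha> * root x = D powr p * (kelvin c w y - \<alpha> * flip.root y)
        + \<alpha> * ((D powr p - 1) * flip.root y) + \<alpha> * (flip.root y - root x)"
      unfolding w by (simp add: algebra_simps)
    then have "\<bar>w x - \<alpha> * root x\<bar> \<le> \<bar>D powr p * (kelvin c w y - \<alpha> * flip.root y)\<bar>
        + \<bar>\<alpha> * ((D powr p - 1) * flip.root y)\<bar> + \<bar>\<alpha> * (flip.root y - root x)\<bar>"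
      by linarith
    also have "\<bar>D powr p * (kelvin c w y - \<alpha> * flip.root y)\<bar> \<le> (1 + L) * (\<epsilon>' * (2 * q))"
      unfolding abs_mult using kD' ky L(1) by (intro mult_mono) auto
    also have "\<bar>\<alpha> * ((D powr p - 1) * flip.root y)\<bar> \<le> \<alpha> * ((L * (3 * norm x)) * (2 * q))"
      unfolding abs_mult using kD sy flip.root_le[of y] flip.root_nonneg[of y] \<alpha> L(1) q(1)
      by (intro mult_mono mult_nonneg_nonneg) auto
    also have "\<bar>\<alpha> * (flip.root y - root x)\<bar> \<le> \<alpha> * (3 * norm x)"
      unfolding abs_mult using rd \<alpha> by (intro mult_mono) auto
    also have "(1 + L) * (\<epsilon>' * (2 * q)) + \<alpha> * ((L * (3 * norm x)) * (2 * q)) + \<alpha> * (3 * norm x)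
      \<le> q * (\<epsilon> / 2) + q * (q * K)"
    proof -
      have "(1 + L) * (\<epsilon>' * (2 * q)) = q * (\<epsilon> / 2)" using L(1) by (simp add: \<epsilon>'_def field_simps)
      moreover have "\<alpha> * ((L * (3 * norm x)) * (2 * q)) \<le> (6 * \<alpha> * L) * (q * q)"
      proof -
        have "(6 * \<alpha> * L * q) * norm x \<le> (6 * \<alpha> * L * q) * q"
          using qq \<alpha> L(1) q(1) by (intro mult_left_mono mult_nonneg_nonneg) auto
        then show ?thesis by (simp add: mult_ac)
      qed
      moreover have "\<alpha> * (3 * norm x) = 3 * \<alpha> * (q * q)" by (simp add: q(2))
      moreover have "0 \<le> q * q" using q(1) by simp
      moreover have "q * (q * K) = (6 * \<alpha> * L) * (q * q) + 3 * \<alpha> * (q * q) + q * q"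
        by (simp add: K_def algebra_simps)
      ultimately show ?thesis by linarith
    qed
    also have "\<dots> \<le> q * (\<epsilon> / 2) + q * (\<epsilon> / 2)"
      using qK q(1) by (intro add_left_mono mult_left_mono)
    finally show ?thesis by (simp add: q_def mult.commute)
  qed
  then show ?thesis using r' by blast
qed

text \<open>The centre \<open>e\<close> lies in the hyperplane \<open>x \<bullet> f = 0\<close>, so
  the inversion preserves that hyperplane, and by \<open>outside\<close> every nearby point whose
  image leaves \<open>S\<close> lies in \<open>flip.slit\<close>. The Kelvin transform is thus
  harmonic off the flat slit.\<close>

lemma expansion_positive_tangent_ball:
  fixes w :: "'a \<Rightarrow> real"
  assumes S: "open S" and harm: "harmonic_on S w" and C: "C \<ge> 0"
    and holder: "\<And>x y. x \<in> ball 0 1 \<Longrightarrow> y \<in> ball 0 1 \<Longrightarrow> \<bar>w x - w y\<bar> \<le> C * sqrt (norm (x - y))"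
    and nonneg: "\<And>x. x \<in> ball 0 1 \<Longrightarrow> 0 \<le> w x" and w0: "w 0 = 0"
    and outside: "\<And>x. x \<in> ball 0 1 - S \<Longrightarrow> x \<bullet> f = 0 \<and> x \<bullet> e \<le> x \<bullet> x"
    and pos: "x\<^sub>0 \<noteq> 0" "norm x\<^sub>0 < 1/32" "w x\<^sub>0 > 0"
  shows "\<exists>\<alpha>>0. \<forall>\<epsilon>>0. \<exists>r>0. \<forall>x. norm x < r \<longrightarrow> \<bar>w x - \<alpha> * root x\<bar> \<le> \<epsilon> * sqrt (norm x)"
proof -
  have ne: "norm e = 1" using ee by (simp add: norm_eq_1)
  note bounds = norm_center_bounds[OF ne] and inv_le = norm_inversion_le[OF ne]
  have in1: "inversion e y \<in> ball 0 1" if "norm y < 1/4" for y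
    using inv_le[OF that] that by simp
  from kelvin_holder[OF ne C w0 holder] obtain C' where C': "C' > 0"
    "\<And>x y. x \<in> ball 0 (1/4) \<Longrightarrow> y \<in> ball 0 (1/4) \<Longrightarrow> \<bar>kelvin e w x - kelvin e w y\<bar> \<le> C' * sqrt (norm (x - y))"
    by auto
  have K0: "kelvin e w 0 = 0" using w0 inversion_0[OF ne] by (simp add: kelvin_def)
  have Knn: "0 \<le> kelvin e w y" if "y \<in> ball 0 (1/4)" for y
    using nonneg[OF in1[of y]] that by (simp add: kelvin_def)
  have Ksup: "supersol (kelvin e w) y" if y: "y \<in> ball 0 (1/4) - flip.slit" for y
  proof -
    have y4: "norm y < 1/4" using y by simp
    have "inversion e y \<in> S"
    proof (rule ccontr)
      assume "inversion e y \<notin> S"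
      with outside[of "inversion e y"] in1[OF y4]
      have o: "inversion e y \<bullet> f = 0" "inversion e y \<bullet> e \<le> inversion e y \<bullet> inversion e y" by auto
      then have "\<not> e \<bullet> y < 0"
        using inversion_ball_halfspace[OF ne bounds(3)[OF y4]] by (simp add: inner_commute)
      moreover have "y \<bullet> f = 0"
      proof -
        have "(y - e) \<bullet> (y - e) \<noteq> 0" using bounds(3)[OF y4] by simp
        moreover have "inversion e y \<bullet> f = (1 / ((y - e) \<bullet> (y - e))) * (y \<bullet> f)"
          unfolding inversion_def inner_add_left[of e] inner_scaleR_left inner_diff_left[of y e f] ef by simp
        ultimately show ?thesis using o(1) by (simp del: inner_eq_zero_iff)
      qed
      ultimately have "y \<in> flip.slit" by (simp add: flip_slit inner_commute)
      with y show False by simp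
    qed
    from kelvin_harmonic[OF S harm bounds(3)[OF y4] this] obtain d where "has_lap (kelvin e w) y d 0" by blast
    then show ?thesis by (rule supersol_lap) simp
  qed
  show ?thesis
  proof (rule flip.expansion_supersol[of "1/4" C' "kelvin e w", OF _ _ K0 Knn Ksup C'(2)])
    fix \<alpha> assume \<alpha>: "\<alpha> \<ge> 0" and p: "\<And>x. 4 * norm x \<le> 1/4 \<Longrightarrow> 0 < kelvin e w x \<Longrightarrow> 0 < \<alpha>"
      and exp: "\<And>\<epsilon>. 0 < \<epsilon> \<Longrightarrow> \<exists>r>0. \<forall>x. norm x < r \<longrightarrow> \<bar>kelvin e w x - \<alpha> * flip.root x\<bar> \<le> \<epsilon> * sqrt (norm x)"
    have "\<alpha> > 0"
    proof (rule p)
      have x4: "norm x\<^sub>0 < 1/4" using pos by simp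
      \<comment> \<open>\<open>norm_inversion_le\<close> and the bound 1/32 place the image within
        \<open>4/3 * 1/32 = 1/24\<close> of the origin.\<close>
      show "4 * norm (inversion e x\<^sub>0) \<le> 1/4" using inv_le[OF x4] pos by simp
      show "0 < kelvin e w (inversion e x\<^sub>0)"
        unfolding kelvin_def inversion_inversion[OF bounds(3)[OF x4]] dist_sq_inversion
        using pos(3) bounds(3)[OF x4] by simp
    qed
    moreover have "\<forall>\<epsilon>>0. \<exists>r>0. \<forall>x. norm x < r \<longrightarrow> \<bar>w x - \<alpha> * root x\<bar> \<le> \<epsilon> * sqrt (norm x)"
      using kelvin_expansion_transfer[of e 1, OF _ _ \<alpha> exp] by simp
    ultimately show ?thesis by blast
  qed (use C'(1) in auto)
qed

text \<open>The tangent ball now lies on the side of \<open>- e\<close>, and inversion about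
  \<open>- e\<close> turns its part in \<open>x \<bullet> f = 0\<close> into the interior of the
  flat slit near 0.\<close>

lemma expansion_vanishing_tangent_ball:
  fixes w :: "'a \<Rightarrow> real"
  assumes S: "open S" and harm: "harmonic_on S w" and C: "C \<ge> 0"
    and holder: "\<And>x y. x \<in> ball 0 1 \<Longrightarrow> y \<in> ball 0 1 \<Longrightarrow> \<bar>w x - w y\<bar> \<le> C * sqrt (norm (x - y))"
    and nonneg: "\<And>x. x \<in> ball 0 1 \<Longrightarrow> 0 \<le> w x" and w0: "w 0 = 0"
    and outside: "\<And>x. x \<in> ball 0 1 - S \<Longrightarrow> w x = 0"
    and vanish: "\<And>x. x \<in> ball 0 1 \<Longrightarrow> x \<bullet> f = 0 \<Longrightarrow> x \<bullet> x < - (x \<bullet> e) \<Longrightarrow> w x = 0"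
  shows "\<exists>\<alpha>\<ge>0. \<forall>\<epsilon>>0. \<exists>r>0. \<forall>x. norm x < r \<longrightarrow> \<bar>w x - \<alpha> * root x\<bar> \<le> \<epsilon> * sqrt (norm x)"
proof -
  have ne: "norm e = 1" using ee by (simp add: norm_eq_1)
  have nc: "norm (- e) = 1" using ne by simp
  note bounds = norm_center_bounds[OF nc] and inv_le = norm_inversion_le[OF nc]
  let ?W = "kelvin (- e) w"
  have in1: "inversion (- e) y \<in> ball 0 1" if "norm y < 1/4" for y
    using inv_le[OF that] that by simp
  from kelvin_holder[OF nc C w0 holder] obtain C' where C': "C' > 0"
    "\<And>x y. x \<in> ball 0 (1/4) \<Longrightarrow> y \<in> ball 0 (1/4) \<Longrightarrow> \<bar>?W x - ?W y\<bar> \<le> C' * sqrt (norm (x - y))"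
    by auto
  have Knn: "0 \<le> ?W y" if "y \<in> ball 0 (1/4)" for y
    using nonneg[OF in1[of y]] that by (simp add: kelvin_def)
  have open_zero: "?W y = 0" if y: "norm y < 1/4" "y \<bullet> f = 0" "0 < y \<bullet> e" for y
  proof -
    have "inversion (- e) y \<bullet> inversion (- e) y < - (inversion (- e) y \<bullet> e)"
      using inversion_ball_halfspace[OF nc bounds(3)[OF y(1)]] y(3) by (simp add: inner_commute)
    moreover have "inversion (- e) y \<bullet> f = 0"
      using y(2) by (simp add: inversion_def inner_add_left inner_diff_left ef)
    ultimately have "w (inversion (- e) y) = 0" using in1[OF y(1)] by (intro vanish) auto
    then show ?thesis by (simp add: kelvin_def)
  qed
  \<comment> \<open>The open ball covers only \<open>0 < y \<bullet> e\<close>; the edge is reached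
    by continuity, approaching along \<open>t *\<^sub>R e\<close> with \<open>t\<close> decreasing
    to 0.\<close>
  have zero: "?W y = 0" if y: "y \<in> ball 0 (1/4) \<inter> flip.slit" for y
  proof -
    have y': "norm y < 1/4" "y \<bullet> f = 0" "0 \<le> y \<bullet> e" using y by (auto simp: flip_slit)
    have "((\<lambda>t. y + t *\<^sub>R e) \<longlongrightarrow> y + 0 *\<^sub>R e) (at_right 0)"
      by (intro tendsto_intros)
    moreover have "continuous_on (ball 0 (1/4)) ?W" by (rule continuous_on_sqrt_holder[OF C'(2)])
    then have "isCont ?W y" using y by (auto simp: continuous_on_eq_continuous_at)
    ultimately have "((\<lambda>t. ?W (y + t *\<^sub>R e)) \<longlongrightarrow> ?W y) (at_right 0)"
      by (intro isCont_tendsto_compose[of y ?W]) auto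
    moreover have "\<forall>\<^sub>F t in at_right 0. ?W (y + t *\<^sub>R e) = 0"
      unfolding eventually_at_right_field
    proof (intro exI conjI allI impI)
      show "0 < 1/4 - norm y" using y' by simp
      fix t :: real assume t: "0 < t" "t < 1/4 - norm y"
      show "?W (y + t *\<^sub>R e) = 0"
        using t y' ne norm_triangle_ineq[of y "t *\<^sub>R e"] by (intro open_zero) (auto simp: inner_add_left ee ef)
    qed
    ultimately have "((\<lambda>t::real. 0) \<longlongrightarrow> ?W y) (at_right 0)"
      by (rule Lim_transform_eventually)
    then show ?thesis by (simp add: tendsto_const_iff)
  qed
  have Ksup: "supersol (\<lambda>y. - ?W y) y" if y: "y \<in> ball 0 (1/4) - flip.slit" for y
  proof -
    have y4: "norm y < 1/4" using y by simp
    show ?thesis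
    proof (cases "inversion (- e) y \<in> S")
      case True
      from kelvin_harmonic[OF S harm bounds(3)[OF y4] True] obtain d where "has_lap ?W y d 0" by blast
      from has_lap_cmult[OF this, of "- 1"] have "has_lap (\<lambda>y. - ?W y) y (- d) 0" by simp
      then show ?thesis by (rule supersol_lap) simp
    next
      case False
      \<comment> \<open>The zero set may extend beyond the tangent ball. At such a point the
        nonnegative transform attains the value 0, so the constant 0 touches its negative from
        above.\<close>
      then have "w (inversion (- e) y) = 0" using in1[OF y4] by (intro outside) auto
      then have W0: "?W y = 0" by (simp add: kelvin_def)
      have "\<forall>\<^sub>F z in nhds y. z \<in> ball 0 (1/4)" using y4 by (intro eventually_nhds_in_open) auto
      then have "\<forall>\<^sub>F z in nhds y. - ?W z \<le> 0" by eventually_elim (use Knn in simp)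
      then show ?thesis
        unfolding supersol_def using W0 by (intro exI[of _ "\<lambda>_. 0"] exI[of _ 0]) auto
    qed
  qed
  show ?thesis
  proof (rule flip.expansion_vanishing[of "1/4" C' ?W, OF _ C'(1) Knn zero Ksup C'(2)])
    fix \<alpha> assume \<alpha>: "\<alpha> \<ge> 0"
      and exp: "\<And>\<epsilon>. 0 < \<epsilon> \<Longrightarrow> \<exists>r>0. \<forall>x. norm x < r \<longrightarrow> \<bar>?W x - \<alpha> * flip.root x\<bar> \<le> \<epsilon> * sqrt (norm x)"
    have "\<forall>\<epsilon>>0. \<exists>r>0. \<forall>x. norm x < r \<longrightarrow> \<bar>w x - \<alpha> * root x\<bar> \<le> \<epsilon> * sqrt (norm x)"
      using kelvin_expansion_transfer[of "- e" "-1", OF _ _ \<alpha> exp] by simp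
    with \<alpha> show ?thesis by blast
  qed simp
qed

end

section \<open>The expansion at a free boundary point\<close>

lemma U_half_eq_csqrt: "U_half t s = Re (csqrt (Complex t s))"
proof -
  have "Re (csqrt z) = cmod (csqrt z) * cos (Arg (csqrt z))" for z
    using rcis_cmod_Arg[of "csqrt z"] Re_rcis[of "cmod (csqrt z)" "Arg (csqrt z)"] by simp
  then show ?thesis
    by (simp add: U_half_def norm_csqrt del: csqrt.simps)
qed

lemma U_expansionI:
  assumes "\<And>\<epsilon>. \<epsilon> > 0 \<Longrightarrow> \<exists>r>0. \<forall>x. norm x < r \<longrightarrow> \<bar>w x - \<alpha> * U n x\<bar> \<le> \<epsilon> * sqrt (norm x)"
  shows "U_expansion n w \<alpha>"
  unfolding U_expansion_def
proof (rule landau_o.smallI)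
  fix \<epsilon> :: real assume "\<epsilon> > 0"
  from assms[OF this] obtain r where "r > 0" "\<And>x. norm x < r \<Longrightarrow> \<bar>w x - \<alpha> * U n x\<bar> \<le> \<epsilon> * sqrt (norm x)"
    by blast
  then show "\<forall>\<^sub>F x in at 0. norm (w x - \<alpha> * U n x) \<le> \<epsilon> * norm (norm x powr (1/2))"
    unfolding eventually_at by (intro exI[of _ r]) (auto simp: powr_half_sqrt dist_norm)
qed

lemma open_Bplus:
  assumes "continuous_on (ball 0 1) w"
  shows "open (Bplus w)"
proof -
  have "Bplus w = (ball 0 1 \<inter> {X. snd X \<noteq> 0}) \<union> (ball 0 1 \<inter> w -` (- {0}))"
    by (auto simp: Bplus_def)
  moreover have "open (ball 0 1 \<inter> w -` (- {0}))"
    using assms by (intro continuous_open_preimage) auto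
  moreover have "open {X :: 'a \<times> real. snd X \<noteq> 0}"
    by (intro open_Collect_neq continuous_intros)
  ultimately show ?thesis by auto
qed

text \<open>By continuity the positivity set in the hyperplane is open, hence disjoint from its
  frontier.\<close>

lemma free_bdry_0:
  assumes cont: "continuous_on (ball 0 1) w" and nonneg: "0 \<le> w 0" and 0: "0 \<in> free_bdry w"
  shows "w 0 = 0"
proof -
  have "open (ball 0 1 \<inter> w -` {0<..})"
    using cont by (intro continuous_open_preimage) auto
  moreover have "continuous_on UNIV (\<lambda>x. (x, 0::real))"
    by (intro continuous_intros)
  ultimately have "open ((\<lambda>x. (x, 0)) -` (ball 0 1 \<inter> w -` {0<..}))"
    using open_vimage by blast
  moreover have "(\<lambda>x. (x, 0)) -` (ball 0 1 \<inter> w -` {0<..}) = {x \<in> ball 0 1. w (x, 0) > 0}"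
    by (auto simp: norm_Pair)
  ultimately have "open {x \<in> ball 0 1. w (x, 0) > 0}" by simp
  then have "0 \<notin> {x \<in> ball 0 1. w (x, 0) > 0}"
    using 0 by (auto simp: free_bdry_def frontier_def interior_open)
  then show ?thesis using nonneg by (simp add: zero_prod_def)
qed

text \<open>Puts the tangent ball into the form used by
  \<open>inversion_ball_halfspace\<close>.\<close>

lemma mem_ball_half:
  fixes e x :: "'a::euclidean_space"
  assumes "norm e = 1"
  shows "x \<in> ball ((1/2) *\<^sub>R e) (1/2) \<longleftrightarrow> x \<bullet> x < x \<bullet> e"
proof -
  have "x \<in> ball ((1/2) *\<^sub>R e) (1/2) \<longleftrightarrow> (norm (x - (1/2) *\<^sub>R e))\<^sup>2 < (1/2)\<^sup>2"
    by (auto simp: dist_norm norm_minus_commute intro: power_strict_mono dest: power_less_imp_less_base)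
  also have "(norm (x - (1/2) *\<^sub>R e))\<^sup>2 = x \<bullet> x - x \<bullet> e + (1/2)\<^sup>2"
    using assms unfolding power2_norm_eq_inner
    by (simp add: inner_diff_left inner_diff_right inner_commute norm_eq_1 power2_eq_square)
  finally show ?thesis by simp
qed

theorem lemma7p5:
  fixes w :: "(real ^ 'n) \<times> real \<Rightarrow> real" and n :: 'n
  assumes "holder_on (1/2) (ball 0 1) w"
    and "\<And>X. X \<in> ball 0 1 \<Longrightarrow> w X \<ge> 0"
    and "harmonic_on (Bplus w) w"
  shows "(0 \<in> free_bdry w \<and> ball ((1/2) *\<^sub>R axis n 1) (1/2) \<times> {0} \<subseteq> Bplus w
            \<longrightarrow> (\<exists>\<alpha>>0. U_expansion n w \<alpha>)) \<and>
         (0 \<in> free_bdry w \<and> ball (- (1/2) *\<^sub>R axis n 1) (1/2) \<times> {0} \<subseteq> zero_set w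
            \<longrightarrow> (\<exists>\<alpha>\<ge>0. U_expansion n w \<alpha>))"
proof -
  let ?a = "axis n 1 :: real ^ 'n"
  let ?e = "(?a, 0) :: (real ^ 'n) \<times> real"
  let ?f = "(0, 1) :: (real ^ 'n) \<times> real"
  interpret orthonormal_pair ?e ?f
    by unfold_locales (simp_all add: inner_axis_axis)
  have na: "norm ?a = 1" by simp
  from assms(1) obtain C0 where C0: "\<forall>x\<in>ball 0 1. \<forall>y\<in>ball 0 1. dist (w x) (w y) \<le> C0 * dist x y powr (1/2)"
    unfolding holder_on_def by blast
  define C where "C = max C0 0"
  have C: "C \<ge> 0" by (simp add: C_def)
  have holder: "\<bar>w x - w y\<bar> \<le> C * sqrt (norm (x - y))" if "x \<in> ball 0 1" "y \<in> ball 0 1" for x y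
  proof -
    have "\<bar>w x - w y\<bar> \<le> C0 * sqrt (norm (x - y))"
      using C0[rule_format, OF that] by (simp add: dist_norm powr_half_sqrt)
    also have "\<dots> \<le> C * sqrt (norm (x - y))" by (intro mult_right_mono) (auto simp: C_def)
    finally show ?thesis .
  qed
  have cont: "continuous_on (ball 0 1) w" by (rule continuous_on_sqrt_holder[OF holder])
  note S = open_Bplus[OF cont]
  have w0: "w 0 = 0" if "0 \<in> free_bdry w" using free_bdry_0[OF cont assms(2) that] by simp
  have U_root: "U n x = root x" for x
    by (simp add: U_def root_def proj_def U_half_eq_csqrt inner_prod_def inner_axis del: csqrt.simps)
  have inner_e: "x \<bullet> ?e = fst x \<bullet> ?a" and inner_f: "x \<bullet> ?f = snd x" for x
    by (simp_all add: inner_prod_def)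
  have outside: "snd x = 0 \<and> w x = 0" if "x \<in> ball 0 1 - Bplus w" for x
    using that by (auto simp: Bplus_def)
  show ?thesis
  proof (intro conjI impI; elim conjE)
    assume 0: "0 \<in> free_bdry w" and sub: "ball ((1/2) *\<^sub>R ?a) (1/2) \<times> {0} \<subseteq> Bplus w"
    \<comment> \<open>A point of the tangent ball with \<open>s = 0\<close>, where membership in
      \<open>Bplus w\<close> forces \<open>w\<close> to be nonzero; norm 1/64 meets the bound
      1/32.\<close>
    define x0 where "x0 = (1/64) *\<^sub>R ?e"
    have x0: "x0 = ((1/64) *\<^sub>R ?a, 0)" by (simp add: x0_def)
    have nx0: "norm x0 = 1/64" by (simp add: x0_def norm_Pair)
    have "(1/64) *\<^sub>R ?a \<in> ball ((1/2) *\<^sub>R ?a) (1/2)"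
      unfolding mem_ball_half[OF na] by (simp add: inner_axis_axis)
    then have "x0 \<in> Bplus w" using sub by (auto simp: x0)
    then have wx0: "w x0 \<noteq> 0" "x0 \<in> ball 0 1" by (auto simp: Bplus_def x0)
    have "\<exists>\<alpha>>0. \<forall>\<epsilon>>0. \<exists>r>0. \<forall>x. norm x < r \<longrightarrow> \<bar>w x - \<alpha> * root x\<bar> \<le> \<epsilon> * sqrt (norm x)"
    proof (rule expansion_positive_tangent_ball[OF S assms(3) C holder assms(2) w0[OF 0]])
      show "x0 \<noteq> 0" "norm x0 < 1/32" using nx0 by auto
      show "0 < w x0" using wx0 assms(2)[of x0] by simp
      fix x assume x: "x \<in> ball 0 1 - Bplus w"
      have "fst x \<notin> ball ((1/2) *\<^sub>R ?a) (1/2)"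
      proof
        assume "fst x \<in> ball ((1/2) *\<^sub>R ?a) (1/2)"
        then have "(fst x, 0) \<in> Bplus w" using sub by auto
        then show False using x outside[OF x] by (metis DiffD2 prod.collapse)
      qed
      then have "fst x \<bullet> ?a \<le> fst x \<bullet> fst x" unfolding mem_ball_half[OF na] by simp
      then show "x \<bullet> ?f = 0 \<and> x \<bullet> ?e \<le> x \<bullet> x"
        unfolding inner_e inner_f using outside[OF x] by (simp add: inner_prod_def)
    qed
    then show "\<exists>\<alpha>>0. U_expansion n w \<alpha>"
      by (auto intro!: U_expansionI simp: U_root)
  next
    assume 0: "0 \<in> free_bdry w" and sub: "ball (- (1/2) *\<^sub>R ?a) (1/2) \<times> {0} \<subseteq> zero_set w"
    have "\<exists>\<alpha>\<ge>0. \<forall>\<epsilon>>0. \<exists>r>0. \<forall>x. norm x < r \<longrightarrow> \<bar>w x - \<alpha> * root x\<bar> \<le> \<epsilon> * sqrt (norm x)"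
    proof (rule expansion_vanishing_tangent_ball[OF S assms(3) C holder assms(2) w0[OF 0]])
      show "w x = 0" if "x \<in> ball 0 1 - Bplus w" for x using outside[OF that] by simp
      fix x assume x: "x \<in> ball 0 1" "x \<bullet> ?f = 0" "x \<bullet> x < - (x \<bullet> ?e)"
      have "fst x \<in> ball ((1/2) *\<^sub>R (- ?a)) (1/2)"
        using x(2,3) unfolding inner_e inner_f mem_ball_half[of "- ?a", unfolded norm_minus_cancel, OF na]
        by (simp add: inner_prod_def)
      then have "(fst x, 0) \<in> zero_set w" using sub by auto
      moreover have "(fst x, 0) = x" using x(2) unfolding inner_f by (simp add: prod_eq_iff)
      ultimately show "w x = 0" by (simp add: zero_set_def)
    qed
    then show "\<exists>\<alpha>\<ge>0. U_expansion n w \<alpha>"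
      by (auto intro!: U_expansionI simp: U_root)
  qed
qed

end
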